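(* Let $p:\mathbb E\to\mathbb B$ be a fibration with fibred small (resp. large) limits, $\mathcal T=(T,\eta,\mu)$ a monad on $\mathbb B$, and $R:\mathbb A\to\mathbb B_{\mathcal T}$, $S:\mathbb A\to\mathbb E$ a lifting parameter for $\mathcal T$ with $\mathbb A$ small (resp. large). Then the tuple $(\dot T,\dot\eta,(-)^{\dot\#})$ of the pointwise codensity lifting (defined in the context) is a Kleisli triple on $\mathbb E$, and the corresponding monad is a lifting of $\mathcal T$ along $p$.
   Context: Juxtaposition denotes whiskering, $\bullet$ vertical composition. $J\dashv K$ ($K:\mathbb B_{\mathcal T}\to\mathbb B$) is the Kleisli resolution with counit $\epsilon$; $g^\#=\mu\circ Tg$. A lifting parameter is $R:\mathbb A\to\mathbb B_{\mathcal T}$, $S:\mathbb A\to\mathbb E$ with $KR=pS$. A lifting of $\mathcal T$ is a monad $(\dot T,\dot\eta,\dot\mu)$ on $\mathbb E$ with $p\dot T=Tp$, $p\dot\eta=\eta p$, $p\dot\mu=\mu p$. Pointwise codensity lifting: for $X\in\mathbb E$ let $X\downarrow S$ be the comma category (objects $(a,g:X\to Sa)$), $\pi_X:X\downarrow S\to\mathbb A$ the projection, $!:X\downarrow S\to1$, $\gamma_X:X!\to S\pi_X$ the canonical natural transformation (components $g$). Let $\delta_X=K\epsilon R\pi_X\bullet Tp\gamma_X:TpX!\to KR\pi_X$, and let $\overline{\delta_X}(S\pi_X):\delta_X^{-1}(S\pi_X)\to S\pi_X$ be a cartesian lifting of $\delta_X$ in the fibration $[X\downarrow S,p]$. Define $\dot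 TX=\lim\delta_X^{-1}(S\pi_X)$, the fibred limit in the fibre over $T(pX)$, with vertical projection $P_X:(\dot TX)!\to\delta_X^{-1}(S\pi_X)$; for $f:pY\to T(pX)$ and $h:Y!\to\delta_X^{-1}(S\pi_X)$ above $f!$, $\langle h\rangle:Y\to\dot TX$ denotes the induced morphism above $f$. Unit: $\eta'_X:X!\to\delta_X^{-1}(S\pi_X)$ is the unique natural transformation above $\eta pX!$ with $\overline{\delta_X}(S\pi_X)\bullet\eta'_X=\gamma_X$, and $\dot\eta_X=\langle\eta'_X\rangle$. Kleisli extension: for $g:X\to\dot TY$ put $f=P_Y\bullet g!:X!\to\delta_Y^{-1}(S\pi_Y)$; let $M_f:Y\downarrow S\to X\downarrow S$ be the unique functor with $\pi_XM_f=\pi_Y$ and $\gamma_XM_f=\overline{\delta_Y}(S\pi_Y)\bullet f$; let $f^\flat:\delta_X^{-1}(S\pi_X)M_f\to\delta_Y^{-1}(S\pi_Y)$ be the unique natural transformation above $(pg)^\#!$ with $\overline{\delta_Y}(S\pi_Y)\bullet f^\flat=\overline{\delta_X}(S\pi_X)M_f$; define $g^{\dot\#}=\langle f^\flat\bullet P_XM_f\rangle:\dot TX\to\dot TY$ (above $(pg)^\#$). *)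

theory Defs
  imports "HOL-Library.FuncSet"
begin

unbundle cardinal_syntax

record ('o, 'm) cat =
  Ob :: "'o set"
  Ar :: "'m set"
  Dom :: "'m \<Rightarrow> 'o"
  Cod :: "'m \<Rightarrow> 'o"
  Idn :: "'o \<Rightarrow> 'm"
  Cmp :: "'m \<Rightarrow> 'm \<Rightarrow> 'm"

definition hom :: "('o, 'm) cat \<Rightarrow> 'o \<Rightarrow> 'o \<Rightarrow> 'm set" where
  "hom C a b = {f \<in> Ar C. Dom C f = a \<and> Cod C f = b}"

definition is_cat :: "('o, 'm) cat \<Rightarrow> bool" where
  "is_cat C \<longleftrightarrow>
     (\<forall>f\<in>Ar C. Dom C f \<in> Ob C \<and> Cod C f \<in> Ob C) \<and>
     (\<forall>a\<in>Ob C. Idn C a \<in> hom C a a) \<and>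
     (\<forall>a\<in>Ob C. \<forall>b\<in>Ob C. \<forall>c\<in>Ob C. \<forall>f\<in>hom C a b. \<forall>g\<in>hom C b c. Cmp C g f \<in> hom C a c) \<and>
     (\<forall>a\<in>Ob C. \<forall>b\<in>Ob C. \<forall>f\<in>hom C a b. Cmp C f (Idn C a) = f \<and> Cmp C (Idn C b) f = f) \<and>
     (\<forall>a\<in>Ob C. \<forall>b\<in>Ob C. \<forall>c\<in>Ob C. \<forall>d\<in>Ob C.
        \<forall>f\<in>hom C a b. \<forall>g\<in>hom C b c. \<forall>h\<in>hom C c d.
          Cmp C h (Cmp C g f) = Cmp C (Cmp C h g) f)"

text \<open>Functors and natural transformations carry their source and target, and their maps are
  extensional (undefined off the carriers).  Hence equality of such records is equality of functors
  and of natural transformations, and the equations and ``the unique \<dots>'' clauses below can be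
  stated with plain \<open>=\<close> and \<open>THE\<close>.\<close>

record ('o1, 'm1, 'o2, 'm2) funct =
  Src :: "('o1, 'm1) cat"
  Tgt :: "('o2, 'm2) cat"
  FO :: "'o1 \<Rightarrow> 'o2"
  FA :: "'m1 \<Rightarrow> 'm2"

definition is_functor ::
    "('o1, 'm1) cat \<Rightarrow> ('o2, 'm2) cat \<Rightarrow> ('o1, 'm1, 'o2, 'm2) funct \<Rightarrow> bool" where
  "is_functor C D F \<longleftrightarrow>
     is_cat C \<and> is_cat D \<and> Src F = C \<and> Tgt F = D \<and>
     FO F \<in> extensional (Ob C) \<and> FA F \<in> extensional (Ar C) \<and>
     (\<forall>a\<in>Ob C. FO F a \<in> Ob D) \<and>
     (\<forall>a\<in>Ob C. \<forall>b\<in>Ob C. \<forall>f\<in>hom C a b. FA F f \<in> hom D (FO F a) (FO F b)) \<and>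
     (\<forall>a\<in>Ob C. FA F (Idn C a) = Idn D (FO F a)) \<and>
     (\<forall>a\<in>Ob C. \<forall>b\<in>Ob C. \<forall>c\<in>Ob C. \<forall>f\<in>hom C a b. \<forall>g\<in>hom C b c.
        FA F (Cmp C g f) = Cmp D (FA F g) (FA F f))"

definition id_functor :: "('o, 'm) cat \<Rightarrow> ('o, 'm, 'o, 'm) funct" where
  "id_functor C = \<lparr>Src = C, Tgt = C, FO = restrict (\<lambda>a. a) (Ob C), FA = restrict (\<lambda>f. f) (Ar C)\<rparr>"

definition fcomp ::
    "('o2, 'm2, 'o3, 'm3) funct \<Rightarrow> ('o1, 'm1, 'o2, 'm2) funct \<Rightarrow> ('o1, 'm1, 'o3, 'm3) funct"
    (infixl "\<odot>" 75) where
  "G \<odot> F = \<lparr>Src = Src F, Tgt = Tgt G,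
            FO = restrict (\<lambda>a. FO G (FO F a)) (Ob (Src F)),
            FA = restrict (\<lambda>f. FA G (FA F f)) (Ar (Src F))\<rparr>"

text \<open>\<open>const_functor D C X\<close> is the composite written \<open>X!\<close>, where \<open>! : D \<rightarrow> 1\<close>.\<close>

definition const_functor ::
    "('o1, 'm1) cat \<Rightarrow> ('o2, 'm2) cat \<Rightarrow> 'o2 \<Rightarrow> ('o1, 'm1, 'o2, 'm2) funct" where
  "const_functor D C X = \<lparr>Src = D, Tgt = C,
     FO = restrict (\<lambda>_. X) (Ob D), FA = restrict (\<lambda>_. Idn C X) (Ar D)\<rparr>"

record ('o1, 'm1, 'o2, 'm2) ntrans =
  NSrc :: "('o1, 'm1, 'o2, 'm2) funct"
  NTgt :: "('o1, 'm1, 'o2, 'm2) funct"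
  Comp :: "'o1 \<Rightarrow> 'm2"

definition is_nat ::
    "('o1, 'm1, 'o2, 'm2) funct \<Rightarrow> ('o1, 'm1, 'o2, 'm2) funct \<Rightarrow> ('o1, 'm1, 'o2, 'm2) ntrans \<Rightarrow> bool"
    where
  "is_nat F G \<alpha> \<longleftrightarrow>
     Src F = Src G \<and> Tgt F = Tgt G \<and>
     is_functor (Src F) (Tgt F) F \<and> is_functor (Src G) (Tgt G) G \<and>
     NSrc \<alpha> = F \<and> NTgt \<alpha> = G \<and> Comp \<alpha> \<in> extensional (Ob (Src F)) \<and>
     (\<forall>a\<in>Ob (Src F). Comp \<alpha> a \<in> hom (Tgt F) (FO F a) (FO G a)) \<and>
     (\<forall>a\<in>Ob (Src F). \<forall>b\<in>Ob (Src F). \<forall>f\<in>hom (Src F) a b.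
        Cmp (Tgt F) (Comp \<alpha> b) (FA F f) = Cmp (Tgt F) (FA G f) (Comp \<alpha> a))"

definition id_nat :: "('o1, 'm1, 'o2, 'm2) funct \<Rightarrow> ('o1, 'm1, 'o2, 'm2) ntrans" where
  "id_nat F = \<lparr>NSrc = F, NTgt = F, Comp = restrict (\<lambda>a. Idn (Tgt F) (FO F a)) (Ob (Src F))\<rparr>"

definition vcomp ::
    "('o1, 'm1, 'o2, 'm2) ntrans \<Rightarrow> ('o1, 'm1, 'o2, 'm2) ntrans \<Rightarrow> ('o1, 'm1, 'o2, 'm2) ntrans"
    (infixl "\<bullet>" 65) where
  "\<beta> \<bullet> \<alpha> = \<lparr>NSrc = NSrc \<alpha>, NTgt = NTgt \<beta>,
     Comp = restrict (\<lambda>a. Cmp (Tgt (NTgt \<beta>)) (Comp \<beta> a) (Comp \<alpha> a)) (Ob (Src (NSrc \<alpha>)))\<rparr>"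

text \<open>Whiskering: \<open>F \<lhd> \<alpha>\<close> is \<open>F\<alpha>\<close> (a functor after \<open>\<alpha>\<close>), \<open>\<alpha> \<rhd> G\<close> is \<open>\<alpha>G\<close> (a functor before \<open>\<alpha>\<close>).\<close>

definition whiskL ::
    "('o2, 'm2, 'o3, 'm3) funct \<Rightarrow> ('o1, 'm1, 'o2, 'm2) ntrans \<Rightarrow> ('o1, 'm1, 'o3, 'm3) ntrans"
    (infixr "\<lhd>" 70) where
  "F \<lhd> \<alpha> = \<lparr>NSrc = F \<odot> NSrc \<alpha>, NTgt = F \<odot> NTgt \<alpha>,
     Comp = restrict (\<lambda>a. FA F (Comp \<alpha> a)) (Ob (Src (NSrc \<alpha>)))\<rparr>"

definition whiskR ::
    "('o2, 'm2, 'o3, 'm3) ntrans \<Rightarrow> ('o1, 'm1, 'o2, 'm2) funct \<Rightarrow> ('o1, 'm1, 'o3, 'm3) ntrans"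
    (infixl "\<rhd>" 71) where
  "\<alpha> \<rhd> G = \<lparr>NSrc = NSrc \<alpha> \<odot> G, NTgt = NTgt \<alpha> \<odot> G,
     Comp = restrict (\<lambda>a. Comp \<alpha> (FO G a)) (Ob (Src G))\<rparr>"

text \<open>\<open>const_nat D C f\<close> is \<open>f! : X! \<rightarrow> Y!\<close> for \<open>f : X \<rightarrow> Y\<close>.\<close>

definition const_nat ::
    "('o1, 'm1) cat \<Rightarrow> ('o2, 'm2) cat \<Rightarrow> 'm2 \<Rightarrow> ('o1, 'm1, 'o2, 'm2) ntrans" where
  "const_nat D C f = \<lparr>NSrc = const_functor D C (Dom C f), NTgt = const_functor D C (Cod C f),
     Comp = restrict (\<lambda>_. f) (Ob D)\<rparr>"

definition functor_cat ::
    "('o1, 'm1) cat \<Rightarrow> ('o2, 'm2) cat \<Rightarrow>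
     (('o1, 'm1, 'o2, 'm2) funct, ('o1, 'm1, 'o2, 'm2) ntrans) cat" where
  "functor_cat D C = \<lparr>Ob = {F. is_functor D C F},
     Ar = {\<alpha>. is_functor D C (NSrc \<alpha>) \<and> is_functor D C (NTgt \<alpha>) \<and> is_nat (NSrc \<alpha>) (NTgt \<alpha>) \<alpha>},
     Dom = NSrc, Cod = NTgt, Idn = id_nat, Cmp = (\<bullet>)\<rparr>"

definition functor_cat_map ::
    "('o1, 'm1) cat \<Rightarrow> ('o2, 'm2, 'o3, 'm3) funct \<Rightarrow>
     (('o1, 'm1, 'o2, 'm2) funct, ('o1, 'm1, 'o2, 'm2) ntrans,
      ('o1, 'm1, 'o3, 'm3) funct, ('o1, 'm1, 'o3, 'm3) ntrans) funct" where
  "functor_cat_map D p = \<lparr>Src = functor_cat D (Src p), Tgt = functor_cat D (Tgt p),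
     FO = restrict (\<lambda>F. p \<odot> F) (Ob (functor_cat D (Src p))),
     FA = restrict (\<lambda>\<alpha>. p \<lhd> \<alpha>) (Ar (functor_cat D (Src p)))\<rparr>"

definition cartesian :: "('eo, 'em, 'bo, 'bm) funct \<Rightarrow> 'em \<Rightarrow> bool" where
  "cartesian p h \<longleftrightarrow> h \<in> Ar (Src p) \<and>
     (\<forall>g\<in>Ar (Src p). \<forall>v\<in>hom (Tgt p) (FO p (Dom (Src p) g)) (FO p (Dom (Src p) h)).
        Cod (Src p) g = Cod (Src p) h \<and> FA p g = Cmp (Tgt p) (FA p h) v \<longrightarrow>
        (\<exists>!w. w \<in> hom (Src p) (Dom (Src p) g) (Dom (Src p) h) \<and>
              FA p w = v \<and> Cmp (Src p) h w = g))"

definition cartesian_lifting :: "('eo, 'em, 'bo, 'bm) funct \<Rightarrow> 'bm \<Rightarrow> 'eo \<Rightarrow> 'em \<Rightarrow> bool" where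
  "cartesian_lifting p u X h \<longleftrightarrow> cartesian p h \<and> Cod (Src p) h = X \<and> FA p h = u"

definition fibration ::
    "('eo, 'em) cat \<Rightarrow> ('bo, 'bm) cat \<Rightarrow> ('eo, 'em, 'bo, 'bm) funct \<Rightarrow> bool" where
  "fibration E B p \<longleftrightarrow> is_functor E B p \<and>
     (\<forall>X\<in>Ob E. \<forall>I\<in>Ob B. \<forall>u\<in>hom B I (FO p X). \<exists>h. cartesian_lifting p u X h)"

text \<open>A diagram in the fibre \<open>E\<^sub>I\<close> is a functor \<open>F : D \<rightarrow> E\<close> with \<open>pF = I!\<close>; a cone in \<open>E\<^sub>I\<close> is a cone
  whose components are vertical, i.e. sent to \<open>id I\<close> by \<open>p\<close>.\<close>

definition fibre_diagram ::
    "('eo, 'em, 'bo, 'bm) funct \<Rightarrow> ('do, 'dm) cat \<Rightarrow> 'bo \<Rightarrow> ('do, 'dm, 'eo, 'em) funct \<Rightarrow> bool" where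
  "fibre_diagram p D I F \<longleftrightarrow>
     I \<in> Ob (Tgt p) \<and> is_functor D (Src p) F \<and> p \<odot> F = const_functor D (Tgt p) I"

definition fibre_cone ::
    "('eo, 'em, 'bo, 'bm) funct \<Rightarrow> ('do, 'dm) cat \<Rightarrow> 'bo \<Rightarrow> ('do, 'dm, 'eo, 'em) funct \<Rightarrow> 'eo \<Rightarrow>
     ('do, 'dm, 'eo, 'em) ntrans \<Rightarrow> bool" where
  "fibre_cone p D I F L \<theta> \<longleftrightarrow>
     L \<in> Ob (Src p) \<and> FO p L = I \<and> is_nat (const_functor D (Src p) L) F \<theta> \<and>
     p \<lhd> \<theta> = const_nat D (Tgt p) (Idn (Tgt p) I)"

definition fibre_limit ::
    "('eo, 'em, 'bo, 'bm) funct \<Rightarrow> ('do, 'dm) cat \<Rightarrow> 'bo \<Rightarrow> ('do, 'dm, 'eo, 'em) funct \<Rightarrow> 'eo \<Rightarrow>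
     ('do, 'dm, 'eo, 'em) ntrans \<Rightarrow> bool" where
  "fibre_limit p D I F L \<theta> \<longleftrightarrow>
     fibre_diagram p D I F \<and> fibre_cone p D I F L \<theta> \<and>
     (\<forall>Y \<kappa>. fibre_cone p D I F Y \<kappa> \<longrightarrow>
        (\<exists>!k. k \<in> hom (Src p) Y L \<and> FA p k = Idn (Tgt p) I \<and>
              \<theta> \<bullet> const_nat D (Src p) k = \<kappa>))"

text \<open>\<open>G\<close> is the image \<open>u\<^sup>*F\<close> of the diagram \<open>F\<close> in \<open>E\<^sub>I\<close> under reindexing along \<open>u : J \<rightarrow> I\<close>, for the
  choice of cartesian liftings given by the components of \<open>\<rho> : u\<^sup>*F \<rightarrow> F\<close>.\<close>

definition reindexed_diagram ::
    "('eo, 'em, 'bo, 'bm) funct \<Rightarrow> ('do, 'dm) cat \<Rightarrow> 'bo \<Rightarrow> 'bm \<Rightarrow> ('do, 'dm, 'eo, 'em) funct \<Rightarrow>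
     ('do, 'dm, 'eo, 'em) funct \<Rightarrow> ('do, 'dm, 'eo, 'em) ntrans \<Rightarrow> bool" where
  "reindexed_diagram p D J u F G \<rho> \<longleftrightarrow>
     fibre_diagram p D J G \<and> is_nat G F \<rho> \<and>
     (\<forall>d\<in>Ob D. cartesian_lifting p u (FO F d) (Comp \<rho> d))"

text \<open>Fibred \<open>D\<close>-limits: every fibre has \<open>D\<close>-limits and the reindexing functors preserve them.  In the
  second clause \<open>l : L' \<rightarrow> L\<close> exhibits \<open>L' = u\<^sup>*L\<close> and \<open>\<theta>'\<close> is the reindexed cone \<open>u\<^sup>*\<theta>\<close>; since all
  cartesian liftings are allowed, this is preservation by every reindexing functor.\<close>

definition has_fibred_limits ::
    "('eo, 'em, 'bo, 'bm) funct \<Rightarrow> ('do, 'dm) cat \<Rightarrow> bool" where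
  "has_fibred_limits p D \<longleftrightarrow>
     (\<forall>I F. fibre_diagram p D I F \<longrightarrow> (\<exists>L \<theta>. fibre_limit p D I F L \<theta>)) \<and>
     (\<forall>I J u F L \<theta> G \<rho> L' l \<theta>'.
        fibre_limit p D I F L \<theta> \<and> u \<in> hom (Tgt p) J I \<and>
        reindexed_diagram p D J u F G \<rho> \<and>
        l \<in> hom (Src p) L' L \<and> cartesian_lifting p u L l \<and>
        fibre_cone p D J G L' \<theta>' \<and> \<rho> \<bullet> \<theta>' = \<theta> \<bullet> const_nat D (Src p) l
        \<longrightarrow> fibre_limit p D J G L' \<theta>')"

text \<open>The universe is a type \<open>'u\<close> of infinite regular cardinality.  Following limitation of size, a set
  is small if it is of smaller cardinality than \<open>'u\<close>, and large if it is equipotent with a subset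
  (``class'') of \<open>'u\<close>; small sets are thus in particular large.  A Grothendieck universe is a special
  case (inaccessible cardinality), but nothing beyond regularity is required.\<close>

definition size_universe :: "'u itself \<Rightarrow> bool" where
  "size_universe U \<longleftrightarrow> infinite (UNIV :: 'u set) \<and> regularCard |UNIV :: 'u set|"

definition small :: "'u itself \<Rightarrow> 'x set \<Rightarrow> bool" where
  "small U X \<longleftrightarrow> |X| <o |UNIV :: 'u set|"

definition large :: "'u itself \<Rightarrow> 'x set \<Rightarrow> bool" where
  "large U X \<longleftrightarrow> |X| \<le>o |UNIV :: 'u set|"

definition small_cat :: "'u itself \<Rightarrow> ('o, 'm) cat \<Rightarrow> bool" where
  "small_cat U C \<longleftrightarrow> is_cat C \<and> small U (Ob C) \<and> small U (Ar C)"

definition large_cat :: "'u itself \<Rightarrow> ('o, 'm) cat \<Rightarrow> bool" where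
  "large_cat U C \<longleftrightarrow> is_cat C \<and> large U (Ob C) \<and> large U (Ar C)"

definition small_homs :: "'u itself \<Rightarrow> ('o, 'm) cat \<Rightarrow> bool" where
  "small_homs U C \<longleftrightarrow> (\<forall>a\<in>Ob C. \<forall>b\<in>Ob C. small U (hom C a b))"

definition large_homs :: "'u itself \<Rightarrow> ('o, 'm) cat \<Rightarrow> bool" where
  "large_homs U C \<longleftrightarrow> (\<forall>a\<in>Ob C. \<forall>b\<in>Ob C. large U (hom C a b))"

text \<open>Every small (large) category is isomorphic to one with objects and arrows in \<open>'u\<close>, so it is
  enough to let the shapes range over the latter.\<close>

definition has_fibred_small_limits :: "'u itself \<Rightarrow> ('eo, 'em, 'bo, 'bm) funct \<Rightarrow> bool" where
  "has_fibred_small_limits U p \<longleftrightarrow>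
     (\<forall>D :: ('u, 'u) cat. small_cat U D \<longrightarrow> has_fibred_limits p D)"

definition has_fibred_large_limits :: "'u itself \<Rightarrow> ('eo, 'em, 'bo, 'bm) funct \<Rightarrow> bool" where
  "has_fibred_large_limits U p \<longleftrightarrow>
     (\<forall>D :: ('u, 'u) cat. large_cat U D \<longrightarrow> has_fibred_limits p D)"

record ('o, 'm) monad =
  MF :: "('o, 'm, 'o, 'm) funct"
  Mu :: "('o, 'm, 'o, 'm) ntrans"
  Eta :: "('o, 'm, 'o, 'm) ntrans"

definition is_monad :: "('o, 'm) cat \<Rightarrow> ('o, 'm) monad \<Rightarrow> bool" where
  "is_monad C M \<longleftrightarrow>
     is_functor C C (MF M) \<and>
     is_nat (id_functor C) (MF M) (Eta M) \<and>
     is_nat (MF M \<odot> MF M) (MF M) (Mu M) \<and>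
     Mu M \<bullet> (MF M \<lhd> Eta M) = id_nat (MF M) \<and>
     Mu M \<bullet> (Eta M \<rhd> MF M) = id_nat (MF M) \<and>
     Mu M \<bullet> (MF M \<lhd> Mu M) = Mu M \<bullet> (Mu M \<rhd> MF M)"

text \<open>\<open>ext X Y g : T0 X \<rightarrow> T0 Y\<close> is the Kleisli extension of \<open>g : X \<rightarrow> T0 Y\<close>.\<close>

definition kleisli_triple ::
    "('o, 'm) cat \<Rightarrow> ('o \<Rightarrow> 'o) \<Rightarrow> ('o \<Rightarrow> 'm) \<Rightarrow> ('o \<Rightarrow> 'o \<Rightarrow> 'm \<Rightarrow> 'm) \<Rightarrow> bool" where
  "kleisli_triple C T0 \<eta> ext \<longleftrightarrow>
     is_cat C \<and>
     (\<forall>X\<in>Ob C. T0 X \<in> Ob C \<and> \<eta> X \<in> hom C X (T0 X)) \<and>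
     (\<forall>X\<in>Ob C. \<forall>Y\<in>Ob C. \<forall>g\<in>hom C X (T0 Y). ext X Y g \<in> hom C (T0 X) (T0 Y)) \<and>
     (\<forall>X\<in>Ob C. ext X X (\<eta> X) = Idn C (T0 X)) \<and>
     (\<forall>X\<in>Ob C. \<forall>Y\<in>Ob C. \<forall>g\<in>hom C X (T0 Y). Cmp C (ext X Y g) (\<eta> X) = g) \<and>
     (\<forall>X\<in>Ob C. \<forall>Y\<in>Ob C. \<forall>Z\<in>Ob C. \<forall>f\<in>hom C X (T0 Y). \<forall>g\<in>hom C Y (T0 Z).
        ext X Z (Cmp C (ext Y Z g) f) = Cmp C (ext Y Z g) (ext X Y f))"

definition monad_of_kleisli_triple ::
    "('o, 'm) cat \<Rightarrow> ('o \<Rightarrow> 'o) \<Rightarrow> ('o \<Rightarrow> 'm) \<Rightarrow> ('o \<Rightarrow> 'o \<Rightarrow> 'm \<Rightarrow> 'm) \<Rightarrow> ('o, 'm) monad" where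
  "monad_of_kleisli_triple C T0 \<eta> ext =
     (let F = \<lparr>Src = C, Tgt = C, FO = restrict T0 (Ob C),
               FA = restrict (\<lambda>f. ext (Dom C f) (Cod C f) (Cmp C (\<eta> (Cod C f)) f)) (Ar C)\<rparr>
      in \<lparr>MF = F,
          Mu = \<lparr>NSrc = F \<odot> F, NTgt = F,
                Comp = restrict (\<lambda>X. ext (T0 X) X (Idn C (T0 X))) (Ob C)\<rparr>,
          Eta = \<lparr>NSrc = id_functor C, NTgt = F, Comp = restrict \<eta> (Ob C)\<rparr>\<rparr>)"

text \<open>\<open>bind_ext M J f\<close> is \<open>f\<^sup># = \<mu>\<^sub>J \<circ> T f\<close> for \<open>f : I \<rightarrow> T J\<close>.\<close>

definition bind_ext :: "('o, 'm) monad \<Rightarrow> 'o \<Rightarrow> 'm \<Rightarrow> 'm" where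
  "bind_ext M J f = Cmp (Src (MF M)) (Comp (Mu M) J) (FA (MF M) f)"

text \<open>An arrow \<open>I \<rightarrow> J\<close> of the Kleisli category is a pair \<open>(f, J)\<close> with \<open>f : I \<rightarrow> T J\<close>; the second
  component is needed because \<open>T J\<close> does not determine \<open>J\<close>.\<close>

definition kleisli_cat :: "('o, 'm) monad \<Rightarrow> ('o, 'm \<times> 'o) cat" where
  "kleisli_cat M =
     (let C = Src (MF M) in
      \<lparr>Ob = Ob C,
       Ar = {(f, J). f \<in> Ar C \<and> J \<in> Ob C \<and> Cod C f = FO (MF M) J},
       Dom = (\<lambda>(f, J). Dom C f),
       Cod = (\<lambda>(f, J). J),
       Idn = (\<lambda>I. (Comp (Eta M) I, I)),
       Cmp = (\<lambda>(g, L) (f, J). (Cmp C (bind_ext M L g) f, L))\<rparr>)"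

definition kleisli_J :: "('o, 'm) monad \<Rightarrow> ('o, 'm, 'o, 'm \<times> 'o) funct" where
  "kleisli_J M =
     (let C = Src (MF M) in
      \<lparr>Src = C, Tgt = kleisli_cat M, FO = restrict (\<lambda>I. I) (Ob C),
       FA = restrict (\<lambda>f. (Cmp C (Comp (Eta M) (Cod C f)) f, Cod C f)) (Ar C)\<rparr>)"

definition kleisli_K :: "('o, 'm) monad \<Rightarrow> ('o, 'm \<times> 'o, 'o, 'm) funct" where
  "kleisli_K M =
     \<lparr>Src = kleisli_cat M, Tgt = Src (MF M),
      FO = restrict (FO (MF M)) (Ob (kleisli_cat M)),
      FA = restrict (\<lambda>(f, J). bind_ext M J f) (Ar (kleisli_cat M))\<rparr>"

definition kleisli_counit :: "('o, 'm) monad \<Rightarrow> ('o, 'm \<times> 'o, 'o, 'm \<times> 'o) ntrans" where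
  "kleisli_counit M =
     \<lparr>NSrc = kleisli_J M \<odot> kleisli_K M, NTgt = id_functor (kleisli_cat M),
      Comp = restrict (\<lambda>J. (Idn (Src (MF M)) (FO (MF M) J), J)) (Ob (kleisli_cat M))\<rparr>"

definition lifting_parameter ::
    "('ao, 'am) cat \<Rightarrow> ('eo, 'em) cat \<Rightarrow> ('eo, 'em, 'bo, 'bm) funct \<Rightarrow> ('bo, 'bm) monad \<Rightarrow>
     ('ao, 'am, 'bo, 'bm \<times> 'bo) funct \<Rightarrow> ('ao, 'am, 'eo, 'em) funct \<Rightarrow> bool" where
  "lifting_parameter A E p M R S \<longleftrightarrow>
     is_functor A (kleisli_cat M) R \<and> is_functor A E S \<and> kleisli_K M \<odot> R = p \<odot> S"

definition monad_lifting ::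
    "('eo, 'em) cat \<Rightarrow> ('eo, 'em, 'bo, 'bm) funct \<Rightarrow> ('bo, 'bm) monad \<Rightarrow> ('eo, 'em) monad \<Rightarrow> bool"
    where
  "monad_lifting E p M M' \<longleftrightarrow>
     is_monad E M' \<and> p \<odot> MF M' = MF M \<odot> p \<and>
     p \<lhd> Eta M' = Eta M \<rhd> p \<and> p \<lhd> Mu M' = Mu M \<rhd> p"

text \<open>The comma category \<open>X \<down> S\<close>.  An arrow carries its domain and codomain: it is a triple
  \<open>((a, g), f, (b, h))\<close> with \<open>f : a \<rightarrow> b\<close> and \<open>S f \<circ> g = h\<close>.\<close>

definition comma ::
    "('ao, 'am, 'eo, 'em) funct \<Rightarrow> 'eo \<Rightarrow> ('ao \<times> 'em, ('ao \<times> 'em) \<times> 'am \<times> ('ao \<times> 'em)) cat" where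
  "comma S X =
     (let A = Src S; E = Tgt S; Obs = {(a, g). a \<in> Ob A \<and> g \<in> hom E X (FO S a)} in
      \<lparr>Ob = Obs,
       Ar = {(i, f, j). i \<in> Obs \<and> j \<in> Obs \<and> f \<in> hom A (fst i) (fst j) \<and>
                        Cmp E (FA S f) (snd i) = snd j},
       Dom = (\<lambda>(i, f, j). i),
       Cod = (\<lambda>(i, f, j). j),
       Idn = (\<lambda>i. (i, Idn A (fst i), i)),
       Cmp = (\<lambda>(j', f', k) (i, f, j). (i, Cmp A f' f, k))\<rparr>)"

definition comma_proj ::
    "('ao, 'am, 'eo, 'em) funct \<Rightarrow> 'eo \<Rightarrow>
     ('ao \<times> 'em, ('ao \<times> 'em) \<times> 'am \<times> ('ao \<times> 'em), 'ao, 'am) funct" where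
  "comma_proj S X =
     \<lparr>Src = comma S X, Tgt = Src S,
      FO = restrict fst (Ob (comma S X)),
      FA = restrict (\<lambda>(i, f, j). f) (Ar (comma S X))\<rparr>"

definition comma_gamma ::
    "('ao, 'am, 'eo, 'em) funct \<Rightarrow> 'eo \<Rightarrow>
     ('ao \<times> 'em, ('ao \<times> 'em) \<times> 'am \<times> ('ao \<times> 'em), 'eo, 'em) ntrans" where
  "comma_gamma S X =
     \<lparr>NSrc = const_functor (comma S X) (Tgt S) X, NTgt = S \<odot> comma_proj S X,
      Comp = restrict snd (Ob (comma S X))\<rparr>"

definition codensity_delta ::
    "('eo, 'em, 'bo, 'bm) funct \<Rightarrow> ('bo, 'bm) monad \<Rightarrow>
     ('ao, 'am, 'bo, 'bm \<times> 'bo) funct \<Rightarrow> ('ao, 'am, 'eo, 'em) funct \<Rightarrow> 'eo \<Rightarrow>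
     ('ao \<times> 'em, ('ao \<times> 'em) \<times> 'am \<times> ('ao \<times> 'em), 'bo, 'bm) ntrans" where
  "codensity_delta p M R S X =
     ((kleisli_K M \<lhd> kleisli_counit M) \<rhd> (R \<odot> comma_proj S X)) \<bullet>
     ((MF M \<odot> p) \<lhd> comma_gamma S X)"

text \<open>The choices entering the construction: for each \<open>X\<close> a cartesian lifting \<open>db X\<close> of \<open>\<delta>\<^sub>X\<close> to
  \<open>S\<pi>\<^sub>X\<close> in \<open>[X \<down> S, p]\<close>, whose domain \<open>NSrc (db X)\<close> is \<open>\<delta>\<^sub>X\<inverse>(S\<pi>\<^sub>X)\<close>, and a limit \<open>Td X\<close> of that domain
  in the fibre over \<open>T(pX)\<close>, with projection \<open>P X\<close>.\<close>

definition codensity_data ::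
    "('eo, 'em) cat \<Rightarrow> ('eo, 'em, 'bo, 'bm) funct \<Rightarrow> ('bo, 'bm) monad \<Rightarrow>
     ('ao, 'am, 'bo, 'bm \<times> 'bo) funct \<Rightarrow> ('ao, 'am, 'eo, 'em) funct \<Rightarrow>
     ('eo \<Rightarrow> ('ao \<times> 'em, ('ao \<times> 'em) \<times> 'am \<times> ('ao \<times> 'em), 'eo, 'em) ntrans) \<Rightarrow>
     ('eo \<Rightarrow> 'eo) \<Rightarrow>
     ('eo \<Rightarrow> ('ao \<times> 'em, ('ao \<times> 'em) \<times> 'am \<times> ('ao \<times> 'em), 'eo, 'em) ntrans) \<Rightarrow> bool" where
  "codensity_data E p M R S db Td P \<longleftrightarrow>
     (\<forall>X\<in>Ob E.
        cartesian_lifting (functor_cat_map (comma S X) p)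
          (codensity_delta p M R S X) (S \<odot> comma_proj S X) (db X) \<and>
        fibre_limit p (comma S X) (FO (MF M) (FO p X)) (NSrc (db X)) (Td X) (P X))"

text \<open>\<open>induced p D L \<theta> Y f h\<close> is the arrow \<open>\<langle>h\<rangle> : Y \<rightarrow> L\<close> above \<open>f\<close> induced by \<open>h : Y! \<rightarrow> F\<close> above \<open>f!\<close>,
  where \<open>\<theta> : L! \<rightarrow> F\<close> is a fibred limit cone.\<close>

definition induced ::
    "('eo, 'em, 'bo, 'bm) funct \<Rightarrow> ('do, 'dm) cat \<Rightarrow> 'eo \<Rightarrow> ('do, 'dm, 'eo, 'em) ntrans \<Rightarrow>
     'eo \<Rightarrow> 'bm \<Rightarrow> ('do, 'dm, 'eo, 'em) ntrans \<Rightarrow> 'em" where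
  "induced p D L \<theta> Y f h =
     (THE k. k \<in> hom (Src p) Y L \<and> FA p k = f \<and> \<theta> \<bullet> const_nat D (Src p) k = h)"

definition codensity_eta' ::
    "('eo, 'em, 'bo, 'bm) funct \<Rightarrow> ('bo, 'bm) monad \<Rightarrow> ('ao, 'am, 'eo, 'em) funct \<Rightarrow>
     ('eo \<Rightarrow> ('ao \<times> 'em, ('ao \<times> 'em) \<times> 'am \<times> ('ao \<times> 'em), 'eo, 'em) ntrans) \<Rightarrow> 'eo \<Rightarrow>
     ('ao \<times> 'em, ('ao \<times> 'em) \<times> 'am \<times> ('ao \<times> 'em), 'eo, 'em) ntrans" where
  "codensity_eta' p M S db X =
     (THE n. is_nat (const_functor (comma S X) (Src p) X) (NSrc (db X)) n \<and>
             p \<lhd> n = const_nat (comma S X) (Tgt p) (Comp (Eta M) (FO p X)) \<and>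
             db X \<bullet> n = comma_gamma S X)"

definition codensity_eta ::
    "('eo, 'em, 'bo, 'bm) funct \<Rightarrow> ('bo, 'bm) monad \<Rightarrow> ('ao, 'am, 'eo, 'em) funct \<Rightarrow>
     ('eo \<Rightarrow> ('ao \<times> 'em, ('ao \<times> 'em) \<times> 'am \<times> ('ao \<times> 'em), 'eo, 'em) ntrans) \<Rightarrow>
     ('eo \<Rightarrow> 'eo) \<Rightarrow>
     ('eo \<Rightarrow> ('ao \<times> 'em, ('ao \<times> 'em) \<times> 'am \<times> ('ao \<times> 'em), 'eo, 'em) ntrans) \<Rightarrow> 'eo \<Rightarrow> 'em" where
  "codensity_eta p M S db Td P X =
     induced p (comma S X) (Td X) (P X) X (Comp (Eta M) (FO p X)) (codensity_eta' p M S db X)"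

text \<open>The functor \<open>M\<^sub>f : Y \<down> S \<rightarrow> X \<down> S\<close> for \<open>f : X! \<rightarrow> \<delta>\<^sub>Y\<inverse>(S\<pi>\<^sub>Y)\<close>.\<close>

definition codensity_shift ::
    "('ao, 'am, 'eo, 'em) funct \<Rightarrow>
     ('eo \<Rightarrow> ('ao \<times> 'em, ('ao \<times> 'em) \<times> 'am \<times> ('ao \<times> 'em), 'eo, 'em) ntrans) \<Rightarrow> 'eo \<Rightarrow> 'eo \<Rightarrow>
     ('ao \<times> 'em, ('ao \<times> 'em) \<times> 'am \<times> ('ao \<times> 'em), 'eo, 'em) ntrans \<Rightarrow>
     ('ao \<times> 'em, ('ao \<times> 'em) \<times> 'am \<times> ('ao \<times> 'em),
      'ao \<times> 'em, ('ao \<times> 'em) \<times> 'am \<times> ('ao \<times> 'em)) funct" where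
  "codensity_shift S db X Y f =
     (THE N. is_functor (comma S Y) (comma S X) N \<and>
             comma_proj S X \<odot> N = comma_proj S Y \<and>
             comma_gamma S X \<rhd> N = db Y \<bullet> f)"

text \<open>The transformation \<open>f\<^sup>\<flat>\<close>; the argument \<open>u\<close> stands for \<open>(pg)\<^sup># : T(pX) \<rightarrow> T(pY)\<close>.\<close>

definition codensity_flat ::
    "('eo, 'em, 'bo, 'bm) funct \<Rightarrow> ('ao, 'am, 'eo, 'em) funct \<Rightarrow>
     ('eo \<Rightarrow> ('ao \<times> 'em, ('ao \<times> 'em) \<times> 'am \<times> ('ao \<times> 'em), 'eo, 'em) ntrans) \<Rightarrow> 'eo \<Rightarrow> 'eo \<Rightarrow> 'bm \<Rightarrow>
     ('ao \<times> 'em, ('ao \<times> 'em) \<times> 'am \<times> ('ao \<times> 'em), 'eo, 'em) ntrans \<Rightarrow>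
     ('ao \<times> 'em, ('ao \<times> 'em) \<times> 'am \<times> ('ao \<times> 'em), 'eo, 'em) ntrans" where
  "codensity_flat p S db X Y u f =
     (THE n. is_nat (NSrc (db X) \<odot> codensity_shift S db X Y f) (NSrc (db Y)) n \<and>
             p \<lhd> n = const_nat (comma S Y) (Tgt p) u \<and>
             db Y \<bullet> n = db X \<rhd> codensity_shift S db X Y f)"

definition codensity_ext ::
    "('eo, 'em, 'bo, 'bm) funct \<Rightarrow> ('bo, 'bm) monad \<Rightarrow> ('ao, 'am, 'eo, 'em) funct \<Rightarrow>
     ('eo \<Rightarrow> ('ao \<times> 'em, ('ao \<times> 'em) \<times> 'am \<times> ('ao \<times> 'em), 'eo, 'em) ntrans) \<Rightarrow>
     ('eo \<Rightarrow> 'eo) \<Rightarrow>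
     ('eo \<Rightarrow> ('ao \<times> 'em, ('ao \<times> 'em) \<times> 'am \<times> ('ao \<times> 'em), 'eo, 'em) ntrans) \<Rightarrow>
     'eo \<Rightarrow> 'eo \<Rightarrow> 'em \<Rightarrow> 'em" where
  "codensity_ext p M S db Td P X Y g =
     (let f = P Y \<bullet> const_nat (comma S Y) (Src p) g;
          u = bind_ext M (FO p Y) (FA p g)
      in induced p (comma S Y) (Td Y) (P Y) (Td X) u
           (codensity_flat p S db X Y u f \<bullet> (P X \<rhd> codensity_shift S db X Y f)))"

end

theory Submission
  imports Defs
begin

text \<open>For an object \<open>i = (a, g)\<close> of \<open>X \<down> S\<close> let \<open>proj X i : Td X \<rightarrow> S a\<close> be the composite of the limit
  projection with the cartesian arrow; it lies above \<open>(p g)\<^sup>#\<close>.  The universal properties of cartesian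
  arrows and of fibred limits combine into one: an arrow into \<open>Td X\<close> above a given \<open>u\<close> is determined by
  its composites with all \<open>proj X i\<close>.  The unit and the Kleisli extension satisfy
  \<open>proj X (a, g) \<circ> \<eta>\<^sub>X = g\<close> and \<open>proj Y (a, h) \<circ> ext g = proj X (a, proj Y (a, h) \<circ> g)\<close>, and from
  these equations each law of a Kleisli triple follows by comparing both sides after every \<open>proj X i\<close>
  and in the base, where it is the corresponding law of the given monad.\<close>

section \<open>Categories, functors and natural transformations\<close>

text \<open>Neither universal property by itself concerns an arrow into \<open>Td X\<close> over a
  general \<open>u\<close>: limits are taken inside a fibre, and cartesian arrows live in a functor
  category. Two bridges close the gap. Preservation of limits by reindexing extends the property of
  a fibre limit from vertical arrows to arrows over any \<open>u\<close>
  (\<open>fibre_limit_induced\<close>). Cartesianness of \<open>db X\<close> is applied to sources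
  lying over a constant functor, where the base part is a single arrow \<open>u\<close> and the
  compatibility condition is one equation in the base per object of \<open>X \<down> S\<close>.
  These equations are \<open>f^# \<circ> \<eta> = f\<close> and
  \<open>(g^# \<circ> f)^# = g^# \<circ> f^#\<close>; \<open>KR = pS\<close> enters by making every
  \<open>p S f\<close> an extension \<open>r^#\<close>. The given \<open>db X\<close> is known to be
  cartesian only in \<open>[X \<down> S, p]\<close>. Liftings that are cartesian at each object are
  constructed separately, for the existence of the data and for reindexing diagrams. Limits are
  assumed for shapes with objects and arrows in \<open>'u\<close>, whereas
  \<open>X \<down> S\<close> has types of its own. Its size is therefore bounded through the
  hom-sets of \<open>E\<close>, and limits are then carried over along an isomorphism of
  shapes.\<close>

lemma hom_Dom: "f \<in> hom C a b \<Longrightarrow> Dom C f = a"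
  and hom_Cod: "f \<in> hom C a b \<Longrightarrow> Cod C f = b"
  and hom_Ar: "f \<in> hom C a b \<Longrightarrow> f \<in> Ar C"
  and Ar_hom: "f \<in> Ar C \<Longrightarrow> f \<in> hom C (Dom C f) (Cod C f)"
  by (simp_all add: hom_def)

lemma hom_obj:
  assumes "is_cat C" "f \<in> hom C a b"
  shows "a \<in> Ob C" "b \<in> Ob C"
  using assms unfolding is_cat_def hom_def by auto

lemma Idn_hom: "is_cat C \<Longrightarrow> a \<in> Ob C \<Longrightarrow> Idn C a \<in> hom C a a"
  unfolding is_cat_def by blast

lemma Cmp_hom:
  assumes "is_cat C" "g \<in> hom C b c" "f \<in> hom C a b"
  shows "Cmp C g f \<in> hom C a c"
  using assms hom_obj[OF assms(1)] unfolding is_cat_def by metis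

lemma Cmp_Idn:
  assumes "is_cat C" "f \<in> hom C a b"
  shows "Cmp C f (Idn C a) = f" "Cmp C (Idn C b) f = f"
  using assms hom_obj[OF assms] unfolding is_cat_def by metis+

lemma Cmp_assoc:
  assumes "is_cat C" "h \<in> hom C c d" "g \<in> hom C b c" "f \<in> hom C a b"
  shows "Cmp C h (Cmp C g f) = Cmp C (Cmp C h g) f"
  using assms(1)[unfolded is_cat_def] assms(2-4) hom_obj[OF assms(1,2)] hom_obj[OF assms(1,4)]
  by blast

lemma is_catI:
  assumes "\<And>f. f \<in> Ar C \<Longrightarrow> Dom C f \<in> Ob C" "\<And>f. f \<in> Ar C \<Longrightarrow> Cod C f \<in> Ob C"
    and "\<And>a. a \<in> Ob C \<Longrightarrow> Idn C a \<in> hom C a a"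
    and "\<And>a b c f g. f \<in> hom C a b \<Longrightarrow> g \<in> hom C b c \<Longrightarrow> Cmp C g f \<in> hom C a c"
    and "\<And>a b f. f \<in> hom C a b \<Longrightarrow> Cmp C f (Idn C a) = f"
    and "\<And>a b f. f \<in> hom C a b \<Longrightarrow> Cmp C (Idn C b) f = f"
    and "\<And>a b c d f g h. f \<in> hom C a b \<Longrightarrow> g \<in> hom C b c \<Longrightarrow> h \<in> hom C c d \<Longrightarrow>
      Cmp C h (Cmp C g f) = Cmp C (Cmp C h g) f"
  shows "is_cat C"
  unfolding is_cat_def by (safe; rule assms; assumption)

lemma functor_Src: "is_functor C D F \<Longrightarrow> Src F = C"
  and functor_Tgt: "is_functor C D F \<Longrightarrow> Tgt F = D"
  and functor_cats: "is_functor C D F \<Longrightarrow> is_cat C" "is_functor C D F \<Longrightarrow> is_cat D"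
  and FO_Ob: "is_functor C D F \<Longrightarrow> a \<in> Ob C \<Longrightarrow> FO F a \<in> Ob D"
  and FA_Idn: "is_functor C D F \<Longrightarrow> a \<in> Ob C \<Longrightarrow> FA F (Idn C a) = Idn D (FO F a)"
  by (simp_all add: is_functor_def)

lemma FA_hom: "is_functor C D F \<Longrightarrow> f \<in> hom C a b \<Longrightarrow> FA F f \<in> hom D (FO F a) (FO F b)"
  using hom_obj unfolding is_functor_def by metis

lemma FA_Cmp:
  assumes "is_functor C D F" "g \<in> hom C b c" "f \<in> hom C a b"
  shows "FA F (Cmp C g f) = Cmp D (FA F g) (FA F f)"
  using assms hom_obj[of C g b c] hom_obj[of C f a b] unfolding is_functor_def by metis

lemma is_functorI:
  assumes "is_cat C" "is_cat D" "Src F = C" "Tgt F = D"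
    and "FO F \<in> extensional (Ob C)" "FA F \<in> extensional (Ar C)"
    and "\<And>a. a \<in> Ob C \<Longrightarrow> FO F a \<in> Ob D"
    and "\<And>a b f. f \<in> hom C a b \<Longrightarrow> FA F f \<in> hom D (FO F a) (FO F b)"
    and "\<And>a. a \<in> Ob C \<Longrightarrow> FA F (Idn C a) = Idn D (FO F a)"
    and "\<And>a b c f g. f \<in> hom C a b \<Longrightarrow> g \<in> hom C b c \<Longrightarrow>
      FA F (Cmp C g f) = Cmp D (FA F g) (FA F f)"
  shows "is_functor C D F"
  unfolding is_functor_def using assms by blast

text \<open>Functors are constructed below as records of restricted maps. This removes
  \<open>restrict\<close> from all the obligations at once, using that identities and composites
  stay in \<open>Ar C\<close>.\<close>

lemma is_functor_record:
  assumes "is_cat C" "is_cat D"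
    and "\<And>a. a \<in> Ob C \<Longrightarrow> fo a \<in> Ob D"
    and "\<And>a b f. f \<in> hom C a b \<Longrightarrow> fa f \<in> hom D (fo a) (fo b)"
    and "\<And>a. a \<in> Ob C \<Longrightarrow> fa (Idn C a) = Idn D (fo a)"
    and "\<And>a b c f g. f \<in> hom C a b \<Longrightarrow> g \<in> hom C b c \<Longrightarrow> fa (Cmp C g f) = Cmp D (fa g) (fa f)"
  shows "is_functor C D \<lparr>Src = C, Tgt = D, FO = restrict fo (Ob C), FA = restrict fa (Ar C)\<rparr>"
proof -
  note o = hom_obj[OF assms(1)] and h = Cmp_hom[OF assms(1)] Idn_hom[OF assms(1)]
  have "restrict fa (Ar C) f \<in> hom D (restrict fo (Ob C) a) (restrict fo (Ob C) b)"
    if "f \<in> hom C a b" for a b f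
    using assms(4)[OF that] o[OF that] hom_Ar[OF that] by simp
  moreover have "restrict fa (Ar C) (Idn C a) = Idn D (fo a)" if "a \<in> Ob C" for a
    using assms(5)[OF that] hom_Ar[OF h(2)[OF that]] by simp
  moreover have "restrict fa (Ar C) (Cmp C g f) = Cmp D (restrict fa (Ar C) g) (restrict fa (Ar C) f)"
    if "f \<in> hom C a b" "g \<in> hom C b c" for a b c f g
    using assms(6)[OF that] hom_Ar[OF h(1)[OF that(2,1)]] that[THEN hom_Ar] by simp
  ultimately show ?thesis
    by (intro is_functorI) (simp_all add: assms(1-3))
qed

lemma functor_eqI:
  assumes "is_functor C D F" "is_functor C D G"
    and "\<And>a. a \<in> Ob C \<Longrightarrow> FO F a = FO G a"
    and "\<And>a b f. f \<in> hom C a b \<Longrightarrow> FA F f = FA G f"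
  shows "F = G"
proof -
  have "FO F = FO G"
    using assms(1-3) unfolding is_functor_def by (auto intro!: extensionalityI[of _ "Ob C"])
  moreover have "FA F = FA G"
    using assms(1,2) Ar_hom[THEN assms(4)] unfolding is_functor_def
    by (auto intro!: extensionalityI[of _ "Ar C"])
  ultimately show ?thesis
    using assms(1,2) unfolding is_functor_def by (cases F; cases G) simp
qed

section \<open>Composite, identity and constant functors\<close>

lemma fcomp_FO: "is_functor C D F \<Longrightarrow> a \<in> Ob C \<Longrightarrow> FO (G \<odot> F) a = FO G (FO F a)"
  and fcomp_FA: "is_functor C D F \<Longrightarrow> f \<in> Ar C \<Longrightarrow> FA (G \<odot> F) f = FA G (FA F f)"
  by (simp_all add: fcomp_def is_functor_def)

lemma fcomp_functor:
  assumes "is_functor C D F" "is_functor D D' G"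
  shows "is_functor C D' (G \<odot> F)"
proof -
  have "is_functor C D' \<lparr>Src = C, Tgt = D', FO = restrict (\<lambda>a. FO G (FO F a)) (Ob C),
      FA = restrict (\<lambda>f. FA G (FA F f)) (Ar C)\<rparr>"
  proof (rule is_functor_record)
    show "FA G (FA F (Cmp C g f)) = Cmp D' (FA G (FA F g)) (FA G (FA F f))"
      if "f \<in> hom C a b" "g \<in> hom C b c" for a b c f g
      using FA_Cmp[OF assms(2) FA_hom[OF assms(1) that(2)] FA_hom[OF assms(1) that(1)]]
      by (simp add: FA_Cmp[OF assms(1) that(2,1)])
  qed (use assms in \<open>auto simp: FA_Idn FO_Ob intro: functor_cats FA_hom\<close>)
  then show ?thesis by (simp add: fcomp_def functor_Src[OF assms(1)] functor_Tgt[OF assms(2)])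
qed

lemma fcomp_assoc:
  assumes "is_functor C1 C2 F" "is_functor C2 C3 G" "is_functor C3 C4 H"
  shows "(H \<odot> G) \<odot> F = H \<odot> (G \<odot> F)"
proof (rule functor_eqI[of C1 C4])
  show "is_functor C1 C4 ((H \<odot> G) \<odot> F)" "is_functor C1 C4 (H \<odot> (G \<odot> F))"
    using assms by (blast intro: fcomp_functor)+
  show "FO ((H \<odot> G) \<odot> F) a = FO (H \<odot> (G \<odot> F)) a" if "a \<in> Ob C1" for a
    using that FO_Ob[OF assms(1) that]
    by (simp add: fcomp_FO[OF assms(1)] fcomp_FO[OF assms(2)] fcomp_FO[OF fcomp_functor[OF assms(1,2)]])
  show "FA ((H \<odot> G) \<odot> F) f = FA (H \<odot> (G \<odot> F)) f" if "f \<in> hom C1 a b" for a b f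
    using hom_Ar[OF that] hom_Ar[OF FA_hom[OF assms(1) that]]
    by (simp add: fcomp_FA[OF assms(1)] fcomp_FA[OF assms(2)] fcomp_FA[OF fcomp_functor[OF assms(1,2)]])
qed

lemma id_functor_functor: "is_cat C \<Longrightarrow> is_functor C C (id_functor C)"
  unfolding id_functor_def by (rule is_functor_record) auto

lemma id_functor_FO: "a \<in> Ob C \<Longrightarrow> FO (id_functor C) a = a"
  and id_functor_FA: "f \<in> Ar C \<Longrightarrow> FA (id_functor C) f = f"
  by (simp_all add: id_functor_def)

lemma fcomp_id_functor:
  assumes "is_functor C D F"
  shows "F \<odot> id_functor C = F" "id_functor D \<odot> F = F"
proof -
  note i = id_functor_functor[OF functor_cats(1)[OF assms]] id_functor_functor[OF functor_cats(2)[OF assms]]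
  show "F \<odot> id_functor C = F"
    using assms i
    by (intro functor_eqI[of C D] fcomp_functor[of C C _ D F])
      (auto simp: fcomp_FO[OF i(1)] fcomp_FA[OF i(1)] id_functor_FO id_functor_FA hom_Ar)
  show "id_functor D \<odot> F = F"
    using assms i
    by (intro functor_eqI[of C D] fcomp_functor[of C D _ D])
      (auto simp: fcomp_FO[OF assms] fcomp_FA[OF assms] id_functor_FO id_functor_FA hom_Ar
        FO_Ob[OF assms] FA_hom[OF assms, THEN hom_Ar])
qed

lemma const_functor_functor:
  "is_cat D \<Longrightarrow> is_cat C \<Longrightarrow> X \<in> Ob C \<Longrightarrow> is_functor D C (const_functor D C X)"
  unfolding const_functor_def
  by (rule is_functor_record) (auto intro: Idn_hom Cmp_Idn(1)[OF _ Idn_hom, symmetric])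

lemma const_functor_FO: "a \<in> Ob D \<Longrightarrow> FO (const_functor D C X) a = X"
  and const_functor_FA: "f \<in> Ar D \<Longrightarrow> FA (const_functor D C X) f = Idn C X"
  by (simp_all add: const_functor_def)

lemma fcomp_const_functor:
  assumes "is_cat D" "is_functor C C' F" "X \<in> Ob C"
  shows "F \<odot> const_functor D C X = const_functor D C' (FO F X)"
proof -
  note c = const_functor_functor[OF assms(1) functor_cats(1)[OF assms(2)] assms(3)]
  show ?thesis
    using fcomp_functor[OF c assms(2)]
      const_functor_functor[OF assms(1) functor_cats(2)[OF assms(2)] FO_Ob[OF assms(2,3)]]
    by (rule functor_eqI) (auto simp: fcomp_FO[OF c] fcomp_FA[OF c] const_functor_FO
        const_functor_FA hom_Ar FA_Idn[OF assms(2,3)])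
qed

lemma const_functor_fcomp:
  assumes "is_functor D' D N" "is_cat C" "X \<in> Ob C"
  shows "const_functor D C X \<odot> N = const_functor D' C X"
proof -
  note c = const_functor_functor[OF _ assms(2,3)]
  show ?thesis
    using fcomp_functor[OF assms(1) c[OF functor_cats(2)[OF assms(1)]]] c[OF functor_cats(1)[OF assms(1)]]
    by (rule functor_eqI) (auto simp: fcomp_FO[OF assms(1)] fcomp_FA[OF assms(1)] const_functor_FO
        const_functor_FA hom_Ar FO_Ob[OF assms(1)] FA_hom[OF assms(1), THEN hom_Ar])
qed

text \<open>Treating natural transformations as arrows of the functor category makes the facts about
  \<open>hom\<close> and about cartesian arrows of arbitrary categories apply to them unchanged.
  Unlike \<open>is_nat\<close>, the membership names the source and target categories.\<close>

abbreviation nats where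
  "nats C D F G \<equiv> hom (functor_cat C D) F G"

lemma nats_iff:
  "\<alpha> \<in> nats C D F G \<longleftrightarrow> is_functor C D F \<and> is_functor C D G \<and> is_nat F G \<alpha>"
  by (auto simp: hom_def functor_cat_def is_nat_def)

text \<open>\<open>is_nat\<close> makes the two functors share source and target, so typing one end
  types the other; the variant below starts from the codomain.\<close>

lemma is_nat_nats: "is_functor C D F \<Longrightarrow> is_nat F G \<alpha> \<longleftrightarrow> \<alpha> \<in> nats C D F G"
  by (auto simp: nats_iff is_nat_def functor_Src functor_Tgt)

lemma is_nat_nats': "is_functor C D G \<Longrightarrow> is_nat F G \<alpha> \<longleftrightarrow> \<alpha> \<in> nats C D F G"
  by (auto simp: nats_iff is_nat_def functor_Src functor_Tgt)

lemma nats_functor: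
  assumes "\<alpha> \<in> nats C D F G"
  shows "is_functor C D F" "is_functor C D G"
  using assms by (auto simp: nats_iff)

lemma nats_Comp:
  "\<alpha> \<in> nats C D F G \<Longrightarrow> a \<in> Ob C \<Longrightarrow> Comp \<alpha> a \<in> hom D (FO F a) (FO G a)"
  unfolding nats_iff is_nat_def by (auto simp: functor_Src functor_Tgt)

lemma nats_natural:
  assumes "\<alpha> \<in> nats C D F G" "f \<in> hom C a b"
  shows "Cmp D (Comp \<alpha> b) (FA F f) = Cmp D (FA G f) (Comp \<alpha> a)"
proof -
  have "is_functor C D F" using assms(1) by (simp add: nats_iff)
  with assms hom_obj[OF functor_cats(1)[OF this] assms(2)] show ?thesis
    unfolding nats_iff is_nat_def by (auto simp: functor_Src functor_Tgt)
qed

lemma nats_NSrc: "\<alpha> \<in> nats C D F G \<Longrightarrow> NSrc \<alpha> = F"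
  and nats_NTgt: "\<alpha> \<in> nats C D F G \<Longrightarrow> NTgt \<alpha> = G"
  by (auto simp: nats_iff is_nat_def)

lemma nats_eqI:
  assumes "\<alpha> \<in> nats C D F G" "\<beta> \<in> nats C D F G" "\<And>a. a \<in> Ob C \<Longrightarrow> Comp \<alpha> a = Comp \<beta> a"
  shows "\<alpha> = \<beta>"
proof -
  have "Comp \<alpha> = Comp \<beta>"
    using assms unfolding nats_iff is_nat_def
    by (auto intro!: extensionalityI[of _ "Ob C"] simp: functor_Src)
  then show ?thesis
    using assms(1,2) unfolding nats_iff is_nat_def by (cases \<alpha>; cases \<beta>) simp
qed

lemma natsI:
  assumes "is_functor C D F" "is_functor C D G" "NSrc \<alpha> = F" "NTgt \<alpha> = G"
    and "Comp \<alpha> \<in> extensional (Ob C)"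
    and "\<And>a. a \<in> Ob C \<Longrightarrow> Comp \<alpha> a \<in> hom D (FO F a) (FO G a)"
    and "\<And>a b f. f \<in> hom C a b \<Longrightarrow> a \<in> Ob C \<Longrightarrow> b \<in> Ob C \<Longrightarrow>
      Cmp D (Comp \<alpha> b) (FA F f) = Cmp D (FA G f) (Comp \<alpha> a)"
  shows "\<alpha> \<in> nats C D F G"
  using assms by (auto simp: nats_iff is_nat_def functor_Src functor_Tgt)

lemma vcomp_Comp:
  "\<beta> \<in> nats C D G H \<Longrightarrow> \<alpha> \<in> nats C D F G \<Longrightarrow> a \<in> Ob C \<Longrightarrow>
    Comp (\<beta> \<bullet> \<alpha>) a = Cmp D (Comp \<beta> a) (Comp \<alpha> a)"
  by (auto simp: nats_iff is_nat_def vcomp_def functor_Src functor_Tgt)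

lemma vcomp_nats:
  assumes "\<beta> \<in> nats C D G H" "\<alpha> \<in> nats C D F G"
  shows "\<beta> \<bullet> \<alpha> \<in> nats C D F H"
proof -
  note F = nats_functor(1)[OF assms(2)] and G = nats_functor(1)[OF assms(1)]
    and H = nats_functor(2)[OF assms(1)]
  note D = functor_cats(2)[OF F]
  have eq: "\<beta> \<bullet> \<alpha> =
      \<lparr>NSrc = F, NTgt = H, Comp = restrict (\<lambda>a. Cmp D (Comp \<beta> a) (Comp \<alpha> a)) (Ob C)\<rparr>"
    by (simp add: vcomp_def nats_NSrc[OF assms(2)] nats_NTgt[OF assms(1)] functor_Src[OF F] functor_Tgt[OF H])
  show ?thesis
  proof (rule natsI[OF F H])
    show "Comp (\<beta> \<bullet> \<alpha>) a \<in> hom D (FO F a) (FO H a)" if "a \<in> Ob C" for a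
      using Cmp_hom[OF D nats_Comp[OF assms(1) that] nats_Comp[OF assms(2) that]] that
      by (simp add: eq)
    fix a b f assume f: "f \<in> hom C a b" and a: "a \<in> Ob C" and b: "b \<in> Ob C"
    have "Cmp D (Cmp D (Comp \<beta> b) (Comp \<alpha> b)) (FA F f) = Cmp D (Comp \<beta> b) (Cmp D (FA G f) (Comp \<alpha> a))"
      using Cmp_assoc[OF D nats_Comp[OF assms(1) b] nats_Comp[OF assms(2) b] FA_hom[OF F f]]
      by (simp add: nats_natural[OF assms(2) f])
    also have "\<dots> = Cmp D (Cmp D (FA H f) (Comp \<beta> a)) (Comp \<alpha> a)"
      using Cmp_assoc[OF D nats_Comp[OF assms(1) b] FA_hom[OF G f] nats_Comp[OF assms(2) a]]
      by (simp add: nats_natural[OF assms(1) f])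
    also have "\<dots> = Cmp D (FA H f) (Cmp D (Comp \<beta> a) (Comp \<alpha> a))"
      using Cmp_assoc[OF D FA_hom[OF H f] nats_Comp[OF assms(1) a] nats_Comp[OF assms(2) a]] by simp
    finally show "Cmp D (Comp (\<beta> \<bullet> \<alpha>) b) (FA F f) = Cmp D (FA H f) (Comp (\<beta> \<bullet> \<alpha>) a)"
      using a b by (simp add: eq)
  qed (auto simp: eq)
qed

lemma id_nat_Comp: "is_functor C D F \<Longrightarrow> a \<in> Ob C \<Longrightarrow> Comp (id_nat F) a = Idn D (FO F a)"
  by (simp add: id_nat_def functor_Src functor_Tgt)

lemma id_nat_nats:
  assumes "is_functor C D F"
  shows "id_nat F \<in> nats C D F F"
  using assms
  by (intro natsI) (auto simp: id_nat_def functor_Src functor_Tgt FO_Ob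
      Cmp_Idn[OF functor_cats(2) FA_hom] intro!: Idn_hom functor_cats(2))

lemma functor_cat_simps [simp]:
  "Dom (functor_cat C D) = NSrc" "Cod (functor_cat C D) = NTgt"
  "Idn (functor_cat C D) = id_nat" "Cmp (functor_cat C D) = (\<bullet>)"
  "Ob (functor_cat C D) = Collect (is_functor C D)"
  by (simp_all add: functor_cat_def)

lemma vcomp_assoc:
  assumes "\<gamma> \<in> nats C D H K" "\<beta> \<in> nats C D G H" "\<alpha> \<in> nats C D F G"
  shows "\<gamma> \<bullet> (\<beta> \<bullet> \<alpha>) = (\<gamma> \<bullet> \<beta>) \<bullet> \<alpha>"
proof (rule nats_eqI)
  note c1 = vcomp_nats[OF assms(2,3)] and c2 = vcomp_nats[OF assms(1,2)]
  show "\<gamma> \<bullet> (\<beta> \<bullet> \<alpha>) \<in> nats C D F K" "(\<gamma> \<bullet> \<beta>) \<bullet> \<alpha> \<in> nats C D F K"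
    using assms c1 c2 by (blast intro: vcomp_nats)+
  fix a assume a: "a \<in> Ob C"
  show "Comp (\<gamma> \<bullet> (\<beta> \<bullet> \<alpha>)) a = Comp ((\<gamma> \<bullet> \<beta>) \<bullet> \<alpha>) a"
    using Cmp_assoc[OF functor_cats(2) nats_Comp nats_Comp nats_Comp,
        OF nats_functor(1)[OF assms(1)] assms(1) a assms(2) a assms(3) a] a
    by (simp add: vcomp_Comp[OF assms(1) c1] vcomp_Comp[OF c2 assms(3)] vcomp_Comp[OF assms(1,2)]
        vcomp_Comp[OF assms(2,3)])
qed

lemma functor_cat_cat:
  assumes "is_cat C" "is_cat D"
  shows "is_cat (functor_cat C D)"
proof (rule is_catI)
  show "Dom (functor_cat C D) f \<in> Ob (functor_cat C D)" "Cod (functor_cat C D) f \<in> Ob (functor_cat C D)"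
    if "f \<in> Ar (functor_cat C D)" for f
    using that by (auto simp: functor_cat_def)
  show "Idn (functor_cat C D) F \<in> nats C D F F" if "F \<in> Ob (functor_cat C D)" for F
    using that by (auto intro: id_nat_nats)
  show "Cmp (functor_cat C D) \<beta> \<alpha> \<in> nats C D F H" if "\<alpha> \<in> nats C D F G" "\<beta> \<in> nats C D G H" for F G H \<alpha> \<beta>
    using vcomp_nats[OF that(2,1)] by simp
  show "Cmp (functor_cat C D) \<gamma> (Cmp (functor_cat C D) \<beta> \<alpha>) =
      Cmp (functor_cat C D) (Cmp (functor_cat C D) \<gamma> \<beta>) \<alpha>"
    if "\<alpha> \<in> nats C D F G" "\<beta> \<in> nats C D G H" "\<gamma> \<in> nats C D H K" for F G H K \<alpha> \<beta> \<gamma>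
    using vcomp_assoc[OF that(3,2,1)] by simp
  fix F G \<alpha> assume \<alpha>: "\<alpha> \<in> nats C D F G"
  note F = nats_functor[OF \<alpha>] and i = nats_functor[OF \<alpha>, THEN id_nat_nats]
  have "\<alpha> \<bullet> id_nat F = \<alpha>"
    using vcomp_nats[OF \<alpha> i(1)] \<alpha>
    by (rule nats_eqI) (simp add: vcomp_Comp[OF \<alpha> i(1)] id_nat_Comp[OF F(1)]
        Cmp_Idn[OF assms(2) nats_Comp[OF \<alpha>]])
  moreover have "id_nat G \<bullet> \<alpha> = \<alpha>"
    using vcomp_nats[OF i(2) \<alpha>] \<alpha>
    by (rule nats_eqI) (simp add: vcomp_Comp[OF i(2) \<alpha>] id_nat_Comp[OF F(2)]
        Cmp_Idn[OF assms(2) nats_Comp[OF \<alpha>]])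
  ultimately show "Cmp (functor_cat C D) \<alpha> (Idn (functor_cat C D) F) = \<alpha>"
    "Cmp (functor_cat C D) (Idn (functor_cat C D) G) \<alpha> = \<alpha>" by simp_all
qed

section \<open>Whiskering and constant transformations\<close>

lemma whiskL_Comp: "\<alpha> \<in> nats C D F G \<Longrightarrow> a \<in> Ob C \<Longrightarrow> Comp (H \<lhd> \<alpha>) a = FA H (Comp \<alpha> a)"
  by (auto simp: nats_iff is_nat_def whiskL_def functor_Src)

lemma whiskL_nats:
  assumes "is_functor D D' H" "\<alpha> \<in> nats C D F G"
  shows "H \<lhd> \<alpha> \<in> nats C D' (H \<odot> F) (H \<odot> G)"
proof -
  note F = nats_functor[OF assms(2)]
  show ?thesis
  proof (rule natsI)
    show "is_functor C D' (H \<odot> F)" "is_functor C D' (H \<odot> G)"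
      using F assms(1) by (blast intro: fcomp_functor)+
    show "Comp (H \<lhd> \<alpha>) a \<in> hom D' (FO (H \<odot> F) a) (FO (H \<odot> G) a)" if "a \<in> Ob C" for a
      using FA_hom[OF assms(1) nats_Comp[OF assms(2) that]] that
      by (simp add: fcomp_FO[OF F(1)] fcomp_FO[OF F(2)] whiskL_Comp[OF assms(2)])
    show "Cmp D' (Comp (H \<lhd> \<alpha>) b) (FA (H \<odot> F) f) = Cmp D' (FA (H \<odot> G) f) (Comp (H \<lhd> \<alpha>) a)"
      if "f \<in> hom C a b" "a \<in> Ob C" "b \<in> Ob C" for a b f
      using FA_Cmp[OF assms(1) nats_Comp[OF assms(2) that(3)] FA_hom[OF F(1) that(1)]]
        FA_Cmp[OF assms(1) FA_hom[OF F(2) that(1)] nats_Comp[OF assms(2) that(2)]] that(2,3)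
      by (simp add: fcomp_FA[OF F(1) hom_Ar[OF that(1)]] fcomp_FA[OF F(2) hom_Ar[OF that(1)]]
          whiskL_Comp[OF assms(2)] nats_natural[OF assms(2) that(1)])
  qed (auto simp: whiskL_def nats_NSrc[OF assms(2)] nats_NTgt[OF assms(2)] functor_Src[OF F(1)])
qed

lemma whiskR_Comp: "is_functor C' C H \<Longrightarrow> a \<in> Ob C' \<Longrightarrow> Comp (\<alpha> \<rhd> H) a = Comp \<alpha> (FO H a)"
  by (auto simp: whiskR_def functor_Src)

lemma whiskR_nats:
  assumes "is_functor C' C H" "\<alpha> \<in> nats C D F G"
  shows "\<alpha> \<rhd> H \<in> nats C' D (F \<odot> H) (G \<odot> H)"
proof -
  note F = nats_functor[OF assms(2)]
  show ?thesis
  proof (rule natsI)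
    show "is_functor C' D (F \<odot> H)" "is_functor C' D (G \<odot> H)"
      using F assms(1) by (blast intro: fcomp_functor)+
    show "Comp (\<alpha> \<rhd> H) a \<in> hom D (FO (F \<odot> H) a) (FO (G \<odot> H) a)" if "a \<in> Ob C'" for a
      using nats_Comp[OF assms(2) FO_Ob[OF assms(1) that]] that
      by (simp add: fcomp_FO[OF assms(1)] whiskR_Comp[OF assms(1)])
    show "Cmp D (Comp (\<alpha> \<rhd> H) b) (FA (F \<odot> H) f) = Cmp D (FA (G \<odot> H) f) (Comp (\<alpha> \<rhd> H) a)"
      if "f \<in> hom C' a b" "a \<in> Ob C'" "b \<in> Ob C'" for a b f
      using nats_natural[OF assms(2) FA_hom[OF assms(1) that(1)]] that(2,3)
      by (simp add: fcomp_FA[OF assms(1) hom_Ar[OF that(1)]] whiskR_Comp[OF assms(1)])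
  qed (auto simp: whiskR_def nats_NSrc[OF assms(2)] nats_NTgt[OF assms(2)] functor_Src[OF assms(1)])
qed

lemma const_nat_Comp: "a \<in> Ob D \<Longrightarrow> Comp (const_nat D C f) a = f"
  by (simp add: const_nat_def)

lemma const_nat_nats:
  assumes "is_cat D" "is_cat C" "f \<in> hom C X Y"
  shows "const_nat D C f \<in> nats D C (const_functor D C X) (const_functor D C Y)"
  by (rule natsI[OF const_functor_functor[OF assms(1,2) hom_obj(1)[OF assms(2,3)]]
        const_functor_functor[OF assms(1,2) hom_obj(2)[OF assms(2,3)]]])
    (use assms in \<open>auto simp: const_nat_def const_functor_FO const_functor_FA hom_Dom[OF assms(3)]
      hom_Cod[OF assms(3)] hom_Ar Cmp_Idn[OF assms(2,3)]\<close>)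

section \<open>Cartesian arrows and fibre limits in functor categories\<close>

lemma cartesianI:
  assumes "is_functor E B p" "h \<in> hom E X Y"
    and "\<And>Z g v. g \<in> hom E Z Y \<Longrightarrow> v \<in> hom B (FO p Z) (FO p X) \<Longrightarrow> FA p g = Cmp B (FA p h) v \<Longrightarrow>
      \<exists>!w. w \<in> hom E Z X \<and> FA p w = v \<and> Cmp E h w = g"
  shows "cartesian p h"
  unfolding cartesian_def functor_Src[OF assms(1)] functor_Tgt[OF assms(1)] hom_Dom[OF assms(2)]
    hom_Cod[OF assms(2)]
proof (intro conjI ballI impI)
  show "h \<in> Ar E" using assms(2) by (rule hom_Ar)
  fix g v assume "g \<in> Ar E" and v: "v \<in> hom B (FO p (Dom E g)) (FO p X)"
    and e: "Cod E g = Y \<and> FA p g = Cmp B (FA p h) v"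
  then have "g \<in> hom E (Dom E g) Y" by (simp add: hom_def)
  then show "\<exists>!w. w \<in> hom E (Dom E g) X \<and> FA p w = v \<and> Cmp E h w = g"
    using v conjunct2[OF e] by (rule assms(3))
qed

lemma cartesianD:
  assumes "is_functor E B p" "cartesian p h" "h \<in> hom E X Y" "g \<in> hom E Z Y"
    "v \<in> hom B (FO p Z) (FO p X)" "FA p g = Cmp B (FA p h) v"
  shows "\<exists>!w. w \<in> hom E Z X \<and> FA p w = v \<and> Cmp E h w = g"
  using assms(2) hom_Ar[OF assms(4)] assms(5,6)
  unfolding cartesian_def functor_Src[OF assms(1)] functor_Tgt[OF assms(1)] hom_Dom[OF assms(3)]
    hom_Cod[OF assms(3)]
  using hom_Dom[OF assms(4)] hom_Cod[OF assms(4)] by blast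

text \<open>The factorization property is applied to the arrow \<open>Cmp E h w\<close> itself,
  which has both \<open>w\<close> and \<open>w'\<close> as factors.\<close>

lemma cartesian_cancel:
  assumes "is_functor E B p" "cartesian p h" "h \<in> hom E X Y" "w \<in> hom E Z X" "w' \<in> hom E Z X"
    "FA p w = FA p w'" "Cmp E h w = Cmp E h w'"
  shows "w = w'"
proof -
  have "\<exists>!v. v \<in> hom E Z X \<and> FA p v = FA p w \<and> Cmp E h v = Cmp E h w"
    using assms(1-4) FA_Cmp[OF assms(1,3,4)] FA_hom[OF assms(1,4)] Cmp_hom[OF functor_cats(1)]
    by (intro cartesianD) blast+
  then show ?thesis using assms(4-7) by metis
qed

lemma whiskL_vcomp:
  assumes "is_functor D D' H" "\<beta> \<in> nats C D G K" "\<alpha> \<in> nats C D F G"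
  shows "H \<lhd> (\<beta> \<bullet> \<alpha>) = (H \<lhd> \<beta>) \<bullet> (H \<lhd> \<alpha>)"
proof (rule nats_eqI)
  note c = vcomp_nats[OF assms(2,3)] and w = whiskL_nats[OF assms(1)]
  show "H \<lhd> (\<beta> \<bullet> \<alpha>) \<in> nats C D' (H \<odot> F) (H \<odot> K)" by (rule w[OF c])
  show "(H \<lhd> \<beta>) \<bullet> (H \<lhd> \<alpha>) \<in> nats C D' (H \<odot> F) (H \<odot> K)"
    by (rule vcomp_nats[OF w[OF assms(2)] w[OF assms(3)]])
  show "Comp (H \<lhd> (\<beta> \<bullet> \<alpha>)) a = Comp ((H \<lhd> \<beta>) \<bullet> (H \<lhd> \<alpha>)) a" if "a \<in> Ob C" for a
    using that
    by (simp add: whiskL_Comp[OF c] vcomp_Comp[OF assms(2,3)] vcomp_Comp[OF w[OF assms(2)] w[OF assms(3)]]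
        whiskL_Comp[OF assms(2)] whiskL_Comp[OF assms(3)]
        FA_Cmp[OF assms(1) nats_Comp[OF assms(2)] nats_Comp[OF assms(3)]])
qed

lemma whiskL_id_nat:
  assumes "is_functor D D' H" "is_functor C D F"
  shows "H \<lhd> id_nat F = id_nat (H \<odot> F)"
  by (rule nats_eqI[OF whiskL_nats[OF assms(1) id_nat_nats[OF assms(2)]]
        id_nat_nats[OF fcomp_functor[OF assms(2,1)]]])
    (simp add: whiskL_Comp[OF id_nat_nats[OF assms(2)]] id_nat_Comp[OF assms(2)]
      id_nat_Comp[OF fcomp_functor[OF assms(2,1)]] FA_Idn[OF assms(1)] FO_Ob[OF assms(2)] fcomp_FO[OF assms(2)])

lemma functor_cat_map_simps:
  assumes "is_functor E B p"
  shows "is_functor D E F \<Longrightarrow> FO (functor_cat_map D p) F = p \<odot> F"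
    "\<alpha> \<in> nats D E F G \<Longrightarrow> FA (functor_cat_map D p) \<alpha> = p \<lhd> \<alpha>"
  by (auto simp: functor_cat_map_def functor_Src[OF assms] dest: hom_Ar)

lemma functor_cat_map_functor:
  assumes "is_cat D" "is_functor E B p"
  shows "is_functor (functor_cat D E) (functor_cat D B) (functor_cat_map D p)"
  unfolding functor_cat_map_def functor_Src[OF assms(2)] functor_Tgt[OF assms(2)]
proof (rule is_functor_record)
  show "is_cat (functor_cat D E)" "is_cat (functor_cat D B)"
    using assms functor_cats by (blast intro: functor_cat_cat)+
  show "p \<odot> F \<in> Ob (functor_cat D B)" if "F \<in> Ob (functor_cat D E)" for F
    using fcomp_functor[OF _ assms(2)] that by simp
  show "p \<lhd> \<alpha> \<in> nats D B (p \<odot> F) (p \<odot> G)" if "\<alpha> \<in> nats D E F G" for \<alpha> F G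
    using whiskL_nats[OF assms(2) that] .
  show "p \<lhd> Idn (functor_cat D E) F = Idn (functor_cat D B) (p \<odot> F)" if "F \<in> Ob (functor_cat D E)" for F
    using whiskL_id_nat[OF assms(2)] that by simp
  show "p \<lhd> Cmp (functor_cat D E) \<beta> \<alpha> = Cmp (functor_cat D B) (p \<lhd> \<beta>) (p \<lhd> \<alpha>)"
    if "\<alpha> \<in> nats D E F G" "\<beta> \<in> nats D E G K" for F G K \<alpha> \<beta>
    using whiskL_vcomp[OF assms(2) that(2,1)] by simp
qed

text \<open>Nothing is required of the components of \<open>\<rho>\<close>. This is the only way in
  which the cartesianness of a given \<open>db X\<close> is exploited.\<close>

lemma functor_cat_cartesianD:
  assumes "is_cat D" "is_functor E B p" "cartesian (functor_cat_map D p) \<rho>" "\<rho> \<in> nats D E G F"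
    "n \<in> nats D E H F" "v \<in> nats D B (p \<odot> H) (p \<odot> G)" "p \<lhd> n = (p \<lhd> \<rho>) \<bullet> v"
  shows "\<exists>!w. w \<in> nats D E H G \<and> p \<lhd> w = v \<and> \<rho> \<bullet> w = n"
proof -
  note s = functor_cat_map_simps[OF assms(2)]
  have "\<exists>!w. w \<in> nats D E H G \<and> FA (functor_cat_map D p) w = v \<and> Cmp (functor_cat D E) \<rho> w = n"
    using assms nats_functor[OF assms(5)] nats_functor[OF assms(4)]
    by (intro cartesianD[OF functor_cat_map_functor[OF assms(1,2)] assms(3,4)])
      (simp_all add: s(1) s(2)[OF assms(4)] s(2)[OF assms(5)])
  then show ?thesis using s(2) by (metis functor_cat_simps(4))
qed

text \<open>Factors exist at each object. They form a transformation because two arrows into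
  \<open>FO G b\<close> are equal once they agree under \<open>p\<close> and after the cartesian
  arrow \<open>Comp \<rho> b\<close>; the same cancellation gives uniqueness.\<close>

lemma pointwise_cartesian:
  assumes "is_cat D" "is_functor E B p" "\<rho> \<in> nats D E G F"
    and car: "\<And>d. d \<in> Ob D \<Longrightarrow> cartesian p (Comp \<rho> d)"
  shows "cartesian (functor_cat_map D p) \<rho>"
proof (rule cartesianI[OF functor_cat_map_functor[OF assms(1,2)] assms(3)])
  fix H n v assume n: "n \<in> nats D E H F"
    and "v \<in> nats D B (FO (functor_cat_map D p) H) (FO (functor_cat_map D p) G)"
    and e: "FA (functor_cat_map D p) n = Cmp (functor_cat D B) (FA (functor_cat_map D p) \<rho>) v"
  note s = functor_cat_map_simps[OF assms(2)]
  note H = nats_functor(1)[OF n] and G = nats_functor(1)[OF assms(3)] and F = nats_functor(2)[OF n]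
  have v: "v \<in> nats D B (p \<odot> H) (p \<odot> G)" using \<open>v \<in> _\<close> by (simp add: s(1) H G)
  note Ec = functor_cats(1)[OF assms(2)]
  have vc: "Comp v d \<in> hom B (FO p (FO H d)) (FO p (FO G d))" if "d \<in> Ob D" for d
    using nats_Comp[OF v that] by (simp add: fcomp_FO[OF H that] fcomp_FO[OF G that])
  have e': "FA p (Comp n d) = Cmp B (FA p (Comp \<rho> d)) (Comp v d)" if "d \<in> Ob D" for d
  proof -
    have "p \<lhd> n = (p \<lhd> \<rho>) \<bullet> v" using e by (simp add: s(2)[OF n] s(2)[OF assms(3)])
    then have "Comp (p \<lhd> n) d = Comp ((p \<lhd> \<rho>) \<bullet> v) d" by simp
    then show ?thesis
      by (simp add: whiskL_Comp[OF n that] vcomp_Comp[OF whiskL_nats[OF assms(2,3)] v that]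
          whiskL_Comp[OF assms(3) that])
  qed
  define W where "W d = (THE w. w \<in> hom E (FO H d) (FO G d) \<and> FA p w = Comp v d \<and>
    Cmp E (Comp \<rho> d) w = Comp n d)" for d
  have W: "W d \<in> hom E (FO H d) (FO G d)" "FA p (W d) = Comp v d" "Cmp E (Comp \<rho> d) (W d) = Comp n d"
    if "d \<in> Ob D" for d
    using theI'[OF cartesianD[OF assms(2) car[OF that] nats_Comp[OF assms(3) that] nats_Comp[OF n that]
      vc[OF that] e'[OF that]]] unfolding W_def by blast+
  define w where "w = \<lparr>NSrc = H, NTgt = G, Comp = restrict W (Ob D)\<rparr>"
  have w: "w \<in> nats D E H G"
  proof (rule natsI[OF H G])
    fix a b f assume f: "f \<in> hom D a b" and a: "a \<in> Ob D" and b: "b \<in> Ob D"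
    note Gf = FA_hom[OF G f] and Hf = FA_hom[OF H f] and Ff = FA_hom[OF F f]
      and r = nats_Comp[OF assms(3)]
    \<comment> \<open>Under \<open>p\<close> this is naturality of \<open>v\<close>; after
      \<open>Comp \<rho> b\<close> it follows from naturality of \<open>n\<close> and of
      \<open>\<rho>\<close>.\<close>
    have "Cmp E (W b) (FA H f) = Cmp E (FA G f) (W a)"
    proof (rule cartesian_cancel[OF assms(2) car[OF b] r[OF b]])
      show "Cmp E (W b) (FA H f) \<in> hom E (FO H a) (FO G b)" "Cmp E (FA G f) (W a) \<in> hom E (FO H a) (FO G b)"
        using Cmp_hom[OF Ec W(1)[OF b] Hf] Cmp_hom[OF Ec Gf W(1)[OF a]] by simp_all
      show "FA p (Cmp E (W b) (FA H f)) = FA p (Cmp E (FA G f) (W a))"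
        using nats_natural[OF v f] hom_Ar[OF f]
        by (simp add: FA_Cmp[OF assms(2) W(1)[OF b] Hf] FA_Cmp[OF assms(2) Gf W(1)[OF a]] W(2) a b
            fcomp_FA[OF H] fcomp_FA[OF G])
      have "Cmp E (Comp \<rho> b) (Cmp E (W b) (FA H f)) = Cmp E (Comp n b) (FA H f)"
        using Cmp_assoc[OF Ec r[OF b] W(1)[OF b] Hf] W(3)[OF b] by simp
      also have "\<dots> = Cmp E (Cmp E (FA F f) (Comp \<rho> a)) (W a)"
        using nats_natural[OF n f] Cmp_assoc[OF Ec Ff r[OF a] W(1)[OF a]] W(3)[OF a] by simp
      also have "\<dots> = Cmp E (Comp \<rho> b) (Cmp E (FA G f) (W a))"
        using nats_natural[OF assms(3) f] Cmp_assoc[OF Ec r[OF b] Gf W(1)[OF a]] by simp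
      finally show "Cmp E (Comp \<rho> b) (Cmp E (W b) (FA H f)) = Cmp E (Comp \<rho> b) (Cmp E (FA G f) (W a))" .
    qed
    then show "Cmp E (Comp w b) (FA H f) = Cmp E (FA G f) (Comp w a)" by (simp add: w_def a b)
  qed (auto simp: w_def W)
  have pw: "p \<lhd> w = v"
    by (rule nats_eqI[OF whiskL_nats[OF assms(2) w] v]) (simp add: whiskL_Comp[OF w], simp add: w_def W)
  have rw: "\<rho> \<bullet> w = n"
    by (rule nats_eqI[OF vcomp_nats[OF assms(3) w] n])
      (simp add: vcomp_Comp[OF assms(3) w], simp add: w_def W)
  show "\<exists>!w. w \<in> nats D E H G \<and> FA (functor_cat_map D p) w = v \<and> Cmp (functor_cat D E) \<rho> w = n"
  proof (rule ex1I[of _ w])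
    show "w \<in> nats D E H G \<and> FA (functor_cat_map D p) w = v \<and> Cmp (functor_cat D E) \<rho> w = n"
      using w pw rw by (simp add: s(2)[OF w])
    fix w' assume "w' \<in> nats D E H G \<and> FA (functor_cat_map D p) w' = v \<and> Cmp (functor_cat D E) \<rho> w' = n"
    then have w': "w' \<in> nats D E H G" and "p \<lhd> w' = v" "\<rho> \<bullet> w' = n"
      using s(2)[of w'] by auto
    show "w' = w"
    proof (rule nats_eqI[OF w' w])
      fix d assume d: "d \<in> Ob D"
      show "Comp w' d = Comp w d"
      proof (rule cartesian_cancel[OF assms(2) car[OF d] nats_Comp[OF assms(3) d] nats_Comp[OF w' d]
            nats_Comp[OF w d]])
        show "FA p (Comp w' d) = FA p (Comp w d)"
          using \<open>p \<lhd> w' = v\<close> pw whiskL_Comp[OF w' d] whiskL_Comp[OF w d] by metis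
        show "Cmp E (Comp \<rho> d) (Comp w' d) = Cmp E (Comp \<rho> d) (Comp w d)"
          using \<open>\<rho> \<bullet> w' = n\<close> rw vcomp_Comp[OF assms(3) w' d] vcomp_Comp[OF assms(3) w d] by metis
      qed
    qed
  qed
qed

lemma fibration_functor: "fibration E B p \<Longrightarrow> is_functor E B p"
  by (simp add: fibration_def)

lemma cartesian_lifting_hom:
  assumes "is_functor E B p" "cartesian_lifting p u X h" "u \<in> hom B J I"
  shows "h \<in> hom E (Dom E h) X" "FO p (Dom E h) = J" "cartesian p h" "FA p h = u"
proof -
  show h: "h \<in> hom E (Dom E h) X" "cartesian p h" "FA p h = u"
    using assms(2) functor_Src[OF assms(1)]
    unfolding cartesian_lifting_def cartesian_def hom_def by auto
  show "FO p (Dom E h) = J"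
    using FA_hom[OF assms(1) h(1)] assms(3) h(3) by (auto simp: hom_def)
qed

text \<open>Once liftings are chosen at the objects, \<open>G\<close> is forced on arrows: over
  \<open>FA H f\<close> exactly one arrow is compatible with the liftings at the two ends. The
  functor laws hold because both sides solve the same factorization problem.\<close>

lemma pointwise_cartesian_lifting:
  assumes "fibration E B p" "\<delta> \<in> nats D B H (p \<odot> F)" "is_functor D E F"
  obtains \<rho> G where "\<rho> \<in> nats D E G F" "p \<odot> G = H" "p \<lhd> \<rho> = \<delta>"
    "\<And>d. d \<in> Ob D \<Longrightarrow> cartesian_lifting p (Comp \<delta> d) (FO F d) (Comp \<rho> d)"
proof -
  note p = fibration_functor[OF assms(1)] and F = assms(3)
  note Ec = functor_cats(1)[OF p] and Bc = functor_cats(2)[OF p] and Dc = functor_cats(1)[OF F]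
  note H = nats_functor(1)[OF assms(2)]
  have dl: "Comp \<delta> d \<in> hom B (FO H d) (FO p (FO F d))" if "d \<in> Ob D" for d
    using nats_Comp[OF assms(2) that] by (simp add: fcomp_FO[OF F that])
  have "\<exists>h. cartesian_lifting p (Comp \<delta> d) (FO F d) h" if "d \<in> Ob D" for d
    using assms(1) dl[OF that] FO_Ob[OF F that] hom_obj(1)[OF Bc dl[OF that]] unfolding fibration_def by blast
  then obtain r where r: "\<And>d. d \<in> Ob D \<Longrightarrow> cartesian_lifting p (Comp \<delta> d) (FO F d) (r d)" by metis
  define g where "g d = Dom E (r d)" for d
  have rh: "r d \<in> hom E (g d) (FO F d)" "FO p (g d) = FO H d" "cartesian p (r d)" "FA p (r d) = Comp \<delta> d"
    if "d \<in> Ob D" for d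
    using cartesian_lifting_hom[OF p r[OF that] dl[OF that]] unfolding g_def by blast+
  \<comment> \<open>The ends are read off \<open>f\<close>, so that \<open>W\<close> depends on the
    arrow alone, as the field \<open>FA\<close> requires.\<close>
  define W where "W f = (THE w. w \<in> hom E (g (Dom D f)) (g (Cod D f)) \<and> FA p w = FA H f \<and>
    Cmp E (r (Cod D f)) w = Cmp E (FA F f) (r (Dom D f)))" for f
  have W: "W f \<in> hom E (g a) (g b)" "FA p (W f) = FA H f" "Cmp E (r b) (W f) = Cmp E (FA F f) (r a)"
    if f: "f \<in> hom D a b" for a b f
  proof -
    note ab = hom_obj[OF Dc f]
    note Ff = FA_hom[OF F f]
    have "FA p (Cmp E (FA F f) (r a)) = Cmp B (FA p (r b)) (FA H f)"
      using nats_natural[OF assms(2) f]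
      by (simp add: FA_Cmp[OF p Ff rh(1)[OF ab(1)]] rh(4) ab fcomp_FA[OF F hom_Ar[OF f]])
    moreover have "FA H f \<in> hom B (FO p (g a)) (FO p (g b))"
      using FA_hom[OF H f] by (simp add: rh(2) ab)
    ultimately have "\<exists>!w. w \<in> hom E (g a) (g b) \<and> FA p w = FA H f \<and> Cmp E (r b) w = Cmp E (FA F f) (r a)"
      using cartesianD[OF p rh(3)[OF ab(2)] rh(1)[OF ab(2)] Cmp_hom[OF Ec Ff rh(1)[OF ab(1)]]] by blast
    from theI'[OF this] show "W f \<in> hom E (g a) (g b)" "FA p (W f) = FA H f"
      "Cmp E (r b) (W f) = Cmp E (FA F f) (r a)"
      unfolding W_def hom_Dom[OF f] hom_Cod[OF f] by blast+
  qed
  define G where "G = \<lparr>Src = D, Tgt = E, FO = restrict g (Ob D), FA = restrict W (Ar D)\<rparr>"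
  define \<rho> where "\<rho> = \<lparr>NSrc = G, NTgt = F, Comp = restrict r (Ob D)\<rparr>"
  have G: "is_functor D E G"
    unfolding G_def
  proof (rule is_functor_record[OF Dc Ec])
    show "g a \<in> Ob E" if "a \<in> Ob D" for a using hom_obj(1)[OF Ec rh(1)[OF that]] .
    show "W f \<in> hom E (g a) (g b)" if "f \<in> hom D a b" for a b f using W(1)[OF that] .
    show "W (Idn D a) = Idn E (g a)" if a: "a \<in> Ob D" for a
    proof (rule cartesian_cancel[OF p rh(3)[OF a] rh(1)[OF a]])
      note i = Idn_hom[OF Dc a] and ga = hom_obj(1)[OF Ec rh(1)[OF a]]
      show "W (Idn D a) \<in> hom E (g a) (g a)" using W(1)[OF i] .
      show "Idn E (g a) \<in> hom E (g a) (g a)" using Idn_hom[OF Ec ga] .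
      show "FA p (W (Idn D a)) = FA p (Idn E (g a))"
        by (simp add: W(2)[OF i] FA_Idn[OF H a] FA_Idn[OF p ga] rh(2)[OF a])
      show "Cmp E (r a) (W (Idn D a)) = Cmp E (r a) (Idn E (g a))"
        by (simp add: W(3)[OF i] FA_Idn[OF F a] Cmp_Idn[OF Ec rh(1)[OF a]])
    qed
    show "W (Cmp D k f) = Cmp E (W k) (W f)" if f: "f \<in> hom D a b" and k: "k \<in> hom D b c" for a b c f k
    proof (rule cartesian_cancel[OF p rh(3)[OF hom_obj(2)[OF Dc k]] rh(1)[OF hom_obj(2)[OF Dc k]]])
      note kf = Cmp_hom[OF Dc k f]
      note rr = rh(1)[OF hom_obj(1)[OF Dc f]] rh(1)[OF hom_obj(2)[OF Dc f]] rh(1)[OF hom_obj(2)[OF Dc k]]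
      show "W (Cmp D k f) \<in> hom E (g a) (g c)" "Cmp E (W k) (W f) \<in> hom E (g a) (g c)"
        using W(1)[OF kf] Cmp_hom[OF Ec W(1)[OF k] W(1)[OF f]] by simp_all
      show "FA p (W (Cmp D k f)) = FA p (Cmp E (W k) (W f))"
        by (simp add: W(2)[OF kf] FA_Cmp[OF H k f] FA_Cmp[OF p W(1)[OF k] W(1)[OF f]] W(2)[OF k] W(2)[OF f])
      have "Cmp E (r c) (Cmp E (W k) (W f)) = Cmp E (Cmp E (FA F k) (r b)) (W f)"
        using Cmp_assoc[OF Ec rr(3) W(1)[OF k] W(1)[OF f]] W(3)[OF k] by simp
      also have "\<dots> = Cmp E (FA F k) (Cmp E (FA F f) (r a))"
        using Cmp_assoc[OF Ec FA_hom[OF F k] rr(2) W(1)[OF f]] W(3)[OF f] by simp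
      also have "\<dots> = Cmp E (FA F (Cmp D k f)) (r a)"
        using Cmp_assoc[OF Ec FA_hom[OF F k] FA_hom[OF F f] rr(1)] FA_Cmp[OF F k f] by simp
      finally show "Cmp E (r c) (W (Cmp D k f)) = Cmp E (r c) (Cmp E (W k) (W f))"
        using W(3)[OF kf] by simp
    qed
  qed
  have GO: "FO G d = g d" if "d \<in> Ob D" for d using that by (simp add: G_def)
  have GA: "FA G f = W f" if "f \<in> hom D a b" for a b f using hom_Ar[OF that] by (simp add: G_def)
  have \<rho>: "\<rho> \<in> nats D E G F"
    by (rule natsI[OF G F]) (auto simp: \<rho>_def rh GO GA W)
  have pG: "p \<odot> G = H"
    by (rule functor_eqI[OF fcomp_functor[OF G p] H])
      (auto simp: fcomp_FO[OF G] fcomp_FA[OF G] hom_Ar GO GA rh W)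
  have p\<rho>: "p \<lhd> \<rho> = \<delta>"
    using whiskL_nats[OF p \<rho>] assms(2) unfolding pG
    by (rule nats_eqI) (simp add: whiskL_Comp[OF \<rho>], simp add: \<rho>_def rh)
  show thesis
    by (rule that[OF \<rho> pG p\<rho>]) (simp add: \<rho>_def r)
qed

section \<open>Fibre limits and arrows over a general base arrow\<close>

lemma whiskL_const_nat:
  assumes "is_cat D" "is_functor E B p" "k \<in> hom E X Y"
  shows "p \<lhd> const_nat D E k = const_nat D B (FA p k)"
proof (rule nats_eqI)
  note E = functor_cats(1)[OF assms(2)] and B = functor_cats(2)[OF assms(2)]
  note k = const_nat_nats[OF assms(1) E assms(3)]
  show "p \<lhd> const_nat D E k \<in> nats D B (const_functor D B (FO p X)) (const_functor D B (FO p Y))"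
    using whiskL_nats[OF assms(2) k] hom_obj[OF E assms(3)] by (simp add: fcomp_const_functor[OF assms(1,2)])
  show "const_nat D B (FA p k) \<in> nats D B (const_functor D B (FO p X)) (const_functor D B (FO p Y))"
    by (rule const_nat_nats[OF assms(1) B FA_hom[OF assms(2,3)]])
qed (simp add: whiskL_Comp[OF const_nat_nats[OF assms(1) functor_cats(1)[OF assms(2)] assms(3)]] const_nat_Comp)

lemma vcomp_const_nat:
  assumes "is_cat D" "is_cat E" "k \<in> hom E Y Z" "l \<in> hom E X Y"
  shows "const_nat D E k \<bullet> const_nat D E l = const_nat D E (Cmp E k l)"
  by (rule nats_eqI[OF vcomp_nats[OF const_nat_nats[OF assms(1-3)] const_nat_nats[OF assms(1,2,4)]]
        const_nat_nats[OF assms(1,2) Cmp_hom[OF assms(2-4)]]])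
    (simp add: vcomp_Comp[OF const_nat_nats[OF assms(1-3)] const_nat_nats[OF assms(1,2,4)]] const_nat_Comp)

lemma fibre_coneD:
  assumes "is_functor E B p" "fibre_diagram p D I F" "fibre_cone p D I F L \<theta>"
  shows "L \<in> Ob E" "FO p L = I" "\<theta> \<in> nats D E (const_functor D E L) F"
    "p \<lhd> \<theta> = const_nat D B (Idn B I)"
  using assms unfolding fibre_diagram_def fibre_cone_def functor_Src[OF assms(1)] functor_Tgt[OF assms(1)]
  by (auto simp: is_nat_nats'[of D E F])

text \<open>An arrow over \<open>u\<close> into a fibre limit \<open>L\<close> is a vertical arrow into \<open>u\<^sup>*L\<close>, which is again a fibre
  limit since limits are preserved by reindexing.\<close>

lemma fibre_limit_induced:
  assumes "fibration E B p" "has_fibred_limits p D" "fibre_limit p D I F L \<theta>"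
    and u: "u \<in> hom B (FO p Y) I" and Y: "Y \<in> Ob E"
    and h: "h \<in> nats D E (const_functor D E Y) F" "p \<lhd> h = const_nat D B u"
  shows "\<exists>!k. k \<in> hom E Y L \<and> FA p k = u \<and> \<theta> \<bullet> const_nat D E k = h"
proof -
  note p = fibration_functor[OF assms(1)]
  note Ec = functor_cats(1)[OF p] and Bc = functor_cats(2)[OF p]
  note SrcTgt = functor_Src[OF p] functor_Tgt[OF p]
  have F: "is_functor D E F" "p \<odot> F = const_functor D B I" and diag: "fibre_diagram p D I F"
    and cone: "fibre_cone p D I F L \<theta>"
    using assms(3) unfolding fibre_limit_def fibre_diagram_def SrcTgt by auto
  note Dc = functor_cats(1)[OF F(1)]
  note L = fibre_coneD[OF p diag cone]
  define J where "J = FO p Y"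
  have u': "u \<in> hom B J I" using u by (simp add: J_def)
  note J = hom_obj(1)[OF Bc u'] and I = hom_obj(2)[OF Bc u']
  obtain l where lift: "cartesian_lifting p u L l"
    using assms(1) u' L(1,2) J unfolding fibration_def by blast
  define L' where "L' = Dom E l"
  have l: "l \<in> hom E L' L" "FO p L' = J" "cartesian p l" "FA p l = u"
    using cartesian_lifting_hom[OF p lift u'] by (auto simp: L'_def)
  have cu: "const_nat D B u \<in> nats D B (const_functor D B J) (p \<odot> F)"
    using const_nat_nats[OF Dc Bc u'] by (simp add: F(2))
  \<comment> \<open>\<open>G\<close> is the reindexed diagram \<open>u^*F\<close>: lifting the
    constant transformation \<open>u!\<close> lands in the fibre over \<open>J\<close>. The liftings
    are taken at each object because \<open>reindexed_diagram\<close> asks for that.\<close>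
  obtain \<rho> G where \<rho>: "\<rho> \<in> nats D E G F" and pG: "p \<odot> G = const_functor D B J"
    and p\<rho>: "p \<lhd> \<rho> = const_nat D B u"
    and \<rho>l: "\<And>d. d \<in> Ob D \<Longrightarrow> cartesian_lifting p (Comp (const_nat D B u) d) (FO F d) (Comp \<rho> d)"
    using pointwise_cartesian_lifting[OF assms(1) cu F(1)] by metis
  note G = nats_functor(1)[OF \<rho>]
  have car: "cartesian (functor_cat_map D p) \<rho>"
    using pointwise_cartesian[OF Dc p \<rho>] \<rho>l unfolding cartesian_lifting_def by blast
  have diagG: "fibre_diagram p D J G"
    unfolding fibre_diagram_def SrcTgt using J G pG by simp
  have re: "reindexed_diagram p D J u F G \<rho>"
    unfolding reindexed_diagram_def using diagG \<rho> \<rho>l by (auto simp: is_nat_nats[OF G] const_nat_Comp)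
  note iJ = Idn_hom[OF Bc J]
  \<comment> \<open>Cones on \<open>F\<close> over \<open>u\<close> correspond to vertical cones on
    \<open>G\<close>, which moves the problem into the fibre over \<open>J\<close>.\<close>
  have factor: "\<exists>!w. w \<in> nats D E (const_functor D E Z) G \<and> p \<lhd> w = const_nat D B (Idn B J) \<and> \<rho> \<bullet> w = n"
    if "n \<in> nats D E (const_functor D E Z) F" "p \<lhd> n = const_nat D B u" "Z \<in> Ob E" "FO p Z = J" for Z n
  proof (rule functor_cat_cartesianD[OF Dc p car \<rho> that(1)])
    show "const_nat D B (Idn B J) \<in> nats D B (p \<odot> const_functor D E Z) (p \<odot> G)"
      using const_nat_nats[OF Dc Bc iJ] that(3,4) by (simp add: fcomp_const_functor[OF Dc p] pG)
    show "p \<lhd> n = (p \<lhd> \<rho>) \<bullet> const_nat D B (Idn B J)"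
      by (simp add: that(2) p\<rho> vcomp_const_nat[OF Dc Bc u' iJ] Cmp_Idn[OF Bc u'])
  qed
  note cl = const_nat_nats[OF Dc Ec l(1)]
  have "p \<lhd> (\<theta> \<bullet> const_nat D E l) = const_nat D B u"
    using L(2) u' by (simp add: whiskL_vcomp[OF p L(3) cl] L(4) whiskL_const_nat[OF Dc p l(1)] l(4)
        vcomp_const_nat[OF Dc Bc Idn_hom[OF Bc I] u'] Cmp_Idn[OF Bc u'])
  then obtain \<theta>' where \<theta>': "\<theta>' \<in> nats D E (const_functor D E L') G"
    "p \<lhd> \<theta>' = const_nat D B (Idn B J)" "\<rho> \<bullet> \<theta>' = \<theta> \<bullet> const_nat D E l"
    using factor[OF vcomp_nats[OF L(3) cl] _ hom_obj(1)[OF Ec l(1)] l(2)] by blast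
  have "fibre_cone p D J G L' \<theta>'"
    unfolding fibre_cone_def SrcTgt using \<theta>' l hom_obj(1)[OF Ec l(1)] by (auto simp: is_nat_nats'[OF G])
  \<comment> \<open>Preservation by reindexing enters here: \<open>\<theta>'\<close> is the
    reindexed cone \<open>u^*\<theta>\<close>, with vertex \<open>L' = u^*L\<close>.\<close>
  then have lim: "fibre_limit p D J G L' \<theta>'"
    using assms(2,3) u' re l(1) lift \<theta>'(3) unfolding has_fibred_limits_def SrcTgt by blast
  obtain h' where h': "h' \<in> nats D E (const_functor D E Y) G"
    "p \<lhd> h' = const_nat D B (Idn B J)" "\<rho> \<bullet> h' = h"
    and h'u: "\<And>w. w \<in> nats D E (const_functor D E Y) G \<Longrightarrow> p \<lhd> w = const_nat D B (Idn B J) \<Longrightarrow>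
      \<rho> \<bullet> w = h \<Longrightarrow> w = h'"
    using factor[OF h Y J_def[symmetric]] by (metis (no_types, lifting))
  have "fibre_cone p D J G Y h'"
    unfolding fibre_cone_def SrcTgt using h' Y J_def by (auto simp: is_nat_nats'[OF G])
  then have ex1: "\<exists>!k. k \<in> hom E Y L' \<and> FA p k = Idn B J \<and> \<theta>' \<bullet> const_nat D E k = h'"
    using lim unfolding fibre_limit_def SrcTgt by blast
  have trans: "\<theta> \<bullet> const_nat D E (Cmp E l k) = \<rho> \<bullet> (\<theta>' \<bullet> const_nat D E k)" if "k \<in> hom E Y L'" for k
  proof -
    note ck = const_nat_nats[OF Dc Ec that]
    show ?thesis
      by (simp add: vcomp_const_nat[OF Dc Ec l(1) that, symmetric] vcomp_assoc[OF L(3) cl ck]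
          vcomp_assoc[OF \<rho> \<theta>'(1) ck] \<theta>'(3))
  qed
  obtain k where k: "k \<in> hom E Y L'" "FA p k = Idn B J" "\<theta>' \<bullet> const_nat D E k = h'"
    using ex1 by blast
  show ?thesis
  proof (rule ex1I[of _ "Cmp E l k"], intro conjI)
    show "Cmp E l k \<in> hom E Y L" using Cmp_hom[OF Ec l(1) k(1)] .
    show "FA p (Cmp E l k) = u" by (simp add: FA_Cmp[OF p l(1) k(1)] l(4) k(2) Cmp_Idn[OF Bc u'])
    show "\<theta> \<bullet> const_nat D E (Cmp E l k) = h" by (simp add: trans[OF k(1)] k(3) h'(3))
    fix m assume m: "m \<in> hom E Y L \<and> FA p m = u \<and> \<theta> \<bullet> const_nat D E m = h"
    have "FA p m = Cmp B (FA p l) (Idn B J)" using m by (simp add: l(4) Cmp_Idn[OF Bc u'])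
    \<comment> \<open>A competitor \<open>m\<close> over \<open>u\<close> factors through the
      cartesian arrow \<open>l\<close> by a vertical arrow, to which uniqueness in the fibre over
      \<open>J\<close> applies.\<close>
    then obtain m' where m': "m' \<in> hom E Y L'" "FA p m' = Idn B J" "Cmp E l m' = m"
      using cartesianD[OF p l(3,1) conjunct1[OF m]] iJ l(2) J_def by metis
    note cm = const_nat_nats[OF Dc Ec m'(1)]
    have "\<theta>' \<bullet> const_nat D E m' = h'"
    proof (rule h'u[OF vcomp_nats[OF \<theta>'(1) cm]])
      show "p \<lhd> (\<theta>' \<bullet> const_nat D E m') = const_nat D B (Idn B J)"
        by (simp add: whiskL_vcomp[OF p \<theta>'(1) cm] \<theta>'(2) whiskL_const_nat[OF Dc p m'(1)] m'(2)
            vcomp_const_nat[OF Dc Bc iJ iJ] Cmp_Idn[OF Bc iJ])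
      show "\<rho> \<bullet> (\<theta>' \<bullet> const_nat D E m') = h" using trans[OF m'(1)] m'(3) m by simp
    qed
    then have "m' = k" using ex1 k m' by blast
    then show "m = Cmp E l k" using m'(3) by simp
  qed
qed

section \<open>Fibred limits over small and large shapes\<close>

text \<open>Isomorphism of shapes, needed because limits are assumed for shapes of type
  \<open>('u, 'u) cat\<close> only. Both directions are carried along: one moves diagrams to the
  other shape, the other brings limits back.\<close>

definition inverse_functors ::
    "('o1, 'm1) cat \<Rightarrow> ('o2, 'm2) cat \<Rightarrow> ('o1, 'm1, 'o2, 'm2) funct \<Rightarrow> ('o2, 'm2, 'o1, 'm1) funct \<Rightarrow> bool"
  where
  "inverse_functors C D \<Phi> \<Psi> \<longleftrightarrow> is_functor C D \<Phi> \<and> is_functor D C \<Psi> \<and>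
     \<Psi> \<odot> \<Phi> = id_functor C \<and> \<Phi> \<odot> \<Psi> = id_functor D"

lemma inverse_functors_sym: "inverse_functors C D \<Phi> \<Psi> \<Longrightarrow> inverse_functors D C \<Psi> \<Phi>"
  by (auto simp: inverse_functors_def)

lemma inverse_functors_FO: "inverse_functors C D \<Phi> \<Psi> \<Longrightarrow> d \<in> Ob D \<Longrightarrow> FO \<Phi> (FO \<Psi> d) = d"
  using fcomp_FO id_functor_FO unfolding inverse_functors_def by metis

lemma inverse_functors_fcomp:
  assumes "inverse_functors D' D \<Phi> \<Psi>" "is_functor D E F"
  shows "(F \<odot> \<Phi>) \<odot> \<Psi> = F"
  using assms fcomp_assoc[of D D' \<Psi> D \<Phi> E F] fcomp_id_functor(1)[OF assms(2)]
  unfolding inverse_functors_def by simp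

lemma whiskR_vcomp:
  assumes "is_functor C' C H" "\<beta> \<in> nats C D G K" "\<alpha> \<in> nats C D F G"
  shows "(\<beta> \<bullet> \<alpha>) \<rhd> H = (\<beta> \<rhd> H) \<bullet> (\<alpha> \<rhd> H)"
proof (rule nats_eqI)
  note c = vcomp_nats[OF assms(2,3)] and w = whiskR_nats[OF assms(1)]
  show "(\<beta> \<bullet> \<alpha>) \<rhd> H \<in> nats C' D (F \<odot> H) (K \<odot> H)" by (rule w[OF c])
  show "(\<beta> \<rhd> H) \<bullet> (\<alpha> \<rhd> H) \<in> nats C' D (F \<odot> H) (K \<odot> H)"
    by (rule vcomp_nats[OF w[OF assms(2)] w[OF assms(3)]])
  show "Comp ((\<beta> \<bullet> \<alpha>) \<rhd> H) a = Comp ((\<beta> \<rhd> H) \<bullet> (\<alpha> \<rhd> H)) a" if "a \<in> Ob C'" for a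
    using that FO_Ob[OF assms(1) that]
    by (simp add: whiskR_Comp[OF assms(1)] vcomp_Comp[OF assms(2,3)] vcomp_Comp[OF w[OF assms(2)] w[OF assms(3)]])
qed

lemma whiskLR:
  assumes "is_functor C' C H" "is_functor D D' K" "\<alpha> \<in> nats C D F G"
  shows "K \<lhd> (\<alpha> \<rhd> H) = (K \<lhd> \<alpha>) \<rhd> H"
proof (rule nats_eqI)
  note F = nats_functor[OF assms(3)]
  show "K \<lhd> (\<alpha> \<rhd> H) \<in> nats C' D' (K \<odot> (F \<odot> H)) (K \<odot> (G \<odot> H))"
    by (rule whiskL_nats[OF assms(2) whiskR_nats[OF assms(1,3)]])
  show "(K \<lhd> \<alpha>) \<rhd> H \<in> nats C' D' (K \<odot> (F \<odot> H)) (K \<odot> (G \<odot> H))"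
    using whiskR_nats[OF assms(1) whiskL_nats[OF assms(2,3)]]
    by (simp add: fcomp_assoc[OF assms(1) F(1) assms(2)] fcomp_assoc[OF assms(1) F(2) assms(2)])
qed (simp add: whiskR_Comp[OF assms(1)] whiskL_Comp[OF whiskR_nats[OF assms(1,3)]]
    whiskL_Comp[OF assms(3)] FO_Ob[OF assms(1)])

lemma whiskR_const_nat:
  assumes "is_functor D' D N" "is_cat C" "f \<in> hom C X Y"
  shows "const_nat D C f \<rhd> N = const_nat D' C f"
proof (rule nats_eqI)
  note o = hom_obj[OF assms(2,3)]
  show "const_nat D C f \<rhd> N \<in> nats D' C (const_functor D' C X) (const_functor D' C Y)"
    using whiskR_nats[OF assms(1) const_nat_nats[OF functor_cats(2)[OF assms(1)] assms(2,3)]]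
    by (simp add: const_functor_fcomp[OF assms(1,2)] o)
  show "const_nat D' C f \<in> nats D' C (const_functor D' C X) (const_functor D' C Y)"
    by (rule const_nat_nats[OF functor_cats(1)[OF assms(1)] assms(2,3)])
qed (simp add: whiskR_Comp[OF assms(1)] const_nat_Comp FO_Ob[OF assms(1)])

lemma inverse_functors_whiskR:
  assumes "inverse_functors D' D \<Phi> \<Psi>" "\<alpha> \<in> nats D E F G"
  shows "(\<alpha> \<rhd> \<Phi>) \<rhd> \<Psi> = \<alpha>"
proof (rule nats_eqI[OF _ assms(2)])
  have \<Phi>: "is_functor D' D \<Phi>" and \<Psi>: "is_functor D D' \<Psi>"
    using assms(1) by (auto simp: inverse_functors_def)
  show "(\<alpha> \<rhd> \<Phi>) \<rhd> \<Psi> \<in> nats D E F G"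
    using whiskR_nats[OF \<Psi> whiskR_nats[OF \<Phi> assms(2)]]
    by (simp add: nats_functor[OF assms(2), THEN inverse_functors_fcomp[OF assms(1)]])
  show "Comp ((\<alpha> \<rhd> \<Phi>) \<rhd> \<Psi>) d = Comp \<alpha> d" if "d \<in> Ob D" for d
    using that FO_Ob[OF \<Psi> that]
    by (simp add: whiskR_Comp[OF \<Psi>] whiskR_Comp[OF \<Phi>] inverse_functors_FO[OF assms(1)])
qed

lemma fibre_diagram_fcomp:
  assumes "is_functor E B p" "is_functor D' D \<Phi>" "fibre_diagram p D I F"
  shows "fibre_diagram p D' I (F \<odot> \<Phi>)"
proof -
  have F: "is_functor D E F" "p \<odot> F = const_functor D B I" "I \<in> Ob B"
    using assms(3) unfolding fibre_diagram_def functor_Src[OF assms(1)] functor_Tgt[OF assms(1)] by auto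
  have "p \<odot> (F \<odot> \<Phi>) = const_functor D' B I"
    using fcomp_assoc[OF assms(2) F(1) assms(1)] const_functor_fcomp[OF assms(2) functor_cats(2)[OF assms(1)] F(3)]
    by (simp add: F(2))
  then show ?thesis
    unfolding fibre_diagram_def functor_Src[OF assms(1)] functor_Tgt[OF assms(1)]
    using F fcomp_functor[OF assms(2) F(1)] by simp
qed

lemma fibre_cone_whiskR:
  assumes "is_functor E B p" "is_functor D' D \<Phi>" "fibre_diagram p D I F" "fibre_cone p D I F L \<theta>"
  shows "fibre_cone p D' I (F \<odot> \<Phi>) L (\<theta> \<rhd> \<Phi>)"
proof -
  note L = fibre_coneD[OF assms(1,3,4)]
  note E = functor_cats(1)[OF assms(1)] and B = functor_cats(2)[OF assms(1)]
  have "I \<in> Ob B" using FO_Ob[OF assms(1) L(1)] L(2) by simp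
  then have "p \<lhd> (\<theta> \<rhd> \<Phi>) = const_nat D' B (Idn B I)"
    by (simp add: whiskLR[OF assms(2,1) L(3)] L(4) whiskR_const_nat[OF assms(2) B Idn_hom[OF B]])
  moreover have "\<theta> \<rhd> \<Phi> \<in> nats D' E (const_functor D' E L) (F \<odot> \<Phi>)"
    using whiskR_nats[OF assms(2) L(3)] by (simp add: const_functor_fcomp[OF assms(2) E L(1)])
  ultimately show ?thesis
    unfolding fibre_cone_def functor_Src[OF assms(1)] functor_Tgt[OF assms(1)]
    using L(1,2) by (auto simp: is_nat_nats[OF const_functor_functor[OF functor_cats(1)[OF assms(2)] E L(1)]])
qed

text \<open>Whiskering with an isomorphism is a bijection between the cones on the two diagrams and
  keeps the vertex, so the same arrow \<open>k\<close> mediates on both sides.\<close>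

lemma fibre_limit_whiskR:
  assumes p: "is_functor E B p" and inv: "inverse_functors D' D \<Phi> \<Psi>" and lim: "fibre_limit p D I F L \<theta>"
  shows "fibre_limit p D' I (F \<odot> \<Phi>) L (\<theta> \<rhd> \<Phi>)"
proof -
  have \<Phi>: "is_functor D' D \<Phi>" and \<Psi>: "is_functor D D' \<Psi>"
    using inv by (auto simp: inverse_functors_def)
  note E = functor_cats(1)[OF p] and D = functor_cats(2)[OF \<Phi>]
  have diag: "fibre_diagram p D I F" and cone: "fibre_cone p D I F L \<theta>"
    using lim by (auto simp: fibre_limit_def)
  have F: "is_functor D E F" using diag by (simp add: fibre_diagram_def functor_Src[OF p])
  note diag' = fibre_diagram_fcomp[OF p \<Phi> diag] and L = fibre_coneD[OF p diag cone]
  have "\<exists>!k. k \<in> hom E Y L \<and> FA p k = Idn B I \<and> (\<theta> \<rhd> \<Phi>) \<bullet> const_nat D' E k = \<kappa>"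
    if \<kappa>: "fibre_cone p D' I (F \<odot> \<Phi>) Y \<kappa>" for Y \<kappa>
  proof -
    have "fibre_cone p D I F Y (\<kappa> \<rhd> \<Psi>)"
      using fibre_cone_whiskR[OF p \<Psi> diag' \<kappa>] by (simp add: inverse_functors_fcomp[OF inv F])
    then have ex1: "\<exists>!k. k \<in> hom E Y L \<and> FA p k = Idn B I \<and> \<theta> \<bullet> const_nat D E k = \<kappa> \<rhd> \<Psi>"
      using lim unfolding fibre_limit_def functor_Src[OF p] functor_Tgt[OF p] by blast
    \<comment> \<open>The left side is the whiskering by \<open>\<Phi>\<close> of the composite on
      the right, and whiskering by \<open>\<Psi>\<close> undoes it.\<close>
    have "(\<theta> \<rhd> \<Phi>) \<bullet> const_nat D' E k = \<kappa> \<longleftrightarrow> \<theta> \<bullet> const_nat D E k = \<kappa> \<rhd> \<Psi>" if k: "k \<in> hom E Y L" for k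
    proof -
      note ck = const_nat_nats[OF D E k]
      have eq: "(\<theta> \<rhd> \<Phi>) \<bullet> const_nat D' E k = (\<theta> \<bullet> const_nat D E k) \<rhd> \<Phi>"
        by (simp add: whiskR_vcomp[OF \<Phi> L(3) ck] whiskR_const_nat[OF \<Phi> E k])
      note \<kappa>n = fibre_coneD(3)[OF p diag' \<kappa>]
      show ?thesis
        unfolding eq
        using inverse_functors_whiskR[OF inv vcomp_nats[OF L(3) ck]]
          inverse_functors_whiskR[OF inverse_functors_sym[OF inv] \<kappa>n] by auto
    qed
    then show ?thesis using ex1 by (simp cong: conj_cong)
  qed
  then show ?thesis
    unfolding fibre_limit_def functor_Src[OF p] functor_Tgt[OF p]
    using diag' fibre_cone_whiskR[OF p \<Phi> diag cone] by blast
qed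

text \<open>A diagram on \<open>D\<close> is moved to \<open>D'\<close> by composing with
  \<open>\<Phi>\<close>, and the limit found there comes back along \<open>\<Psi>\<close>.
  Preservation travels the same way, since liftings that are cartesian at each object stay so when
  restricted along \<open>\<Phi>\<close>.\<close>

lemma has_fibred_limits_transfer:
  assumes p: "is_functor E B p" and inv: "inverse_functors D' D \<Phi> \<Psi>" and D': "has_fibred_limits p D'"
  shows "has_fibred_limits p D"
  unfolding has_fibred_limits_def
proof (intro conjI allI impI)
  have \<Phi>: "is_functor D' D \<Phi>" and \<Psi>: "is_functor D D' \<Psi>"
    using inv by (auto simp: inverse_functors_def)
  note inv' = inverse_functors_sym[OF inv]
  note E = functor_cats(1)[OF p] and B = functor_cats(2)[OF p]
    and D = functor_cats(2)[OF \<Phi>] and D'c = functor_cats(1)[OF \<Phi>]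
  {
    fix I F assume d: "fibre_diagram p D I F"
    then obtain L \<theta> where "fibre_limit p D' I (F \<odot> \<Phi>) L \<theta>"
      using D' fibre_diagram_fcomp[OF p \<Phi> d] unfolding has_fibred_limits_def by blast
    from fibre_limit_whiskR[OF p inv' this] show "\<exists>L \<theta>. fibre_limit p D I F L \<theta>"
      using inverse_functors_fcomp[OF inv, of E F] d by (auto simp: fibre_diagram_def functor_Src[OF p])
  next
    fix I J u F L \<theta> G \<rho> L' l \<theta>'
    assume "fibre_limit p D I F L \<theta> \<and> u \<in> hom (Tgt p) J I \<and> reindexed_diagram p D J u F G \<rho> \<and>
        l \<in> hom (Src p) L' L \<and> cartesian_lifting p u L l \<and>
        fibre_cone p D J G L' \<theta>' \<and> \<rho> \<bullet> \<theta>' = \<theta> \<bullet> const_nat D (Src p) l"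
    then have lim: "fibre_limit p D I F L \<theta>" and u: "u \<in> hom B J I" and re: "reindexed_diagram p D J u F G \<rho>"
      and l: "l \<in> hom E L' L" "cartesian_lifting p u L l"
      and cone': "fibre_cone p D J G L' \<theta>'" and e: "\<rho> \<bullet> \<theta>' = \<theta> \<bullet> const_nat D E l"
      unfolding functor_Src[OF p] functor_Tgt[OF p] by auto
    have diagG: "fibre_diagram p D J G" and \<rho>: "is_nat G F \<rho>"
      and \<rho>l: "\<And>d. d \<in> Ob D \<Longrightarrow> cartesian_lifting p u (FO F d) (Comp \<rho> d)"
      using re by (auto simp: reindexed_diagram_def)
    have G: "is_functor D E G" using diagG by (simp add: fibre_diagram_def functor_Src[OF p])
    have \<rho>n: "\<rho> \<in> nats D E G F" using \<rho> by (simp add: is_nat_nats[OF G])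
    note \<theta> = fibre_coneD(3)[OF p _ ] and ln = const_nat_nats[OF D E l(1)]
    have \<theta>n: "\<theta> \<in> nats D E (const_functor D E L) F"
      using lim by (intro \<theta>) (auto simp: fibre_limit_def)
    have \<theta>'n: "\<theta>' \<in> nats D E (const_functor D E L') G" using diagG cone' by (rule \<theta>)
    have "reindexed_diagram p D' J u (F \<odot> \<Phi>) (G \<odot> \<Phi>) (\<rho> \<rhd> \<Phi>)"
      unfolding reindexed_diagram_def
    proof (intro conjI ballI)
      show "fibre_diagram p D' J (G \<odot> \<Phi>)" by (rule fibre_diagram_fcomp[OF p \<Phi> diagG])
      show "is_nat (G \<odot> \<Phi>) (F \<odot> \<Phi>) (\<rho> \<rhd> \<Phi>)"
        using whiskR_nats[OF \<Phi> \<rho>n] by (simp add: nats_iff)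
      show "cartesian_lifting p u (FO (F \<odot> \<Phi>) d) (Comp (\<rho> \<rhd> \<Phi>) d)" if "d \<in> Ob D'" for d
        using \<rho>l[OF FO_Ob[OF \<Phi> that]] by (simp add: fcomp_FO[OF \<Phi> that] whiskR_Comp[OF \<Phi> that])
    qed
    moreover have "(\<rho> \<rhd> \<Phi>) \<bullet> (\<theta>' \<rhd> \<Phi>) = (\<theta> \<rhd> \<Phi>) \<bullet> const_nat D' E l"
      using whiskR_vcomp[OF \<Phi> \<rho>n \<theta>'n] whiskR_vcomp[OF \<Phi> \<theta>n ln]
      by (simp add: e whiskR_const_nat[OF \<Phi> E l(1)])
    ultimately have "fibre_limit p D' J (G \<odot> \<Phi>) L' (\<theta>' \<rhd> \<Phi>)"
      using fibre_limit_whiskR[OF p inv lim] u l fibre_cone_whiskR[OF p \<Phi> diagG cone']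
      by (intro conjunct2[OF D'[unfolded has_fibred_limits_def functor_Src[OF p] functor_Tgt[OF p]],
            rule_format, of I "F \<odot> \<Phi>" L "\<theta> \<rhd> \<Phi>" u J "G \<odot> \<Phi>" "\<rho> \<rhd> \<Phi>" l L']) simp
    from fibre_limit_whiskR[OF p inv' this] show "fibre_limit p D J G L' \<theta>'"
      by (simp add: inverse_functors_fcomp[OF inv G] inverse_functors_whiskR[OF inv \<theta>'n])
  }
qed

text \<open>Transport of structure: an arrow of \<open>C'\<close> is a name of one of
  \<open>C\<close>, and each operation decodes the names, acts in \<open>C\<close> and encodes the
  result.\<close>

lemma isomorphic_cat:
  assumes C: "is_cat C" and i: "inj_on i (Ob C)" and j: "inj_on j (Ar C)"
  obtains C' \<Phi> \<Psi> where "inverse_functors C' C \<Phi> \<Psi>" "Ob C' = i ` Ob C" "Ar C' = j ` Ar C"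
proof -
  define i' where "i' = the_inv_into (Ob C) i"
  define j' where "j' = the_inv_into (Ar C) j"
  have i': "i' (i a) = a" if "a \<in> Ob C" for a
    using the_inv_into_f_f[OF i that] by (simp add: i'_def)
  have j': "j' (j f) = f" if "f \<in> Ar C" for f
    using the_inv_into_f_f[OF j that] by (simp add: j'_def)
  define C' where "C' = \<lparr>Ob = i ` Ob C, Ar = j ` Ar C, Dom = \<lambda>f. i (Dom C (j' f)),
    Cod = \<lambda>f. i (Cod C (j' f)), Idn = \<lambda>a. j (Idn C (i' a)), Cmp = \<lambda>g f. j (Cmp C (j' g) (j' f))\<rparr>"
  have simps: "Ob C' = i ` Ob C" "Ar C' = j ` Ar C" "Idn C' a = j (Idn C (i' a))"
    "Cmp C' g f = j (Cmp C (j' g) (j' f))" for a f g by (simp_all add: C'_def)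
  have homI: "j f \<in> hom C' (i a) (i b)" if "f \<in> hom C a b" for f a b
    using hom_Ar[OF that] that by (simp add: hom_def C'_def j')
  have homE: "\<exists>a b f. a \<in> Ob C \<and> b \<in> Ob C \<and> x = i a \<and> y = i b \<and> f \<in> hom C a b \<and> k = j f"
    if "k \<in> hom C' x y" for k x y
  proof -
    obtain f where f: "f \<in> Ar C" "k = j f" using hom_Ar[OF \<open>k \<in> hom C' x y\<close>] by (auto simp: simps)
    then have "x = i (Dom C f)" "y = i (Cod C f)" using that by (auto simp: hom_def C'_def j')
    then show ?thesis using f Ar_hom[OF f(1)] hom_obj[OF C Ar_hom[OF f(1)]] by blast
  qed
  \<comment> \<open>Writing the ends as \<open>i' x\<close> and \<open>i' y\<close> gives decoded
    consecutive arrows literally the same middle object, so they compose in \<open>C\<close> without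
    comparing representatives.\<close>
  have homE': "\<exists>f. f \<in> hom C (i' x) (i' y) \<and> k = j f \<and> i (i' x) = x \<and> i (i' y) = y" if "k \<in> hom C' x y" for k x y
    using homE[OF that] i' by metis
  have Cmp': "Cmp C' (j g) (j f) = j (Cmp C g f)" if "f \<in> hom C a b" "g \<in> hom C b c" for a b c f g
    using that[THEN hom_Ar] by (simp add: simps j')
  have C': "is_cat C'"
  proof (rule is_catI)
    show "Dom C' f \<in> Ob C'" "Cod C' f \<in> Ob C'" if "f \<in> Ar C'" for f
      using that hom_obj[OF C Ar_hom] by (auto simp: C'_def j')
    show "Idn C' a \<in> hom C' a a" if "a \<in> Ob C'" for a
      using that homI[OF Idn_hom[OF C]] by (auto simp: simps i')
    fix a b f assume f: "f \<in> hom C' a b"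
    then obtain f' where f': "f' \<in> hom C (i' a) (i' b)" "f = j f'" using homE' by blast
    note oo = hom_obj[OF C f'(1)]
    show "Cmp C' f (Idn C' a) = f"
      using Cmp'[OF Idn_hom[OF C oo(1)] f'(1)] f'(2) Cmp_Idn[OF C f'(1)] by (simp add: simps(3))
    show "Cmp C' (Idn C' b) f = f"
      using Cmp'[OF f'(1) Idn_hom[OF C oo(2)]] f'(2) Cmp_Idn[OF C f'(1)] by (simp add: simps(3))
    fix c g assume g: "g \<in> hom C' b c"
    then obtain g' where g': "g' \<in> hom C (i' b) (i' c)" "g = j g'" using homE' by blast
    note gf = Cmp_hom[OF C g'(1) f'(1)]
    show "Cmp C' g f \<in> hom C' a c"
      using homI[OF gf] Cmp'[OF f'(1) g'(1)] f'(2) g'(2) homE'[OF f] homE'[OF g] by metis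
    fix d h assume "h \<in> hom C' c d"
    then obtain h' where h': "h' \<in> hom C (i' c) (i' d)" "h = j h'" using homE' by blast
    show "Cmp C' h (Cmp C' g f) = Cmp C' (Cmp C' h g) f"
      by (simp add: f'(2) g'(2) h'(2) Cmp'[OF f'(1) g'(1)] Cmp'[OF g'(1) h'(1)] Cmp'[OF gf h'(1)]
          Cmp'[OF f'(1) Cmp_hom[OF C h'(1) g'(1)]] Cmp_assoc[OF C h'(1) g'(1) f'(1)])
  qed
  define \<Phi> where "\<Phi> = \<lparr>Src = C', Tgt = C, FO = restrict i' (Ob C'), FA = restrict j' (Ar C')\<rparr>"
  define \<Psi> where "\<Psi> = \<lparr>Src = C, Tgt = C', FO = restrict i (Ob C), FA = restrict j (Ar C)\<rparr>"
  have \<Phi>: "is_functor C' C \<Phi>"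
    unfolding \<Phi>_def
  proof (rule is_functor_record[OF C' C])
    show "i' a \<in> Ob C" if "a \<in> Ob C'" for a using that by (auto simp: simps i')
    show "j' f \<in> hom C (i' a) (i' b)" if "f \<in> hom C' a b" for f a b
      using homE'[OF that] hom_Ar j' by metis
    show "j' (Idn C' a) = Idn C (i' a)" if "a \<in> Ob C'" for a
      using that hom_Ar[OF Idn_hom[OF C]] by (auto simp: simps i' j')
    show "j' (Cmp C' g f) = Cmp C (j' g) (j' f)" if fg: "f \<in> hom C' a b" "g \<in> hom C' b c" for a b c f g
    proof -
      obtain f' g' where f': "f' \<in> hom C (i' a) (i' b)" "f = j f'" and g': "g' \<in> hom C (i' b) (i' c)" "g = j g'"
        using homE'[OF fg(1)] homE'[OF fg(2)] by blast
      show ?thesis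
        by (simp add: f'(2) g'(2) Cmp'[OF f'(1) g'(1)] j' hom_Ar[OF f'(1)] hom_Ar[OF g'(1)]
            hom_Ar[OF Cmp_hom[OF C g'(1) f'(1)]])
    qed
  qed
  have \<Psi>: "is_functor C C' \<Psi>"
    unfolding \<Psi>_def
    using homI by (intro is_functor_record[OF C C']) (auto simp: simps(1,3) i' Cmp')
  have FO_\<Phi>: "FO \<Phi> a = i' a" if "a \<in> Ob C'" for a using that by (simp add: \<Phi>_def)
  have FA_\<Phi>: "FA \<Phi> f = j' f" if "f \<in> Ar C'" for f using that by (simp add: \<Phi>_def)
  have FO_\<Psi>: "FO \<Psi> a = i a" if "a \<in> Ob C" for a using that by (simp add: \<Psi>_def)
  have FA_\<Psi>: "FA \<Psi> f = j f" if "f \<in> Ar C" for f using that by (simp add: \<Psi>_def)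
  have "\<Psi> \<odot> \<Phi> = id_functor C'"
  proof (rule functor_eqI[OF fcomp_functor[OF \<Phi> \<Psi>] id_functor_functor[OF C']])
    show "FO (\<Psi> \<odot> \<Phi>) a = FO (id_functor C') a" if "a \<in> Ob C'" for a
      using that FO_Ob[OF \<Phi> that] i'
      by (auto simp: fcomp_FO[OF \<Phi> that] id_functor_FO FO_\<Phi> FO_\<Psi> simps(1))
    show "FA (\<Psi> \<odot> \<Phi>) f = FA (id_functor C') f" if "f \<in> hom C' a b" for a b f
      using hom_Ar[OF that] j' hom_Ar[OF FA_hom[OF \<Phi> that]]
      by (auto simp: fcomp_FA[OF \<Phi> hom_Ar[OF that]] id_functor_FA FA_\<Phi> FA_\<Psi> simps(2))
  qed
  moreover have "\<Phi> \<odot> \<Psi> = id_functor C"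
  proof (rule functor_eqI[OF fcomp_functor[OF \<Psi> \<Phi>] id_functor_functor[OF C]])
    show "FO (\<Phi> \<odot> \<Psi>) a = FO (id_functor C) a" if "a \<in> Ob C" for a
      using that by (simp add: fcomp_FO[OF \<Psi> that] id_functor_FO FO_\<Phi> FO_\<Psi> i' simps(1))
    show "FA (\<Phi> \<odot> \<Psi>) f = FA (id_functor C) f" if "f \<in> hom C a b" for a b f
      using hom_Ar[OF that]
      by (simp add: fcomp_FA[OF \<Psi> hom_Ar[OF that]] id_functor_FA FA_\<Phi> FA_\<Psi> j' simps(2))
  qed
  ultimately show thesis
    using that[of C' \<Phi> \<Psi>] \<Phi> \<Psi> simps(1,2) by (auto simp: inverse_functors_def)
qed

section \<open>Cardinalities relative to the universe\<close>

lemma small_subset: "small U Y \<Longrightarrow> X \<subseteq> Y \<Longrightarrow> small U X"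
  unfolding small_def using card_of_mono1 ordLeq_ordLess_trans by blast

lemma large_subset: "large U Y \<Longrightarrow> X \<subseteq> Y \<Longrightarrow> large U X"
  unfolding large_def using card_of_mono1 ordLeq_transitive by blast

lemma small_image: "small U X \<Longrightarrow> small U (f ` X)"
  unfolding small_def using card_of_image ordLeq_ordLess_trans by blast

lemma large_image: "large U X \<Longrightarrow> large U (f ` X)"
  unfolding large_def using card_of_image ordLeq_transitive by blast

lemma small_large: "small U X \<Longrightarrow> large U X"
  unfolding small_def large_def by (rule ordLess_imp_ordLeq)

text \<open>Regularity of the cardinal of \<open>'u\<close>, in the form \<open>stable\<close>: a
  sum of fewer than \<open>|'u|\<close> sets, each of size below \<open>|'u|\<close>, is again below
  \<open>|'u|\<close>.\<close>

lemma small_Sigma: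
  fixes U :: "'u itself"
  assumes "size_universe U" "small U X" "\<And>x. x \<in> X \<Longrightarrow> small U (Y x)"
  shows "small U (Sigma X Y)"
proof -
  have "stable |UNIV :: 'u set|"
    using assms(1) regularCard_stable[OF card_of_Card_order, of "UNIV :: 'u set"] Field_card_of[of "UNIV :: 'u set"]
    unfolding size_universe_def by metis
  then show ?thesis using assms(2,3) stable_elim unfolding small_def by blast
qed

text \<open>An infinite cardinal absorbs a sum of at most that many sets of at most that
  size.\<close>

lemma large_Sigma:
  fixes U :: "'u itself"
  assumes "size_universe U" "large U X" "\<And>x. x \<in> X \<Longrightarrow> large U (Y x)"
  shows "large U (Sigma X Y)"
  unfolding large_def
proof (rule card_of_Sigma_ordLeq_infinite)
  show "infinite (UNIV :: 'u set)" using assms(1) by (simp add: size_universe_def)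
qed (use assms(2,3) in \<open>auto simp: large_def\<close>)

lemma large_inj:
  assumes "large (U :: 'u itself) X"
  obtains i :: "'x \<Rightarrow> 'u" where "inj_on i X"
  using assms card_of_ordLeq[of X "UNIV :: 'u set"] unfolding large_def by blast

text \<open>Naming the objects and arrows of the shape by elements of \<open>'u\<close> turns it
  into one of the shapes for which limits are assumed.\<close>

lemma has_fibred_limits_small:
  fixes U :: "'u itself" and D :: "('do, 'dm) cat"
  assumes "is_functor E B p" "has_fibred_small_limits U p" "small_cat U D"
  shows "has_fibred_limits p D"
proof -
  have D: "is_cat D" "small U (Ob D)" "small U (Ar D)" using assms(3) by (auto simp: small_cat_def)
  obtain i :: "'do \<Rightarrow> 'u" where i: "inj_on i (Ob D)" using small_large[OF D(2)] by (rule large_inj)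
  obtain j :: "'dm \<Rightarrow> 'u" where j: "inj_on j (Ar D)" using small_large[OF D(3)] by (rule large_inj)
  obtain D' \<Phi> \<Psi> where D': "inverse_functors D' D \<Phi> \<Psi>" "Ob D' = i ` Ob D" "Ar D' = j ` Ar D"
    using D(1) i j by (rule isomorphic_cat)
  have "small_cat U D'"
    using D'(1) small_image[OF D(2)] small_image[OF D(3)] functor_cats(1)[of D' D]
    unfolding small_cat_def inverse_functors_def D'(2,3) by blast
  then show ?thesis
    using assms(2) has_fibred_limits_transfer[OF assms(1) D'(1)]
    by (auto simp: has_fibred_small_limits_def)
qed

lemma has_fibred_limits_large:
  fixes U :: "'u itself" and D :: "('do, 'dm) cat"
  assumes "is_functor E B p" "has_fibred_large_limits U p" "large_cat U D"
  shows "has_fibred_limits p D"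
proof -
  have D: "is_cat D" "large U (Ob D)" "large U (Ar D)" using assms(3) by (auto simp: large_cat_def)
  obtain i :: "'do \<Rightarrow> 'u" where i: "inj_on i (Ob D)" using D(2) by (rule large_inj)
  obtain j :: "'dm \<Rightarrow> 'u" where j: "inj_on j (Ar D)" using D(3) by (rule large_inj)
  obtain D' \<Phi> \<Psi> where D': "inverse_functors D' D \<Phi> \<Psi>" "Ob D' = i ` Ob D" "Ar D' = j ` Ar D"
    using D(1) i j by (rule isomorphic_cat)
  have "large_cat U D'"
    using D'(1) large_image[OF D(2)] large_image[OF D(3)] functor_cats(1)[of D' D]
    unfolding large_cat_def inverse_functors_def D'(2,3) by blast
  then show ?thesis
    using assms(2) has_fibred_limits_transfer[OF assms(1) D'(1)]
    by (auto simp: has_fibred_large_limits_def)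
qed

section \<open>Comma categories as shapes of limits\<close>

lemma comma_simps:
  assumes "is_functor A E S"
  shows "Ob (comma S X) = {(a, g). a \<in> Ob A \<and> g \<in> hom E X (FO S a)}"
    "Ar (comma S X) = {(i, f, j). i \<in> Ob (comma S X) \<and> j \<in> Ob (comma S X) \<and> f \<in> hom A (fst i) (fst j) \<and>
      Cmp E (FA S f) (snd i) = snd j}"
    "Dom (comma S X) = fst" "Cod (comma S X) = snd \<circ> snd"
    "Idn (comma S X) i = (i, Idn A (fst i), i)"
    "Cmp (comma S X) (j', f', k) (i, f, j) = (i, Cmp A f' f, k)"
  by (auto simp: comma_def functor_Src[OF assms] functor_Tgt[OF assms] Let_def fun_eq_iff)

lemma comma_hom:
  assumes "is_functor A E S"
  shows "t \<in> hom (comma S X) i j \<longleftrightarrow> i \<in> Ob (comma S X) \<and> j \<in> Ob (comma S X) \<and>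
    (\<exists>f. t = (i, f, j) \<and> f \<in> hom A (fst i) (fst j) \<and> Cmp E (FA S f) (snd i) = snd j)"
  unfolding hom_def[of "comma S X"] comma_simps(2-4)[OF assms] by (cases t) auto

lemma comma_Ob:
  assumes "is_functor A E S" "i \<in> Ob (comma S X)"
  shows "fst i \<in> Ob A" "snd i \<in> hom E X (FO S (fst i))"
  using assms(2) unfolding comma_simps(1)[OF assms(1)] by auto

lemma comma_cat:
  assumes S: "is_functor A E S"
  shows "is_cat (comma S X)"
proof (rule is_catI)
  note A = functor_cats(1)[OF S] and E = functor_cats(2)[OF S]
  note Ob = comma_Ob[OF S]
  show "Dom (comma S X) f \<in> Ob (comma S X)" "Cod (comma S X) f \<in> Ob (comma S X)"
    if "f \<in> Ar (comma S X)" for f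
    using that unfolding comma_simps(2-4)[OF S] by auto
  show "Idn (comma S X) i \<in> hom (comma S X) i i" if "i \<in> Ob (comma S X)" for i
    using that Ob[OF that] Idn_hom[OF A] Cmp_Idn[OF E Ob(2)[OF that]]
    by (simp add: comma_hom[OF S] comma_simps(5)[OF S] FA_Idn[OF S])
  fix a b f assume "f \<in> hom (comma S X) a b"
  then obtain f' where f: "f = (a, f', b)" "f' \<in> hom A (fst a) (fst b)" "Cmp E (FA S f') (snd a) = snd b"
    and ab: "a \<in> Ob (comma S X)" "b \<in> Ob (comma S X)" unfolding comma_hom[OF S] by blast
  show "Cmp (comma S X) f (Idn (comma S X) a) = f" "Cmp (comma S X) (Idn (comma S X) b) f = f"
    by (simp_all add: f(1) comma_simps(5,6)[OF S] Cmp_Idn[OF A f(2)])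
  fix c g assume "g \<in> hom (comma S X) b c"
  then obtain g' where g: "g = (b, g', c)" "g' \<in> hom A (fst b) (fst c)" "Cmp E (FA S g') (snd b) = snd c"
    and c: "c \<in> Ob (comma S X)" unfolding comma_hom[OF S] by blast
  show "Cmp (comma S X) g f \<in> hom (comma S X) a c"
    using ab c Cmp_hom[OF A g(2) f(2)] Cmp_assoc[OF E FA_hom[OF S g(2)] FA_hom[OF S f(2)] Ob(2)[OF ab(1)]] g(3) f(3)
    by (simp add: f(1) g(1) comma_simps(6)[OF S] comma_hom[OF S] FA_Cmp[OF S g(2) f(2)])
  fix d h assume "h \<in> hom (comma S X) c d"
  then obtain h' where h: "h = (c, h', d)" "h' \<in> hom A (fst c) (fst d)" unfolding comma_hom[OF S] by blast
  show "Cmp (comma S X) h (Cmp (comma S X) g f) = Cmp (comma S X) (Cmp (comma S X) h g) f"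
    by (simp add: f(1) g(1) h(1) comma_simps(6)[OF S] Cmp_assoc[OF A h(2) g(2) f(2)])
qed

lemma comma_Ob_Sigma:
  "is_functor A E S \<Longrightarrow> Ob (comma S X) = (SIGMA a:Ob A. hom E X (FO S a))"
  by (auto simp: comma_simps)

lemma comma_Ar_subset:
  "is_functor A E S \<Longrightarrow> Ar (comma S X) \<subseteq> Ob (comma S X) \<times> Ar A \<times> Ob (comma S X)"
  by (auto simp: comma_simps dest: hom_Ar)

text \<open>The objects form a sum over \<open>Ob A\<close> of hom-sets of \<open>E\<close>, and the
  arrows embed into a product of this sum with itself and \<open>Ar A\<close>. The size of the
  hom-sets of \<open>E\<close> enters here and nowhere else.\<close>

lemma comma_has_fibred_limits:
  assumes "size_universe U" "is_functor A E S" "is_functor E B p" "X \<in> Ob E"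
    and "small_homs U E \<and> small_cat U A \<and> has_fibred_small_limits U p \<or>
         large_homs U E \<and> large_cat U A \<and> has_fibred_large_limits U p"
  shows "has_fibred_limits p (comma S X)"
  using assms(5)
proof (elim disjE conjE)
  assume h: "small_homs U E" "small_cat U A" "has_fibred_small_limits U p"
  then have A: "small U (Ob A)" "small U (Ar A)" by (auto simp: small_cat_def)
  have o: "small U (Ob (comma S X))"
    unfolding comma_Ob_Sigma[OF assms(2)]
    using h(1) FO_Ob[OF assms(2)] assms(4) by (intro small_Sigma[OF assms(1) A(1)]) (auto simp: small_homs_def)
  have "small U (Ar (comma S X))"
    using o A by (intro small_subset[OF _ comma_Ar_subset[OF assms(2)]] small_Sigma[OF assms(1)])
  then show ?thesis
    using o comma_cat[OF assms(2)] by (intro has_fibred_limits_small[OF assms(3) h(3)]) (simp add: small_cat_def)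
next
  assume h: "large_homs U E" "large_cat U A" "has_fibred_large_limits U p"
  then have A: "large U (Ob A)" "large U (Ar A)" by (auto simp: large_cat_def)
  have o: "large U (Ob (comma S X))"
    unfolding comma_Ob_Sigma[OF assms(2)]
    using h(1) FO_Ob[OF assms(2)] assms(4) by (intro large_Sigma[OF assms(1) A(1)]) (auto simp: large_homs_def)
  have "large U (Ar (comma S X))"
    using o A by (intro large_subset[OF _ comma_Ar_subset[OF assms(2)]] large_Sigma[OF assms(1)])
  then show ?thesis
    using o comma_cat[OF assms(2)] by (intro has_fibred_limits_large[OF assms(3) h(3)]) (simp add: large_cat_def)
qed

section \<open>Monads and Kleisli triples\<close>

lemma is_monadD:
  assumes "is_monad B M"
  shows "is_functor B B (MF M)" "Src (MF M) = B"
    "Eta M \<in> nats B B (id_functor B) (MF M)" "Mu M \<in> nats B B (MF M \<odot> MF M) (MF M)"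
proof -
  show T: "is_functor B B (MF M)" using assms by (simp add: is_monad_def)
  show "Src (MF M) = B" by (rule functor_Src[OF T])
  show "Eta M \<in> nats B B (id_functor B) (MF M)" "Mu M \<in> nats B B (MF M \<odot> MF M) (MF M)"
    using assms unfolding is_monad_def is_nat_nats'[OF T] by auto
qed

lemma monad_eta_hom:
  assumes "is_monad B M" "I \<in> Ob B"
  shows "Comp (Eta M) I \<in> hom B I (FO (MF M) I)"
  using nats_Comp[OF is_monadD(3)[OF assms(1)] assms(2)] by (simp add: id_functor_FO[OF assms(2)])

lemma monad_mu_hom:
  assumes "is_monad B M" "I \<in> Ob B"
  shows "Comp (Mu M) I \<in> hom B (FO (MF M) (FO (MF M) I)) (FO (MF M) I)"
  using nats_Comp[OF is_monadD(4)[OF assms(1)] assms(2)]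
  by (simp add: fcomp_FO[OF is_monadD(1)[OF assms(1)] assms(2)])

lemma monad_laws:
  assumes M: "is_monad B M" and I: "I \<in> Ob B"
  shows "Cmp B (Comp (Mu M) I) (FA (MF M) (Comp (Eta M) I)) = Idn B (FO (MF M) I)"
    "Cmp B (Comp (Mu M) I) (Comp (Eta M) (FO (MF M) I)) = Idn B (FO (MF M) I)"
    "Cmp B (Comp (Mu M) I) (FA (MF M) (Comp (Mu M) I)) = Cmp B (Comp (Mu M) I) (Comp (Mu M) (FO (MF M) I))"
proof -
  note T = is_monadD(1)[OF M] and e = is_monadD(3)[OF M] and m = is_monadD(4)[OF M]
  have "Mu M \<bullet> (MF M \<lhd> Eta M) = id_nat (MF M)" "Mu M \<bullet> (Eta M \<rhd> MF M) = id_nat (MF M)"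
    and mu: "Mu M \<bullet> (MF M \<lhd> Mu M) = Mu M \<bullet> (Mu M \<rhd> MF M)"
    using M by (auto simp: is_monad_def)
  then have "Comp (Mu M \<bullet> (MF M \<lhd> Eta M)) I = Comp (id_nat (MF M)) I"
    "Comp (Mu M \<bullet> (Eta M \<rhd> MF M)) I = Comp (id_nat (MF M)) I" by simp_all
  moreover have "MF M \<lhd> Eta M \<in> nats B B (MF M) (MF M \<odot> MF M)"
    "Eta M \<rhd> MF M \<in> nats B B (MF M) (MF M \<odot> MF M)"
    using whiskL_nats[OF T e] whiskR_nats[OF T e] by (simp_all add: fcomp_id_functor[OF T])
  ultimately show "Cmp B (Comp (Mu M) I) (FA (MF M) (Comp (Eta M) I)) = Idn B (FO (MF M) I)"
    "Cmp B (Comp (Mu M) I) (Comp (Eta M) (FO (MF M) I)) = Idn B (FO (MF M) I)"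
    using I by (simp_all add: vcomp_Comp[OF m] whiskL_Comp[OF e] whiskR_Comp[OF T] id_nat_Comp[OF T])
  have "Mu M \<rhd> MF M \<in> nats B B (MF M \<odot> (MF M \<odot> MF M)) (MF M \<odot> MF M)"
    using whiskR_nats[OF T m] by (simp add: fcomp_assoc[OF T T T])
  moreover have "Comp (Mu M \<bullet> (MF M \<lhd> Mu M)) I = Comp (Mu M \<bullet> (Mu M \<rhd> MF M)) I" using mu by simp
  ultimately show "Cmp B (Comp (Mu M) I) (FA (MF M) (Comp (Mu M) I)) =
      Cmp B (Comp (Mu M) I) (Comp (Mu M) (FO (MF M) I))"
    using I by (simp add: vcomp_Comp[OF m] whiskL_Comp[OF m] whiskL_nats[OF T m]
        vcomp_Comp[OF m whiskL_nats[OF T m]] whiskR_Comp[OF T])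
qed

lemma bind_ext_hom:
  assumes M: "is_monad B M" and f: "f \<in> hom B I (FO (MF M) J)" and J: "J \<in> Ob B"
  shows "bind_ext M J f \<in> hom B (FO (MF M) I) (FO (MF M) J)"
  unfolding bind_ext_def is_monadD(2)[OF M]
  using Cmp_hom[OF functor_cats(1) monad_mu_hom[OF M J] FA_hom[OF _ f]] is_monadD(1)[OF M] by blast

lemma bind_ext_eta: "is_monad B M \<Longrightarrow> I \<in> Ob B \<Longrightarrow> bind_ext M I (Comp (Eta M) I) = Idn B (FO (MF M) I)"
  by (simp add: bind_ext_def is_monadD(2) monad_laws(1))

text \<open>Recovers the multiplication from the extension operation. It identifies the image of the
  Kleisli counit, whose components are identities, and later the multiplication of the lifted
  monad.\<close>

lemma bind_ext_Idn:
  assumes "is_monad B M" "I \<in> Ob B"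
  shows "bind_ext M I (Idn B (FO (MF M) I)) = Comp (Mu M) I"
proof -
  note T = is_monadD(1)[OF assms(1)]
  show ?thesis
    using Cmp_Idn(1)[OF functor_cats(1)[OF T] monad_mu_hom[OF assms]]
    by (simp add: bind_ext_def is_monadD(2)[OF assms(1)] FA_Idn[OF T FO_Ob[OF T assms(2)]])
qed

text \<open>Naturality of the unit moves \<open>f\<close> past it, and the unit law at
  \<open>FO (MF M) J\<close> cancels it against the multiplication.\<close>

lemma bind_ext_Cmp_eta:
  assumes M: "is_monad B M" and f: "f \<in> hom B I (FO (MF M) J)" and J: "J \<in> Ob B"
  shows "Cmp B (bind_ext M J f) (Comp (Eta M) I) = f"
proof -
  note T = is_monadD(1)[OF M]
  note B = functor_cats(1)[OF T]
  note I = hom_obj(1)[OF B f] and TJ = FO_Ob[OF T J]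
  note mu = monad_mu_hom[OF M J]
  have "Cmp B (bind_ext M J f) (Comp (Eta M) I) = Cmp B (Comp (Mu M) J) (Cmp B (FA (MF M) f) (Comp (Eta M) I))"
    using Cmp_assoc[OF B mu FA_hom[OF T f] monad_eta_hom[OF M I]] by (simp add: bind_ext_def is_monadD(2)[OF M])
  also have "\<dots> = Cmp B (Comp (Mu M) J) (Cmp B (Comp (Eta M) (FO (MF M) J)) f)"
    using nats_natural[OF is_monadD(3)[OF M] f] by (simp add: id_functor_FA[OF hom_Ar[OF f]])
  also have "\<dots> = f"
    using Cmp_assoc[OF B mu monad_eta_hom[OF M TJ] f] by (simp add: monad_laws(2)[OF M J] Cmp_Idn[OF B f])
  finally show ?thesis .
qed

text \<open>Associativity of the multiplication replaces the inner \<open>T \<mu>\<close> by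
  \<open>\<mu>\<close> at \<open>T L\<close>, and naturality of the multiplication at
  \<open>g\<close> (fact \<open>n\<close>) brings it to \<open>\<mu>\<close> at
  \<open>J\<close>.\<close>

lemma bind_ext_bind_ext:
  assumes M: "is_monad B M" and f: "f \<in> hom B I (FO (MF M) J)" and J: "J \<in> Ob B"
    and g: "g \<in> hom B J (FO (MF M) L)" and L: "L \<in> Ob B"
  shows "bind_ext M L (Cmp B (bind_ext M L g) f) = Cmp B (bind_ext M L g) (bind_ext M J f)"
proof -
  let ?T = "FO (MF M)" and ?A = "FA (MF M)" and ?m = "Comp (Mu M)"
  note T = is_monadD(1)[OF M]
  note B = functor_cats(1)[OF T]
  note TL = FO_Ob[OF T L] and c = Cmp_hom[OF B]
  note mJ = monad_mu_hom[OF M J] and mL = monad_mu_hom[OF M L] and mTL = monad_mu_hom[OF M TL]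
  note Tf = FA_hom[OF T f] and Tg = FA_hom[OF T g] and TTg = FA_hom[OF T FA_hom[OF T g]]
  have b: "bind_ext M X h = Cmp B (?m X) (?A h)" for X h by (simp add: bind_ext_def is_monadD(2)[OF M])
  have n: "Cmp B (?m (?T L)) (?A (?A g)) = Cmp B (?A g) (?m J)"
    using nats_natural[OF is_monadD(4)[OF M] g] by (simp add: fcomp_FA[OF T hom_Ar[OF g]])
  have "bind_ext M L (Cmp B (bind_ext M L g) f) = Cmp B (?m L) (Cmp B (Cmp B (?A (?m L)) (?A (?A g))) (?A f))"
    unfolding b by (simp add: FA_Cmp[OF T c[OF mL Tg] f] FA_Cmp[OF T mL Tg])
  also have "\<dots> = Cmp B (Cmp B (Cmp B (?m L) (?A (?m L))) (?A (?A g))) (?A f)"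
    using Cmp_assoc[OF B mL c[OF FA_hom[OF T mL] TTg] Tf] Cmp_assoc[OF B mL FA_hom[OF T mL] TTg] by simp
  also have "\<dots> = Cmp B (Cmp B (Cmp B (?m L) (?m (?T L))) (?A (?A g))) (?A f)"
    by (simp add: monad_laws(3)[OF M L])
  also have "\<dots> = Cmp B (Cmp B (?m L) (Cmp B (?A g) (?m J))) (?A f)"
    using Cmp_assoc[OF B mL mTL TTg] by (simp add: n)
  also have "\<dots> = Cmp B (Cmp B (Cmp B (?m L) (?A g)) (?m J)) (?A f)"
    using Cmp_assoc[OF B mL Tg mJ] by simp
  also have "\<dots> = Cmp B (bind_ext M L g) (bind_ext M J f)"
    unfolding b using Cmp_assoc[OF B c[OF mL Tg] mJ Tf] by simp
  finally show ?thesis .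
qed

text \<open>\<open>(\<eta> \<circ> f)^#\<close> is the formula by which
  \<open>monad_of_kleisli_triple\<close> defines its functor on arrows; in the base it gives back
  the action of \<open>T\<close>.\<close>

lemma bind_ext_eta_Cmp:
  assumes M: "is_monad B M" and f: "f \<in> hom B I J"
  shows "bind_ext M J (Cmp B (Comp (Eta M) J) f) = FA (MF M) f"
proof -
  note T = is_monadD(1)[OF M]
  note B = functor_cats(1)[OF T]
  note J = hom_obj(2)[OF B f]
  note eta = monad_eta_hom[OF M J]
  have "bind_ext M J (Cmp B (Comp (Eta M) J) f) =
      Cmp B (Cmp B (Comp (Mu M) J) (FA (MF M) (Comp (Eta M) J))) (FA (MF M) f)"
    using Cmp_assoc[OF B monad_mu_hom[OF M J] FA_hom[OF T eta] FA_hom[OF T f]]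
    by (simp add: bind_ext_def is_monadD(2)[OF M] FA_Cmp[OF T eta f])
  then show ?thesis by (simp add: monad_laws(1)[OF M J] Cmp_Idn[OF B FA_hom[OF T f]])
qed

section \<open>The Kleisli category and the functor K\<close>

lemma kleisli_simps:
  assumes "is_monad B M"
  shows "Ob (kleisli_cat M) = Ob B"
    "t \<in> hom (kleisli_cat M) I J \<longleftrightarrow> snd t = J \<and> J \<in> Ob B \<and> fst t \<in> hom B I (FO (MF M) J)"
    "Idn (kleisli_cat M) I = (Comp (Eta M) I, I)"
    "Cmp (kleisli_cat M) s t = (Cmp B (bind_ext M (snd s) (fst s)) (fst t), snd s)"
  by (auto simp: kleisli_cat_def is_monadD(2)[OF assms] hom_def Let_def split: prod.splits)

text \<open>That \<open>kleisli_cat M\<close> is a category is available from the functor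
  \<open>R\<close> of a lifting parameter, hence its place as an assumption. Functoriality itself
  amounts to the laws of \<open>bind_ext\<close>.\<close>

lemma kleisli_K_functor:
  assumes M: "is_monad B M" and K: "is_cat (kleisli_cat M)"
  shows "is_functor (kleisli_cat M) B (kleisli_K M)"
proof -
  note T = is_monadD(1)[OF M]
  have "is_functor (kleisli_cat M) B \<lparr>Src = kleisli_cat M, Tgt = B,
      FO = restrict (FO (MF M)) (Ob (kleisli_cat M)),
      FA = restrict (\<lambda>(f, J). bind_ext M J f) (Ar (kleisli_cat M))\<rparr>"
  proof (rule is_functor_record[OF K functor_cats(1)[OF T]])
    show "FO (MF M) a \<in> Ob B" if "a \<in> Ob (kleisli_cat M)" for a
      using FO_Ob[OF T] that by (simp add: kleisli_simps(1)[OF M])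
    show "(\<lambda>(f, J). bind_ext M J f) f \<in> hom B (FO (MF M) a) (FO (MF M) b)"
      if "f \<in> hom (kleisli_cat M) a b" for f a b
      using that bind_ext_hom[OF M] unfolding kleisli_simps(2)[OF M] by (auto split: prod.splits)
    show "(\<lambda>(f, J). bind_ext M J f) (Idn (kleisli_cat M) a) = Idn B (FO (MF M) a)"
      if "a \<in> Ob (kleisli_cat M)" for a
      using that bind_ext_eta[OF M] by (simp add: kleisli_simps[OF M])
    show "(\<lambda>(f, J). bind_ext M J f) (Cmp (kleisli_cat M) g f) =
        Cmp B ((\<lambda>(f, J). bind_ext M J f) g) ((\<lambda>(f, J). bind_ext M J f) f)"
      if "f \<in> hom (kleisli_cat M) a b" "g \<in> hom (kleisli_cat M) b c" for a b c f g
      using that bind_ext_bind_ext[OF M]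
      unfolding kleisli_simps(2)[OF M] by (auto simp: kleisli_simps(4)[OF M] split: prod.splits)
  qed
  then show ?thesis by (simp add: kleisli_K_def is_monadD(2)[OF M])
qed

lemma kleisli_K_simps:
  assumes "is_monad B M"
  shows "I \<in> Ob B \<Longrightarrow> FO (kleisli_K M) I = FO (MF M) I"
    "t \<in> hom (kleisli_cat M) I J \<Longrightarrow> FA (kleisli_K M) t = bind_ext M J (fst t)"
  using hom_Ar[of t "kleisli_cat M" I J] kleisli_simps(2)[OF assms, of t I J]
  by (auto simp: kleisli_K_def kleisli_simps(1)[OF assms] split: prod.splits)

text \<open>The equations are handled by absorbing the functor action \<open>G\<close> into an
  extension (\<open>ext_G\<close>); what is left in each case is an instance of a Kleisli triple
  law.\<close>

lemma monad_of_kleisli_triple_monad: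
  assumes K: "kleisli_triple C T0 \<eta> ext"
  shows "is_monad C (monad_of_kleisli_triple C T0 \<eta> ext)"
proof -
  have C: "is_cat C" and T0: "\<And>X. X \<in> Ob C \<Longrightarrow> T0 X \<in> Ob C"
    and \<eta>: "\<And>X. X \<in> Ob C \<Longrightarrow> \<eta> X \<in> hom C X (T0 X)"
    and ext_\<eta>: "\<And>X. X \<in> Ob C \<Longrightarrow> ext X X (\<eta> X) = Idn C (T0 X)"
    using K by (auto simp: kleisli_triple_def)
  have ext: "ext X Y g \<in> hom C (T0 X) (T0 Y)" and ext_unit: "Cmp C (ext X Y g) (\<eta> X) = g"
    if "g \<in> hom C X (T0 Y)" "Y \<in> Ob C" for X Y g
    using K that hom_obj(1)[OF C that(1)] unfolding kleisli_triple_def by blast+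
  have ext_ext: "ext X Z (Cmp C (ext Y Z g) f) = Cmp C (ext Y Z g) (ext X Y f)"
    if "f \<in> hom C X (T0 Y)" "g \<in> hom C Y (T0 Z)" "Z \<in> Ob C" for X Y Z f g
    using K that hom_obj(1)[OF C that(1)] hom_obj(1)[OF C that(2)] unfolding kleisli_triple_def by blast
  define G where "G X Y f = ext X Y (Cmp C (\<eta> Y) f)" for X Y f
  have \<eta>f: "Cmp C (\<eta> Y) f \<in> hom C X (T0 Y)" if "f \<in> hom C X Y" for X Y f
    using Cmp_hom[OF C \<eta>[OF hom_obj(2)[OF C that]] that] .
  have G: "G X Y f \<in> hom C (T0 X) (T0 Y)" if "f \<in> hom C X Y" for X Y f
    unfolding G_def by (rule ext[OF \<eta>f[OF that] hom_obj(2)[OF C that]])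
  \<comment> \<open>\<open>G X Y f\<close> is itself an extension, so \<open>ext_ext\<close> merges
    the two, and \<open>ext_unit\<close> then removes \<open>\<eta> Y\<close>.\<close>
  have ext_G: "Cmp C (ext Y Z g) (G X Y f) = ext X Z (Cmp C g f)"
    if f: "f \<in> hom C X Y" and g: "g \<in> hom C Y (T0 Z)" "Z \<in> Ob C" for X Y Z f g
  proof -
    have "Cmp C (ext Y Z g) (Cmp C (\<eta> Y) f) = Cmp C g f"
      using Cmp_assoc[OF C ext[OF g] \<eta>[OF hom_obj(2)[OF C f]] f] ext_unit[OF g] by simp
    then show ?thesis
      unfolding G_def using ext_ext[OF \<eta>f[OF f] g] by simp
  qed
  define F where "F = \<lparr>Src = C, Tgt = C, FO = restrict T0 (Ob C),
    FA = restrict (\<lambda>f. G (Dom C f) (Cod C f) f) (Ar C)\<rparr>"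
  have F: "is_functor C C F"
    unfolding F_def
  proof (rule is_functor_record[OF C C T0])
    show "G (Dom C f) (Cod C f) f \<in> hom C (T0 a) (T0 b)" if "f \<in> hom C a b" for f a b
      using G[OF that] by (simp add: hom_Dom[OF that] hom_Cod[OF that])
    show "G (Dom C (Idn C a)) (Cod C (Idn C a)) (Idn C a) = Idn C (T0 a)" if "a \<in> Ob C" for a
      using Idn_hom[OF C that] ext_\<eta>[OF that]
      by (simp add: G_def hom_Dom hom_Cod Cmp_Idn[OF C \<eta>[OF that]])
    show "G (Dom C (Cmp C g f)) (Cod C (Cmp C g f)) (Cmp C g f) =
        Cmp C (G (Dom C g) (Cod C g) g) (G (Dom C f) (Cod C f) f)"
      if f: "f \<in> hom C a b" and g: "g \<in> hom C b c" for a b c f g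
    proof -
      note gf = Cmp_hom[OF C g f] and c = hom_obj(2)[OF C g]
      have "G a c (Cmp C g f) = Cmp C (G b c g) (G a b f)"
        using ext_G[OF f \<eta>f[OF g] c] Cmp_assoc[OF C \<eta>[OF c] g f]
        unfolding G_def by simp
      then show ?thesis
        by (simp add: hom_Dom[OF f] hom_Cod[OF f] hom_Dom[OF g] hom_Cod[OF g] hom_Dom[OF gf] hom_Cod[OF gf])
    qed
  qed
  have FO: "FO F X = T0 X" if "X \<in> Ob C" for X using that by (simp add: F_def)
  have FA: "FA F f = G X Y f" if "f \<in> hom C X Y" for X Y f
    using hom_Ar[OF that] by (simp add: F_def hom_Dom[OF that] hom_Cod[OF that])
  define e where "e = \<lparr>NSrc = id_functor C, NTgt = F, Comp = restrict \<eta> (Ob C)\<rparr>"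
  define m where "m = \<lparr>NSrc = F \<odot> F, NTgt = F, Comp = restrict (\<lambda>X. ext (T0 X) X (Idn C (T0 X))) (Ob C)\<rparr>"
  have eq: "monad_of_kleisli_triple C T0 \<eta> ext = \<lparr>MF = F, Mu = m, Eta = e\<rparr>"
    by (simp add: monad_of_kleisli_triple_def Let_def F_def e_def m_def G_def)
  have eC: "Comp e X = \<eta> X" and mC: "Comp m X = ext (T0 X) X (Idn C (T0 X))" if "X \<in> Ob C" for X
    using that by (simp_all add: e_def m_def)
  note FF = fcomp_functor[OF F F]
  have FFO: "FO (F \<odot> F) X = T0 (T0 X)" if "X \<in> Ob C" for X
    using that by (simp add: fcomp_FO[OF F] FO T0)
  note i = Idn_hom[OF C T0]
  have e: "e \<in> nats C C (id_functor C) F"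
  proof (rule natsI[OF id_functor_functor[OF C] F])
    show "Cmp C (Comp e b) (FA (id_functor C) f) = Cmp C (FA F f) (Comp e a)"
      if "f \<in> hom C a b" "a \<in> Ob C" "b \<in> Ob C" for a b f
      using ext_unit[OF \<eta>f[OF that(1)] that(3)] that
      by (simp add: eC FA id_functor_FA[OF hom_Ar[OF that(1)]] G_def)
  qed (auto simp: e_def id_functor_FO FO \<eta>)
  have m: "m \<in> nats C C (F \<odot> F) F"
  proof (rule natsI[OF FF F])
    show "Comp m X \<in> hom C (FO (F \<odot> F) X) (FO F X)" if "X \<in> Ob C" for X
      using ext[OF i[OF that] that] that by (simp add: mC FFO FO)
    show "Cmp C (Comp m b) (FA (F \<odot> F) f) = Cmp C (FA F f) (Comp m a)"
      if f: "f \<in> hom C a b" and a: "a \<in> Ob C" and b: "b \<in> Ob C" for a b f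
    proof -
      \<comment> \<open>Both paths of the naturality square are the extension of
        \<open>G a b f\<close>.\<close>
      have "Cmp C (Comp m b) (FA (F \<odot> F) f) = ext (T0 a) b (G a b f)"
        using ext_G[OF G[OF f] i[OF b] b]
        by (simp add: mC[OF b] fcomp_FA[OF F hom_Ar[OF f]] FA[OF f] FA[OF G[OF f]] Cmp_Idn[OF C G[OF f]])
      also have "\<dots> = Cmp C (FA F f) (Comp m a)"
        using ext_ext[OF i[OF a] \<eta>f[OF f] b] Cmp_Idn(1)[OF C G[OF f]]
        by (simp add: mC[OF a] FA[OF f] G_def)
      finally show ?thesis .
    qed
  qed (auto simp: m_def)
  have "m \<bullet> (F \<lhd> e) = id_nat F"
  proof (rule nats_eqI[OF vcomp_nats[OF m] id_nat_nats[OF F]])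
    show Fe: "F \<lhd> e \<in> nats C C F (F \<odot> F)"
      using whiskL_nats[OF F e] by (simp add: fcomp_id_functor[OF F])
    show "Comp (m \<bullet> (F \<lhd> e)) X = Comp (id_nat F) X" if X: "X \<in> Ob C" for X
      using ext_G[OF \<eta>[OF X] i[OF X] X]
      by (simp add: vcomp_Comp[OF m Fe X] whiskL_Comp[OF e X] id_nat_Comp[OF F X] FO[OF X] mC[OF X] eC[OF X]
          FA[OF \<eta>[OF X]] Cmp_Idn[OF C \<eta>[OF X]] ext_\<eta>[OF X])
  qed
  moreover have "m \<bullet> (e \<rhd> F) = id_nat F"
  proof (rule nats_eqI[OF vcomp_nats[OF m] id_nat_nats[OF F]])
    show eF: "e \<rhd> F \<in> nats C C F (F \<odot> F)"
      using whiskR_nats[OF F e] by (simp add: fcomp_id_functor[OF F])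
    show "Comp (m \<bullet> (e \<rhd> F)) X = Comp (id_nat F) X" if X: "X \<in> Ob C" for X
      using ext_unit[OF i[OF X] X]
      by (simp add: vcomp_Comp[OF m eF X] whiskR_Comp[OF F X] id_nat_Comp[OF F X] FO[OF X] mC[OF X]
          eC[OF T0[OF X]])
  qed
  moreover have "m \<bullet> (F \<lhd> m) = m \<bullet> (m \<rhd> F)"
  proof (rule nats_eqI[OF vcomp_nats[OF m] vcomp_nats[OF m]])
    show Fm: "F \<lhd> m \<in> nats C C (F \<odot> (F \<odot> F)) (F \<odot> F)" by (rule whiskL_nats[OF F m])
    show mF: "m \<rhd> F \<in> nats C C (F \<odot> (F \<odot> F)) (F \<odot> F)"
      using whiskR_nats[OF F m] by (simp add: fcomp_assoc[OF F F F])
    fix X assume X: "X \<in> Ob C"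
    note TX = T0[OF X]
    note mX = ext[OF i[OF X] X]
    \<comment> \<open>Both sides are the extension of \<open>Comp m X\<close>: the left one by
      \<open>ext_G\<close>, the right one by \<open>ext_ext\<close> applied to two
      identities.\<close>
    show "Comp (m \<bullet> (F \<lhd> m)) X = Comp (m \<bullet> (m \<rhd> F)) X"
      using ext_G[OF mX i[OF X] X] ext_ext[OF i[OF TX] i[OF X] X] Cmp_Idn[OF C mX]
      by (simp add: vcomp_Comp[OF m Fm X] vcomp_Comp[OF m mF X] whiskL_Comp[OF m X] whiskR_Comp[OF F X]
          FO[OF X] mC[OF X] mC[OF TX] FA[OF mX])
  qed
  ultimately show ?thesis
    using F e m by (simp add: is_monad_def eq is_nat_nats'[OF F])
qed

section \<open>The pointwise codensity lifting\<close>

lemma comma_proj_functor: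
  assumes S: "is_functor A E S"
  shows "is_functor (comma S X) A (comma_proj S X)"
    "i \<in> Ob (comma S X) \<Longrightarrow> FO (comma_proj S X) i = fst i"
    "(i, f, j) \<in> Ar (comma S X) \<Longrightarrow> FA (comma_proj S X) (i, f, j) = f"
proof -
  have "is_functor (comma S X) A \<lparr>Src = comma S X, Tgt = A, FO = restrict fst (Ob (comma S X)),
      FA = restrict (\<lambda>(i, f, j). f) (Ar (comma S X))\<rparr>"
    by (rule is_functor_record[OF comma_cat[OF S] functor_cats(1)[OF S]])
      (auto simp: comma_hom[OF S] comma_simps(5,6)[OF S] dest: comma_Ob(1)[OF S])
  then show "is_functor (comma S X) A (comma_proj S X)"
    by (simp add: comma_proj_def functor_Src[OF S])
qed (auto simp: comma_proj_def)

text \<open>Naturality at an arrow of the comma category is the commuting triangle stored in that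
  arrow.\<close>

lemma comma_gamma_nats:
  assumes S: "is_functor A E S" and X: "X \<in> Ob E"
  shows "comma_gamma S X \<in> nats (comma S X) E (const_functor (comma S X) E X) (S \<odot> comma_proj S X)"
    "i \<in> Ob (comma S X) \<Longrightarrow> Comp (comma_gamma S X) i = snd i"
proof -
  note pr = comma_proj_functor[OF S]
  show c: "Comp (comma_gamma S X) i = snd i" if "i \<in> Ob (comma S X)" for i
    using that by (simp add: comma_gamma_def)
  show "comma_gamma S X \<in> nats (comma S X) E (const_functor (comma S X) E X) (S \<odot> comma_proj S X)"
  proof (rule natsI[OF const_functor_functor[OF comma_cat[OF S] functor_cats(2)[OF S] X] fcomp_functor[OF pr(1) S]])
    show "Comp (comma_gamma S X) i \<in> hom E (FO (const_functor (comma S X) E X) i) (FO (S \<odot> comma_proj S X) i)"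
      if "i \<in> Ob (comma S X)" for i
      using that comma_Ob[OF S that] by (simp add: c const_functor_FO fcomp_FO[OF pr(1)] pr(2))
    show "Cmp E (Comp (comma_gamma S X) j) (FA (const_functor (comma S X) E X) t) =
        Cmp E (FA (S \<odot> comma_proj S X) t) (Comp (comma_gamma S X) i)"
      if t: "t \<in> hom (comma S X) i j" and i: "i \<in> Ob (comma S X)" and j: "j \<in> Ob (comma S X)" for i j t
      using t hom_Ar[OF t] Cmp_Idn(1)[OF functor_cats(2)[OF S] comma_Ob(2)[OF S j]]
      unfolding comma_hom[OF S]
      by (auto simp: c i j const_functor_FA fcomp_FA[OF pr(1)] pr(3))
  qed (simp_all add: comma_gamma_def functor_Tgt[OF S])
qed

section \<open>The transformation \<open>\<delta>\<close> of a lifting parameter\<close>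

locale lifting_param =
  fixes A :: "('ao, 'am) cat" and E :: "('eo, 'em) cat" and B :: "('bo, 'bm) cat"
    and p :: "('eo, 'em, 'bo, 'bm) funct" and M :: "('bo, 'bm) monad"
    and R :: "('ao, 'am, 'bo, 'bm \<times> 'bo) funct" and S :: "('ao, 'am, 'eo, 'em) funct"
  assumes fib: "fibration E B p" and monad: "is_monad B M" and param: "lifting_parameter A E p M R S"
begin

abbreviation "T \<equiv> FO (MF M)"
abbreviation "\<delta> \<equiv> codensity_delta p M R S"
abbreviation "S\<pi> X \<equiv> S \<odot> comma_proj S X"

lemma p: "is_functor E B p"
  by (rule fibration_functor[OF fib])

lemmas E = functor_cats(1)[OF p]
  and B = functor_cats(2)[OF p]

lemma R: "is_functor A (kleisli_cat M) R"
  and S: "is_functor A E S"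
  and KR: "kleisli_K M \<odot> R = p \<odot> S"
  using param by (auto simp: lifting_parameter_def)

lemmas TF = is_monadD(1)[OF monad]
  and K = kleisli_K_functor[OF monad functor_cats(2)[OF R]]
  and comma = comma_cat[OF S]

lemma S\<pi>: "is_functor (comma S X) E (S\<pi> X)"
  by (rule fcomp_functor[OF comma_proj_functor(1)[OF S] S])

lemma S\<pi>_FO: "i \<in> Ob (comma S X) \<Longrightarrow> FO (S\<pi> X) i = FO S (fst i)"
  by (simp add: fcomp_FO[OF comma_proj_functor(1)[OF S]] comma_proj_functor(2)[OF S])

lemma S\<pi>_FA: "(i, f, j) \<in> Ar (comma S X) \<Longrightarrow> FA (S\<pi> X) (i, f, j) = FA S f"
  by (simp add: fcomp_FA[OF comma_proj_functor(1)[OF S]] comma_proj_functor(3)[OF S])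

lemma R_Ob: "a \<in> Ob A \<Longrightarrow> FO R a \<in> Ob B"
  using FO_Ob[OF R] by (simp add: kleisli_simps(1)[OF monad])

lemma p_S: "a \<in> Ob A \<Longrightarrow> FO p (FO S a) = T (FO R a)"
  using fcomp_FO[OF S, of a p] fcomp_FO[OF R, of a "kleisli_K M"] kleisli_K_simps(1)[OF monad R_Ob]
  by (simp add: KR)

text \<open>This is \<open>KR = pS\<close> on arrows. The base arrow underlying
  \<open>FA R f\<close> presents \<open>p S f\<close> as an extension, which lets associativity of
  \<open>bind_ext\<close> give the naturality of \<open>\<delta>\<close>.\<close>

lemma p_S_FA:
  assumes "f \<in> hom A a b"
  obtains r where "r \<in> hom B (FO R a) (T (FO R b))" "FA p (FA S f) = bind_ext M (FO R b) r"
proof -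
  note Rf = FA_hom[OF R assms]
  show thesis
  proof (rule that[of "fst (FA R f)"])
    show "fst (FA R f) \<in> hom B (FO R a) (T (FO R b))"
      using Rf by (simp add: kleisli_simps(2)[OF monad])
    show "FA p (FA S f) = bind_ext M (FO R b) (fst (FA R f))"
      using fcomp_FA[OF S hom_Ar[OF assms], of p] fcomp_FA[OF R hom_Ar[OF assms], of "kleisli_K M"]
        kleisli_K_simps(2)[OF monad Rf] by (simp add: KR)
  qed
qed

lemma p_snd:
  assumes "i \<in> Ob (comma S X)"
  shows "FA p (snd i) \<in> hom B (FO p X) (T (FO R (fst i)))" "FO R (fst i) \<in> Ob B"
  using FA_hom[OF p comma_Ob(2)[OF S assms]] p_S[OF comma_Ob(1)[OF S assms]]
    R_Ob[OF comma_Ob(1)[OF S assms]] by simp_all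

text \<open>The components of the counit are identities read as Kleisli arrows, so
  \<open>K \<epsilon>\<close> is the multiplication. Composed with \<open>T (p g)\<close> it yields
  the extension \<open>(p g)^#\<close>.\<close>

lemma \<delta>_Comp:
  assumes "X \<in> Ob E" "i \<in> Ob (comma S X)"
  shows "Comp (\<delta> X) i = bind_ext M (FO R (fst i)) (FA p (snd i))"
proof -
  note a = comma_Ob[OF S assms(2)]
  note Ra = R_Ob[OF a(1)]
  note TR = FO_Ob[OF TF Ra]
  have "(Idn B (T (FO R (fst i))), FO R (fst i)) \<in> hom (kleisli_cat M) (T (FO R (fst i))) (FO R (fst i))"
    using Ra Idn_hom[OF B TR] by (simp add: kleisli_simps(2)[OF monad])
  then have \<epsilon>: "FA (kleisli_K M) (Idn B (T (FO R (fst i))), FO R (fst i)) = Comp (Mu M) (FO R (fst i))"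
    using kleisli_K_simps(2)[OF monad] bind_ext_Idn[OF monad Ra] by fastforce
  have "Comp (\<delta> X) i = Cmp B (Comp (Mu M) (FO R (fst i))) (FA (MF M) (FA p (snd i)))"
    using assms a Ra TR hom_Ar[OF a(2)] functor_Src[OF S] functor_Src[OF R] functor_Src[OF K] functor_Src[OF TF]
      functor_Src[OF p] functor_Tgt[OF K] comma_proj_functor(2)[OF S assms(2)] \<epsilon>
    by (simp add: codensity_delta_def vcomp_def whiskR_def whiskL_def fcomp_def comma_gamma_def
        kleisli_counit_def const_functor_def comma_proj_def kleisli_simps(1)[OF monad])
  then show ?thesis by (simp add: bind_ext_def functor_Src[OF TF])
qed

lemma \<delta>_nats:
  assumes X: "X \<in> Ob E"
  shows "\<delta> X \<in> nats (comma S X) B (const_functor (comma S X) B (T (FO p X))) (p \<odot> S\<pi> X)"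
proof (rule natsI)
  note pX = FO_Ob[OF p X] and pr = comma_proj_functor[OF S]
  note pS = fcomp_functor[OF S\<pi> p]
  show "is_functor (comma S X) B (const_functor (comma S X) B (T (FO p X)))"
    by (rule const_functor_functor[OF comma B FO_Ob[OF TF pX]])
  show "is_functor (comma S X) B (p \<odot> S\<pi> X)" by (rule pS)
  have "NSrc (\<delta> X) = (MF M \<odot> p) \<odot> const_functor (comma S X) E X"
    by (simp add: codensity_delta_def vcomp_def whiskL_def comma_gamma_def functor_Tgt[OF S])
  then show "NSrc (\<delta> X) = const_functor (comma S X) B (T (FO p X))"
    by (simp add: fcomp_const_functor[OF comma fcomp_functor[OF p TF] X] fcomp_FO[OF p X])
  \<comment> \<open>The target \<open>K R \<pi>\<close> of the definition turns into
    \<open>p S \<pi>\<close> by the equation of the lifting parameter.\<close>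
  have "NTgt (\<delta> X) = (kleisli_K M \<odot> id_functor (kleisli_cat M)) \<odot> (R \<odot> comma_proj S X)"
    by (simp add: codensity_delta_def vcomp_def whiskR_def whiskL_def kleisli_counit_def)
  then show "NTgt (\<delta> X) = p \<odot> S\<pi> X"
    by (simp add: fcomp_id_functor[OF K] fcomp_assoc[OF pr(1) R K, symmetric] KR fcomp_assoc[OF pr(1) S p])
  show "Comp (\<delta> X) \<in> extensional (Ob (comma S X))"
    by (simp add: codensity_delta_def vcomp_def whiskR_def whiskL_def comma_gamma_def fcomp_def
        const_functor_def)
  fix i assume i: "i \<in> Ob (comma S X)"
  note a = comma_Ob[OF S i]
  show "Comp (\<delta> X) i \<in> hom B (FO (const_functor (comma S X) B (T (FO p X))) i) (FO (p \<odot> S\<pi> X) i)"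
    using bind_ext_hom[OF monad p_snd[OF i]] i
    by (simp add: \<delta>_Comp[OF X i] const_functor_FO fcomp_FO[OF S\<pi>] S\<pi>_FO p_S[OF a(1)])
next
  fix i j t assume t: "t \<in> hom (comma S X) i j" and i: "i \<in> Ob (comma S X)" and j: "j \<in> Ob (comma S X)"
  obtain f where f: "t = (i, f, j)" "f \<in> hom A (fst i) (fst j)" "Cmp E (FA S f) (snd i) = snd j"
    using t unfolding comma_hom[OF S] by blast
  obtain r where r: "r \<in> hom B (FO R (fst i)) (T (FO R (fst j)))" "FA p (FA S f) = bind_ext M (FO R (fst j)) r"
    using p_S_FA[OF f(2)] by blast
  have "FA p (snd j) = Cmp B (bind_ext M (FO R (fst j)) r) (FA p (snd i))"
    using FA_Cmp[OF p FA_hom[OF S f(2)] comma_Ob(2)[OF S i]] by (simp add: f(3) r(2))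
  \<comment> \<open>With \<open>g = snd i\<close> this reads
    \<open>(r^# \<circ> p g)^# = r^# \<circ> (p g)^#\<close>.\<close>
  then have "bind_ext M (FO R (fst j)) (FA p (snd j)) =
      Cmp B (FA p (FA S f)) (bind_ext M (FO R (fst i)) (FA p (snd i)))"
    using bind_ext_bind_ext[OF monad p_snd[OF i] r(1) p_snd(2)[OF j]] by (simp add: r(2))
  then show "Cmp B (Comp (\<delta> X) j) (FA (const_functor (comma S X) B (T (FO p X))) t) =
      Cmp B (FA (p \<odot> S\<pi> X) t) (Comp (\<delta> X) i)"
    using Cmp_Idn(1)[OF B bind_ext_hom[OF monad p_snd[OF j]]] hom_Ar[OF t]
    by (simp add: \<delta>_Comp[OF X i] \<delta>_Comp[OF X j] const_functor_FA fcomp_FA[OF S\<pi>] f(1) S\<pi>_FA)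
qed

text \<open>Liftings chosen at each object assemble into one that is cartesian in the functor
  category. Its domain lies over \<open>T(pX)!\<close>, so a fibre limit of it can be taken. This
  keeps the claim about all data from being vacuous.\<close>

lemma codensity_data_exists:
  assumes lim: "\<And>X. X \<in> Ob E \<Longrightarrow> has_fibred_limits p (comma S X)"
  shows "\<exists>db Td P. codensity_data E p M R S db Td P"
proof -
  have "\<exists>\<rho> L \<theta>. cartesian_lifting (functor_cat_map (comma S X) p) (\<delta> X) (S\<pi> X) \<rho> \<and>
      fibre_limit p (comma S X) (T (FO p X)) (NSrc \<rho>) L \<theta>" if X: "X \<in> Ob E" for X
  proof -
    obtain \<rho> G where \<rho>: "\<rho> \<in> nats (comma S X) E G (S\<pi> X)"
      and pG: "p \<odot> G = const_functor (comma S X) B (T (FO p X))" and p\<rho>: "p \<lhd> \<rho> = \<delta> X"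
      and car: "\<And>i. i \<in> Ob (comma S X) \<Longrightarrow>
        cartesian_lifting p (Comp (\<delta> X) i) (FO (S\<pi> X) i) (Comp \<rho> i)"
      using pointwise_cartesian_lifting[OF fib \<delta>_nats[OF X] S\<pi>] by metis
    have "cartesian (functor_cat_map (comma S X) p) \<rho>"
      using pointwise_cartesian[OF comma p \<rho>] car unfolding cartesian_lifting_def by blast
    then have "cartesian_lifting (functor_cat_map (comma S X) p) (\<delta> X) (S\<pi> X) \<rho>"
      using nats_NTgt[OF \<rho>] functor_cat_map_simps(2)[OF p \<rho>] p\<rho>
      by (simp add: cartesian_lifting_def functor_Src[OF functor_cat_map_functor[OF comma p]])
    moreover have "fibre_diagram p (comma S X) (T (FO p X)) (NSrc \<rho>)"
      using FO_Ob[OF TF FO_Ob[OF p X]] nats_functor(1)[OF \<rho>] pG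
      by (simp add: fibre_diagram_def functor_Src[OF p] functor_Tgt[OF p] nats_NSrc[OF \<rho>])
    ultimately show ?thesis using lim[OF X] unfolding has_fibred_limits_def by blast
  qed
  then show ?thesis unfolding codensity_data_def by metis
qed

end

section \<open>Unit and Kleisli extension for a fixed choice of data\<close>

locale codensity = lifting_param A E B p M R S
  for A :: "('ao, 'am) cat" and E :: "('eo, 'em) cat" and B :: "('bo, 'bm) cat"
    and p :: "('eo, 'em, 'bo, 'bm) funct" and M :: "('bo, 'bm) monad"
    and R :: "('ao, 'am, 'bo, 'bm \<times> 'bo) funct" and S :: "('ao, 'am, 'eo, 'em) funct" +
  fixes db :: "'eo \<Rightarrow> ('ao \<times> 'em, ('ao \<times> 'em) \<times> 'am \<times> ('ao \<times> 'em), 'eo, 'em) ntrans"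
    and Td :: "'eo \<Rightarrow> 'eo"
    and P :: "'eo \<Rightarrow> ('ao \<times> 'em, ('ao \<times> 'em) \<times> 'am \<times> ('ao \<times> 'em), 'eo, 'em) ntrans"
  assumes lim: "\<And>X. X \<in> Ob E \<Longrightarrow> has_fibred_limits p (comma S X)"
    and data: "codensity_data E p M R S db Td P"
begin

abbreviation "\<Gamma> X \<equiv> NSrc (db X)"

lemma db:
  assumes X: "X \<in> Ob E"
  shows "db X \<in> nats (comma S X) E (\<Gamma> X) (S\<pi> X)"
    "p \<odot> \<Gamma> X = const_functor (comma S X) B (T (FO p X))"
    "p \<lhd> db X = \<delta> X" "cartesian (functor_cat_map (comma S X) p) (db X)"
proof -
  have c: "cartesian_lifting (functor_cat_map (comma S X) p) (\<delta> X) (S\<pi> X) (db X)"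
    using data X by (simp add: codensity_data_def)
  note h = cartesian_lifting_hom[OF functor_cat_map_functor[OF comma p] c \<delta>_nats[OF X], simplified functor_cat_simps]
  note s = functor_cat_map_simps[OF p]
  show 1: "db X \<in> nats (comma S X) E (\<Gamma> X) (S\<pi> X)" by (rule h(1))
  show "p \<odot> \<Gamma> X = const_functor (comma S X) B (T (FO p X))"
    using h(2) s(1)[OF nats_functor(1)[OF 1]] by simp
  show "p \<lhd> db X = \<delta> X" using h(4) s(2)[OF 1] by simp
  show "cartesian (functor_cat_map (comma S X) p) (db X)" by (rule h(3))
qed

lemmas \<Gamma> = nats_functor(1)[OF db(1)]

lemma P:
  assumes X: "X \<in> Ob E"
  shows "fibre_limit p (comma S X) (T (FO p X)) (\<Gamma> X) (Td X) (P X)"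
    "Td X \<in> Ob E" "FO p (Td X) = T (FO p X)"
    "P X \<in> nats (comma S X) E (const_functor (comma S X) E (Td X)) (\<Gamma> X)"
    "p \<lhd> P X = const_nat (comma S X) B (Idn B (T (FO p X)))"
proof -
  show l: "fibre_limit p (comma S X) (T (FO p X)) (\<Gamma> X) (Td X) (P X)"
    using data X by (simp add: codensity_data_def)
  then have d: "fibre_diagram p (comma S X) (T (FO p X)) (\<Gamma> X)"
    and c: "fibre_cone p (comma S X) (T (FO p X)) (\<Gamma> X) (Td X) (P X)" by (auto simp: fibre_limit_def)
  from fibre_coneD[OF p d c] show "Td X \<in> Ob E" "FO p (Td X) = T (FO p X)"
    "P X \<in> nats (comma S X) E (const_functor (comma S X) E (Td X)) (\<Gamma> X)"
    "p \<lhd> P X = const_nat (comma S X) B (Idn B (T (FO p X)))" by blast+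
qed

text \<open>Three factorization problems share this form: those for \<open>\<eta>'\<close>, for
  \<open>f^\<flat>\<close>, and for cancelling \<open>db X\<close> in \<open>proj_cancel\<close>. In
  each the base part is a constant \<open>u!\<close>, so only equations in \<open>B\<close> remain
  to be checked, one per object.\<close>

lemma db_factor:
  assumes X: "X \<in> Ob E" and n: "n \<in> nats (comma S X) E H (S\<pi> X)"
    and H: "p \<odot> H = const_functor (comma S X) B J" and u: "u \<in> hom B J (T (FO p X))"
    and n': "\<And>i. i \<in> Ob (comma S X) \<Longrightarrow> FA p (Comp n i) = Cmp B (Comp (\<delta> X) i) u"
  shows "\<exists>!w. w \<in> nats (comma S X) E H (\<Gamma> X) \<and> p \<lhd> w = const_nat (comma S X) B u \<and> db X \<bullet> w = n"
proof (rule functor_cat_cartesianD[OF comma p db(4)[OF X] db(1)[OF X] n])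
  show cu: "const_nat (comma S X) B u \<in> nats (comma S X) B (p \<odot> H) (p \<odot> \<Gamma> X)"
    using const_nat_nats[OF comma B u] by (simp add: H db(2)[OF X])
  note \<delta> = whiskL_nats[OF p db(1)[OF X], unfolded db(3)[OF X]]
  have "p \<lhd> n = \<delta> X \<bullet> const_nat (comma S X) B u"
    by (rule nats_eqI[OF whiskL_nats[OF p n] vcomp_nats[OF \<delta> cu]])
      (simp add: whiskL_Comp[OF n] vcomp_Comp[OF \<delta> cu] const_nat_Comp n')
  then show "p \<lhd> n = (p \<lhd> db X) \<bullet> const_nat (comma S X) B u" by (simp add: db(3)[OF X])
qed

definition proj :: "'eo \<Rightarrow> 'ao \<times> 'em \<Rightarrow> 'em" where
  "proj X i = Cmp E (Comp (db X) i) (Comp (P X) i)"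

lemma P_Comp: "X \<in> Ob E \<Longrightarrow> i \<in> Ob (comma S X) \<Longrightarrow> Comp (P X) i \<in> hom E (Td X) (FO (\<Gamma> X) i)"
  using nats_Comp[OF P(4)] by (simp add: const_functor_FO)

lemma db_Comp: "X \<in> Ob E \<Longrightarrow> i \<in> Ob (comma S X) \<Longrightarrow> Comp (db X) i \<in> hom E (FO (\<Gamma> X) i) (FO S (fst i))"
  using nats_Comp[OF db(1)] by (simp add: S\<pi>_FO)

lemma proj_hom:
  assumes "X \<in> Ob E" "i \<in> Ob (comma S X)"
  shows "proj X i \<in> hom E (Td X) (FO S (fst i))"
  unfolding proj_def by (rule Cmp_hom[OF E db_Comp[OF assms] P_Comp[OF assms]])

text \<open>The limit projection is vertical, so the image comes from the cartesian factor, where it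
  is the component of \<open>\<delta>\<close>.\<close>

lemma p_proj:
  assumes X: "X \<in> Ob E" and i: "i \<in> Ob (comma S X)"
  shows "FA p (proj X i) = bind_ext M (FO R (fst i)) (FA p (snd i))"
proof -
  have "Comp (p \<lhd> db X) i = Comp (\<delta> X) i" "Comp (p \<lhd> P X) i = Comp (const_nat (comma S X) B (Idn B (T (FO p X)))) i"
    by (simp_all add: db(3)[OF X] P(5)[OF X])
  then have "FA p (Comp (db X) i) = bind_ext M (FO R (fst i)) (FA p (snd i))"
    "FA p (Comp (P X) i) = Idn B (T (FO p X))"
    using i by (simp_all add: whiskL_Comp[OF db(1)[OF X]] whiskL_Comp[OF P(4)[OF X]] \<delta>_Comp[OF X] const_nat_Comp)
  then show ?thesis
    by (simp add: proj_def FA_Cmp[OF p db_Comp[OF X i] P_Comp[OF X i]]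
        Cmp_Idn(1)[OF B bind_ext_hom[OF monad p_snd[OF i]]])
qed

text \<open>\<open>db X \<bullet> P X\<close> is a cone on \<open>S \<pi>\<close> with vertex
  \<open>Td X\<close>. The shift functor is well defined on arrows because of it.\<close>

lemma proj_natural:
  assumes X: "X \<in> Ob E" and t: "(i, f, j) \<in> hom (comma S X) i j"
  shows "Cmp E (FA S f) (proj X i) = proj X j"
proof -
  note n = vcomp_nats[OF db(1)[OF X] P(4)[OF X]]
  have ij: "i \<in> Ob (comma S X)" "j \<in> Ob (comma S X)" using hom_obj[OF comma t] .
  have "Comp (db X \<bullet> P X) k = proj X k" if "k \<in> Ob (comma S X)" for k
    using that by (simp add: proj_def vcomp_Comp[OF db(1)[OF X] P(4)[OF X]])
  with nats_natural[OF n t] show ?thesis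
    using Cmp_Idn(1)[OF E proj_hom[OF X ij(2)]] hom_Ar[OF t] by (simp add: ij const_functor_FA S\<pi>_FA)
qed

text \<open>Replaces the description operator by equations after \<open>proj\<close>, through which
  the unit and the extension are handled from here on.\<close>

lemma induced:
  assumes X: "X \<in> Ob E" and Y: "Y \<in> Ob E" and u: "u \<in> hom B (FO p Y) (T (FO p X))"
    and h: "h \<in> nats (comma S X) E (const_functor (comma S X) E Y) (\<Gamma> X)"
      "p \<lhd> h = const_nat (comma S X) B u"
    and k: "k = induced p (comma S X) (Td X) (P X) Y u h"
  shows "k \<in> hom E Y (Td X)" "FA p k = u"
    "i \<in> Ob (comma S X) \<Longrightarrow> Cmp E (proj X i) k = Cmp E (Comp (db X) i) (Comp h i)"
proof -
  have "\<exists>!k. k \<in> hom E Y (Td X) \<and> FA p k = u \<and> P X \<bullet> const_nat (comma S X) E k = h"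
    by (rule fibre_limit_induced[OF fib lim[OF X] P(1)[OF X] u Y h])
  from theI'[OF this] have "k \<in> hom E Y (Td X) \<and> FA p k = u \<and> P X \<bullet> const_nat (comma S X) E k = h"
    unfolding k induced_def functor_Src[OF p] .
  then have Pk: "P X \<bullet> const_nat (comma S X) E k = h"
    and k': "k \<in> hom E Y (Td X)" "FA p k = u" by blast+
  show "k \<in> hom E Y (Td X)" "FA p k = u" by (rule k')+
  show "Cmp E (proj X i) k = Cmp E (Comp (db X) i) (Comp h i)" if i: "i \<in> Ob (comma S X)"
  proof -
    have "Comp h i = Cmp E (Comp (P X) i) k"
      using vcomp_Comp[OF P(4)[OF X] const_nat_nats[OF comma E k'(1)] i]
      by (simp add: Pk const_nat_Comp[OF i])
    then show ?thesis
      using Cmp_assoc[OF E db_Comp[OF X i] P_Comp[OF X i] k'(1)] by (simp add: proj_def)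
  qed
qed

text \<open>Equality is recovered in two stages: cartesianness of \<open>db X\<close> cancels it
  from the whole transformations \<open>P X \<bullet> k!\<close>, and uniqueness for the limit over
  the common base arrow then identifies the arrows themselves.\<close>

lemma proj_cancel:
  assumes X: "X \<in> Ob E" and k: "k \<in> hom E Y (Td X)" and k': "k' \<in> hom E Y (Td X)"
    and pk: "FA p k = FA p k'"
    and eq: "\<And>i. i \<in> Ob (comma S X) \<Longrightarrow> Cmp E (proj X i) k = Cmp E (proj X i) k'"
  shows "k = k'"
proof -
  let ?c = "const_nat (comma S X) E" and ?d = "const_nat (comma S X) B (FA p k)"
  note Y = hom_obj(1)[OF E k]
  have u: "FA p k \<in> hom B (FO p Y) (T (FO p X))" using FA_hom[OF p k] by (simp add: P(3)[OF X])
  have Pk: "P X \<bullet> ?c h \<in> nats (comma S X) E (const_functor (comma S X) E Y) (\<Gamma> X)"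
    and pPk: "p \<lhd> (P X \<bullet> ?c h) = const_nat (comma S X) B (FA p h)"
    and dPk: "i \<in> Ob (comma S X) \<Longrightarrow> Comp (db X \<bullet> (P X \<bullet> ?c h)) i = Cmp E (proj X i) h"
    if h: "h \<in> hom E Y (Td X)" for h i
  proof -
    note c = const_nat_nats[OF comma E h]
    show n: "P X \<bullet> ?c h \<in> nats (comma S X) E (const_functor (comma S X) E Y) (\<Gamma> X)"
      by (rule vcomp_nats[OF P(4)[OF X] c])
    have ph: "FA p h \<in> hom B (FO p Y) (T (FO p X))" using FA_hom[OF p h] by (simp add: P(3)[OF X])
    show "p \<lhd> (P X \<bullet> ?c h) = const_nat (comma S X) B (FA p h)"
      by (simp add: whiskL_vcomp[OF p P(4)[OF X] c] P(5)[OF X] whiskL_const_nat[OF comma p h]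
          vcomp_const_nat[OF comma B Idn_hom[OF B hom_obj(2)[OF B ph]] ph] Cmp_Idn[OF B ph])
    show "Comp (db X \<bullet> (P X \<bullet> ?c h)) i = Cmp E (proj X i) h" if i: "i \<in> Ob (comma S X)"
      using Cmp_assoc[OF E db_Comp[OF X i] P_Comp[OF X i] h] i
      by (simp add: vcomp_Comp[OF db(1)[OF X] n] vcomp_Comp[OF P(4)[OF X] c] const_nat_Comp proj_def)
  qed
  note n = vcomp_nats[OF db(1)[OF X] Pk[OF k]] and n' = vcomp_nats[OF db(1)[OF X] Pk[OF k']]
  have "\<exists>!w. w \<in> nats (comma S X) E (const_functor (comma S X) E Y) (\<Gamma> X) \<and> p \<lhd> w = ?d \<and>
      db X \<bullet> w = db X \<bullet> (P X \<bullet> ?c k)"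
  proof (rule db_factor[OF X n _ u])
    show "p \<odot> const_functor (comma S X) E Y = const_functor (comma S X) B (FO p Y)"
      by (rule fcomp_const_functor[OF comma p Y])
    show "FA p (Comp (db X \<bullet> (P X \<bullet> ?c k)) i) = Cmp B (Comp (\<delta> X) i) (FA p k)" if "i \<in> Ob (comma S X)" for i
      using that FA_Cmp[OF p proj_hom[OF X that] k] p_proj[OF X that] by (simp add: dPk[OF k] \<delta>_Comp[OF X])
  qed
  moreover have "db X \<bullet> (P X \<bullet> ?c k') = db X \<bullet> (P X \<bullet> ?c k)"
    using n' n by (rule nats_eqI) (simp add: dPk[OF k] dPk[OF k'] eq)
  ultimately have "P X \<bullet> ?c k' = P X \<bullet> ?c k"
    using Pk[OF k] Pk[OF k'] pPk[OF k] pPk[OF k'] pk by metis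
  moreover have "\<exists>!h. h \<in> hom E Y (Td X) \<and> FA p h = FA p k \<and> P X \<bullet> ?c h = P X \<bullet> ?c k"
    by (rule fibre_limit_induced[OF fib lim[OF X] P(1)[OF X] u Y Pk[OF k] pPk[OF k]])
  ultimately show ?thesis using k k' pk by metis
qed

text \<open>The condition under which \<open>\<gamma>\<close> factors through \<open>db X\<close>
  over the unit is \<open>(p g)^# \<circ> \<eta> = p g\<close> at each
  \<open>(a, g)\<close>.\<close>

lemma eta:
  assumes X: "X \<in> Ob E"
  defines "e \<equiv> codensity_eta p M S db Td P X"
  shows "e \<in> hom E X (Td X)" "FA p e = Comp (Eta M) (FO p X)"
    "i \<in> Ob (comma S X) \<Longrightarrow> Cmp E (proj X i) e = snd i"
proof -
  note pX = FO_Ob[OF p X] and g = comma_gamma_nats[OF S X]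
  note u = monad_eta_hom[OF monad pX]
  have "\<exists>!w. w \<in> nats (comma S X) E (const_functor (comma S X) E X) (\<Gamma> X) \<and>
      p \<lhd> w = const_nat (comma S X) B (Comp (Eta M) (FO p X)) \<and> db X \<bullet> w = comma_gamma S X"
    using fcomp_const_functor[OF comma p X] bind_ext_Cmp_eta[OF monad p_snd]
    by (intro db_factor[OF X g(1) _ u]) (auto simp: g(2) \<delta>_Comp[OF X])
  from theI'[OF this] have e': "codensity_eta' p M S db X \<in> nats (comma S X) E (const_functor (comma S X) E X) (\<Gamma> X)"
    "p \<lhd> codensity_eta' p M S db X = const_nat (comma S X) B (Comp (Eta M) (FO p X))"
    "db X \<bullet> codensity_eta' p M S db X = comma_gamma S X"
    unfolding codensity_eta'_def functor_Src[OF p] functor_Tgt[OF p] is_nat_nats'[OF \<Gamma>[OF X]] by blast+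
  note i = induced[OF X X u e'(1,2), OF e_def[unfolded codensity_eta_def, THEN meta_eq_to_obj_eq]]
  show "e \<in> hom E X (Td X)" "FA p e = Comp (Eta M) (FO p X)" by (rule i(1), rule i(2))
  show "Cmp E (proj X i) e = snd i" if "i \<in> Ob (comma S X)"
    using vcomp_Comp[OF db(1)[OF X] e'(1) that] i(3)[OF that] e'(3) g(2)[OF that] by simp
qed

text \<open>The equation on \<open>\<pi>\<close> prescribes the first entry of an object and the
  \<open>A\<close>-part of an arrow, the equation on \<open>\<gamma>\<close> the second entry of an
  object. Hence at most one functor qualifies, and \<open>N0\<close> is one.\<close>

lemma shift:
  assumes X: "X \<in> Ob E" and Y: "Y \<in> Ob E" and g: "g \<in> hom E X (Td Y)"
  defines "N \<equiv> codensity_shift S db X Y (P Y \<bullet> const_nat (comma S Y) E g)"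
  shows "is_functor (comma S Y) (comma S X) N" "comma_proj S X \<odot> N = comma_proj S Y"
    "i \<in> Ob (comma S Y) \<Longrightarrow> FO N i = (fst i, Cmp E (proj Y i) g)"
proof -
  let ?f = "P Y \<bullet> const_nat (comma S Y) E g"
  define s where "s i = (fst i, Cmp E (proj Y i) g)" for i
  note c = const_nat_nats[OF comma E g]
  note f = vcomp_nats[OF P(4)[OF Y] c]
  note dbf = vcomp_nats[OF db(1)[OF Y] f]
  have dbf_Comp: "Comp (db Y \<bullet> ?f) i = Cmp E (proj Y i) g" if i: "i \<in> Ob (comma S Y)" for i
    using Cmp_assoc[OF E db_Comp[OF Y i] P_Comp[OF Y i] g] i
    by (simp add: vcomp_Comp[OF db(1)[OF Y] f] vcomp_Comp[OF P(4)[OF Y] c] const_nat_Comp proj_def)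
  have s: "s i \<in> Ob (comma S X)" if "i \<in> Ob (comma S Y)" for i
    using Cmp_hom[OF E proj_hom[OF Y that] g] comma_Ob(1)[OF S that] by (auto simp: s_def comma_simps(1)[OF S])
  define N0 where "N0 = \<lparr>Src = comma S Y, Tgt = comma S X, FO = restrict s (Ob (comma S Y)),
    FA = restrict (\<lambda>(i, f, j). (s i, f, s j)) (Ar (comma S Y))\<rparr>"
  have N0: "is_functor (comma S Y) (comma S X) N0"
    unfolding N0_def
  proof (rule is_functor_record[OF comma comma s])
    show "(\<lambda>(i, f, j). (s i, f, s j)) t \<in> hom (comma S X) (s i) (s j)" if t: "t \<in> hom (comma S Y) i j" for t i j
    proof -
      obtain f where f: "t = (i, f, j)" "f \<in> hom A (fst i) (fst j)" using t unfolding comma_hom[OF S] by blast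
      note ij = hom_obj[OF comma t]
      \<comment> \<open>Precomposing the cone \<open>proj Y\<close> with \<open>g\<close> leaves a
        cone, so the same \<open>f\<close> is an arrow between the shifted objects.\<close>
      have "Cmp E (FA S f) (Cmp E (proj Y i) g) = Cmp E (proj Y j) g"
        using Cmp_assoc[OF E FA_hom[OF S f(2)] proj_hom[OF Y ij(1)] g] proj_natural[OF Y] t f(1) by simp
      then show ?thesis using s[OF ij(1)] s[OF ij(2)] f by (simp add: comma_hom[OF S] s_def)
    qed
    show "(\<lambda>(i, f, j). (s i, f, s j)) (Idn (comma S Y) i) = Idn (comma S X) (s i)"
      if "i \<in> Ob (comma S Y)" for i
      by (simp add: comma_simps(5)[OF S] s_def)
    show "(\<lambda>(i, f, j). (s i, f, s j)) (Cmp (comma S Y) v t) =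
        Cmp (comma S X) ((\<lambda>(i, f, j). (s i, f, s j)) v) ((\<lambda>(i, f, j). (s i, f, s j)) t)"
      if "t \<in> hom (comma S Y) i j" "v \<in> hom (comma S Y) j k" for i j k t v
      using that unfolding comma_hom[OF S] by (auto simp: comma_simps(6)[OF S])
  qed
  note pX = comma_proj_functor[OF S, where X = X] and pY = comma_proj_functor[OF S, where X = Y]
    and gX = comma_gamma_nats[OF S X]
  have FO_N0: "FO N0 i = s i" if "i \<in> Ob (comma S Y)" for i using that by (simp add: N0_def)
  have FA_N0: "FA N0 (i, f, j) = (s i, f, s j)" if "(i, f, j) \<in> Ar (comma S Y)" for i f j
    using that by (simp add: N0_def)
  have pN0: "comma_proj S X \<odot> N0 = comma_proj S Y"
  proof (rule functor_eqI[OF fcomp_functor[OF N0 pX(1)] pY(1)])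
    show "FO (comma_proj S X \<odot> N0) i = FO (comma_proj S Y) i" if "i \<in> Ob (comma S Y)" for i
      using that s[OF that] by (simp add: fcomp_FO[OF N0] FO_N0 pX(2) pY(2) s_def)
    show "FA (comma_proj S X \<odot> N0) t = FA (comma_proj S Y) t" if t: "t \<in> hom (comma S Y) i j" for t i j
    proof -
      obtain f where f: "t = (i, f, j)" using t unfolding comma_hom[OF S] by blast
      note a = hom_Ar[OF t] hom_Ar[OF FA_hom[OF N0 t]]
      show ?thesis using a unfolding f by (simp add: fcomp_FA[OF N0] FA_N0 pX(3) pY(3))
    qed
  qed
  have gammaN: "comma_gamma S X \<rhd> N' \<in>
      nats (comma S Y) E (const_functor (comma S Y) E X) (S\<pi> Y)"
    if N': "is_functor (comma S Y) (comma S X) N'" "comma_proj S X \<odot> N' = comma_proj S Y" for N'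
    using whiskR_nats[OF N'(1) gX(1)]
    by (simp add: const_functor_fcomp[OF N'(1) E X] fcomp_assoc[OF N'(1) pX(1) S] N'(2))
  have gN0: "comma_gamma S X \<rhd> N0 = db Y \<bullet> ?f"
    using gammaN[OF N0 pN0] dbf
    by (rule nats_eqI) (simp add: whiskR_Comp[OF N0] FO_N0 gX(2) s dbf_Comp, simp add: s_def)
  have "N = N0"
    unfolding N_def codensity_shift_def
  proof (rule the_equality)
    show "is_functor (comma S Y) (comma S X) N0 \<and> comma_proj S X \<odot> N0 = comma_proj S Y \<and>
        comma_gamma S X \<rhd> N0 = db Y \<bullet> ?f"
      using N0 pN0 gN0 by blast
    fix N' assume "is_functor (comma S Y) (comma S X) N' \<and> comma_proj S X \<odot> N' = comma_proj S Y \<and>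
        comma_gamma S X \<rhd> N' = db Y \<bullet> ?f"
    then have N': "is_functor (comma S Y) (comma S X) N'" "comma_proj S X \<odot> N' = comma_proj S Y"
      "comma_gamma S X \<rhd> N' = db Y \<bullet> ?f" by blast+
    have FO_N': "FO N' i = s i" if i: "i \<in> Ob (comma S Y)" for i
    proof -
      note Ni = FO_Ob[OF N'(1) i]
      have "fst (FO N' i) = fst i"
        using fcomp_FO[OF N'(1) i, of "comma_proj S X"] by (simp add: N'(2) pX(2)[OF Ni] pY(2)[OF i])
      moreover have "snd (FO N' i) = Cmp E (proj Y i) g"
        using whiskR_Comp[OF N'(1) i, of "comma_gamma S X"] by (simp add: N'(3) gX(2)[OF Ni] dbf_Comp[OF i])
      ultimately show ?thesis by (simp add: s_def prod_eq_iff)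
    qed
    show "N' = N0"
    proof (rule functor_eqI[OF N'(1) N0])
      show "FO N' i = FO N0 i" if "i \<in> Ob (comma S Y)" for i using that by (simp add: FO_N' FO_N0)
      show "FA N' t = FA N0 t" if t: "t \<in> hom (comma S Y) i j" for t i j
      proof -
        obtain f where f: "t = (i, f, j)" using t unfolding comma_hom[OF S] by blast
        note ij = hom_obj[OF comma t]
        obtain f' where f': "FA N' t = (s i, f', s j)"
          using FA_hom[OF N'(1) t] unfolding comma_hom[OF S] by (auto simp: FO_N' ij)
        have "(s i, f', s j) \<in> Ar (comma S X)" using hom_Ar[OF FA_hom[OF N'(1) t]] by (simp add: f')
        moreover have "(i, f, j) \<in> Ar (comma S Y)" using hom_Ar[OF t] by (simp add: f)
        \<comment> \<open>The ends are fixed by the action on objects, and the projection sees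
          exactly the remaining middle entry.\<close>
        ultimately have "f' = f"
          using fcomp_FA[OF N'(1) hom_Ar[OF t], of "comma_proj S X"]
          by (simp add: N'(2) f' pX(3)) (simp add: f pY(3))
        then show ?thesis using f' FA_N0 hom_Ar[OF t] by (simp add: f)
      qed
    qed
  qed
  then show "is_functor (comma S Y) (comma S X) N" "comma_proj S X \<odot> N = comma_proj S Y"
    "i \<in> Ob (comma S Y) \<Longrightarrow> FO N i = (fst i, Cmp E (proj Y i) g)"
    using N0 pN0 FO_N0 by (auto simp: s_def)
qed

text \<open>The condition for \<open>f^\<flat>\<close> is associativity of extension in the base: at
  the object shifted from \<open>(a, h)\<close>, \<open>\<delta>\<close> has component
  \<open>((p h)^# \<circ> p g)^# = (p h)^# \<circ> (p g)^#\<close>. The last clause serves the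
  Kleisli laws, where \<open>proj\<close> is evaluated at shifted objects.\<close>

lemma ext:
  assumes X: "X \<in> Ob E" and Y: "Y \<in> Ob E" and g: "g \<in> hom E X (Td Y)"
  defines "k \<equiv> codensity_ext p M S db Td P X Y g"
  shows "k \<in> hom E (Td X) (Td Y)" "FA p k = bind_ext M (FO p Y) (FA p g)"
    "i \<in> Ob (comma S Y) \<Longrightarrow> Cmp E (proj Y i) k = proj X (fst i, Cmp E (proj Y i) g)"
    "i \<in> Ob (comma S Y) \<Longrightarrow> (fst i, Cmp E (proj Y i) g) \<in> Ob (comma S X)"
proof -
  define N where "N = codensity_shift S db X Y (P Y \<bullet> const_nat (comma S Y) E g)"
  define u where "u = bind_ext M (FO p Y) (FA p g)"
  define n where "n = codensity_flat p S db X Y u (P Y \<bullet> const_nat (comma S Y) E g)"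
  note N = shift[OF X Y g, folded N_def]
  note pX = FO_Ob[OF p X] and pY = FO_Ob[OF p Y]
  have pg: "FA p g \<in> hom B (FO p X) (T (FO p Y))" using FA_hom[OF p g] by (simp add: P(3)[OF Y])
  have u: "u \<in> hom B (T (FO p X)) (T (FO p Y))" unfolding u_def by (rule bind_ext_hom[OF monad pg pY])
  have NOb: "FO N i \<in> Ob (comma S X)" if "i \<in> Ob (comma S Y)" for i by (rule FO_Ob[OF N(1) that])
  then show Ob: "(fst i, Cmp E (proj Y i) g) \<in> Ob (comma S X)" if "i \<in> Ob (comma S Y)" for i
    using N(3)[OF that] that by metis
  have dN: "db X \<rhd> N \<in> nats (comma S Y) E (\<Gamma> X \<odot> N) (S\<pi> Y)"
    using whiskR_nats[OF N(1) db(1)[OF X]]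
    by (simp add: fcomp_assoc[OF N(1) comma_proj_functor(1)[OF S] S] N(2))
  have p\<Gamma>N: "p \<odot> (\<Gamma> X \<odot> N) = const_functor (comma S Y) B (T (FO p X))"
    using fcomp_assoc[OF N(1) \<Gamma>[OF X] p] const_functor_fcomp[OF N(1) B FO_Ob[OF TF pX]]
    by (simp add: db(2)[OF X])
  have "\<exists>!w. w \<in> nats (comma S Y) E (\<Gamma> X \<odot> N) (\<Gamma> Y) \<and> p \<lhd> w = const_nat (comma S Y) B u \<and>
      db Y \<bullet> w = db X \<rhd> N"
  proof (rule db_factor[OF Y dN p\<Gamma>N u])
    fix i assume i: "i \<in> Ob (comma S Y)"
    have "Comp (p \<lhd> db X) (FO N i) = Comp (\<delta> X) (FO N i)" by (simp add: db(3)[OF X])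
    then have "FA p (Comp (db X \<rhd> N) i) = bind_ext M (FO R (fst i)) (FA p (Cmp E (proj Y i) g))"
      using NOb[OF i] by (simp add: whiskR_Comp[OF N(1) i] whiskL_Comp[OF db(1)[OF X]] \<delta>_Comp[OF X] N(3)[OF i])
    also have "\<dots> = Cmp B (bind_ext M (FO R (fst i)) (FA p (snd i))) u"
      by (simp add: FA_Cmp[OF p proj_hom[OF Y i] g] p_proj[OF Y i] u_def
          bind_ext_bind_ext[OF monad pg pY p_snd[OF i]])
    finally show "FA p (Comp (db X \<rhd> N) i) = Cmp B (Comp (\<delta> Y) i) u" by (simp add: \<delta>_Comp[OF Y i])
  qed
  from theI'[OF this] have n: "n \<in> nats (comma S Y) E (\<Gamma> X \<odot> N) (\<Gamma> Y)"
    "p \<lhd> n = const_nat (comma S Y) B u" "db Y \<bullet> n = db X \<rhd> N"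
    unfolding n_def codensity_flat_def N_def functor_Tgt[OF p] is_nat_nats'[OF \<Gamma>[OF Y]] by blast+
  have PN: "P X \<rhd> N \<in> nats (comma S Y) E (const_functor (comma S Y) E (Td X)) (\<Gamma> X \<odot> N)"
    using whiskR_nats[OF N(1) P(4)[OF X]] by (simp add: const_functor_fcomp[OF N(1) E P(2)[OF X]])
  note h = vcomp_nats[OF n(1) PN]
  note iT = Idn_hom[OF B FO_Ob[OF TF pX]]
  have ph: "p \<lhd> (n \<bullet> (P X \<rhd> N)) = const_nat (comma S Y) B u"
    by (simp add: whiskL_vcomp[OF p n(1) PN] n(2) whiskLR[OF N(1) p P(4)[OF X]] P(5)[OF X]
        whiskR_const_nat[OF N(1) B iT] vcomp_const_nat[OF comma B u iT] Cmp_Idn[OF B u])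
  have k: "k = induced p (comma S Y) (Td Y) (P Y) (Td X) u (n \<bullet> (P X \<rhd> N))"
    by (simp add: k_def codensity_ext_def functor_Src[OF p] u_def n_def N_def Let_def)
  have u': "u \<in> hom B (FO p (Td X)) (T (FO p Y))" using u by (simp add: P(3)[OF X])
  note i = induced[OF Y P(2)[OF X] u' h ph k]
  show "k \<in> hom E (Td X) (Td Y)" "FA p k = bind_ext M (FO p Y) (FA p g)"
    using i(1,2) by (simp_all add: u_def)
  show "Cmp E (proj Y i) k = proj X (fst i, Cmp E (proj Y i) g)" if i': "i \<in> Ob (comma S Y)"
  proof -
    note ni = nats_Comp[OF n(1) i', unfolded fcomp_FO[OF N(1) i']]
    \<comment> \<open>Rebracketing exposes \<open>db Y \<bullet> n\<close>, which is
      \<open>db X\<close> at the shifted object; together with \<open>P X\<close> there it forms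
      \<open>proj X\<close>.\<close>
    have "Cmp E (Comp (db Y) i) (Cmp E (Comp n i) (Comp (P X) (FO N i))) =
        Cmp E (Comp (db Y \<bullet> n) i) (Comp (P X) (FO N i))"
      using Cmp_assoc[OF E db_Comp[OF Y i'] ni P_Comp[OF X NOb[OF i']]]
      by (simp add: vcomp_Comp[OF db(1)[OF Y] n(1) i'])
    then show ?thesis
      using i(3)[OF i'] by (simp add: vcomp_Comp[OF n(1) PN i'] whiskR_Comp[OF N(1) i'] n(3) N(3)[OF i'] proj_def)
  qed
qed

lemma codensity_kleisli_triple:
  "kleisli_triple E Td (codensity_eta p M S db Td P) (codensity_ext p M S db Td P)"
  (is "kleisli_triple E Td ?\<eta> ?ext")
  unfolding kleisli_triple_def
proof (intro conjI ballI)
  show "is_cat E" by (rule E)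
  show "Td X \<in> Ob E" "?\<eta> X \<in> hom E X (Td X)" if "X \<in> Ob E" for X
    using P(2)[OF that] eta(1)[OF that] .
  show "?ext X Y g \<in> hom E (Td X) (Td Y)" if "X \<in> Ob E" "Y \<in> Ob E" "g \<in> hom E X (Td Y)" for X Y g
    by (rule ext(1)[OF that])
  show "?ext X X (?\<eta> X) = Idn E (Td X)" if X: "X \<in> Ob E" for X
  proof (rule proj_cancel[OF X])
    note e = eta[OF X] and pX = FO_Ob[OF p X]
    note x = ext[OF X X e(1)]
    show "?ext X X (?\<eta> X) \<in> hom E (Td X) (Td X)" "Idn E (Td X) \<in> hom E (Td X) (Td X)"
      using x(1) Idn_hom[OF E P(2)[OF X]] .
    show "FA p (?ext X X (?\<eta> X)) = FA p (Idn E (Td X))"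
      by (simp add: x(2) e(2) bind_ext_eta[OF monad pX] FA_Idn[OF p P(2)[OF X]] P(3)[OF X])
    \<comment> \<open>Shifting along the unit sends \<open>i\<close> to
      \<open>(fst i, snd i)\<close>, that is, to \<open>i\<close> itself.\<close>
    show "Cmp E (proj X i) (?ext X X (?\<eta> X)) = Cmp E (proj X i) (Idn E (Td X))" if "i \<in> Ob (comma S X)" for i
      by (simp add: x(3)[OF that] e(3)[OF that] Cmp_Idn[OF E proj_hom[OF X that]])
  qed
  show "Cmp E (?ext X Y g) (?\<eta> X) = g" if X: "X \<in> Ob E" and Y: "Y \<in> Ob E" and g: "g \<in> hom E X (Td Y)" for X Y g
  proof (rule proj_cancel[OF Y _ g])
    note e = eta[OF X] and x = ext[OF X Y g]
    show "Cmp E (?ext X Y g) (?\<eta> X) \<in> hom E X (Td Y)" by (rule Cmp_hom[OF E x(1) e(1)])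
    have "FA p g \<in> hom B (FO p X) (T (FO p Y))" using FA_hom[OF p g] by (simp add: P(3)[OF Y])
    then show "FA p (Cmp E (?ext X Y g) (?\<eta> X)) = FA p g"
      using bind_ext_Cmp_eta[OF monad _ FO_Ob[OF p Y]] by (simp add: FA_Cmp[OF p x(1) e(1)] x(2) e(2))
    show "Cmp E (proj Y i) (Cmp E (?ext X Y g) (?\<eta> X)) = Cmp E (proj Y i) g" if i: "i \<in> Ob (comma S Y)" for i
      using Cmp_assoc[OF E proj_hom[OF Y i] x(1) e(1)] by (simp add: x(3)[OF i] e(3)[OF x(4)[OF i]])
  qed
  show "?ext X Z (Cmp E (?ext Y Z g) f) = Cmp E (?ext Y Z g) (?ext X Y f)"
    if X: "X \<in> Ob E" and Y: "Y \<in> Ob E" and Z: "Z \<in> Ob E" and f: "f \<in> hom E X (Td Y)"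
      and g: "g \<in> hom E Y (Td Z)" for X Y Z f g
  proof (rule proj_cancel[OF Z])
    note xf = ext[OF X Y f] and xg = ext[OF Y Z g]
    note gf = Cmp_hom[OF E xg(1) f]
    note x = ext[OF X Z gf]
    show "?ext X Z (Cmp E (?ext Y Z g) f) \<in> hom E (Td X) (Td Z)" by (rule x(1))
    show "Cmp E (?ext Y Z g) (?ext X Y f) \<in> hom E (Td X) (Td Z)" by (rule Cmp_hom[OF E xg(1) xf(1)])
    have "FA p f \<in> hom B (FO p X) (T (FO p Y))" "FA p g \<in> hom B (FO p Y) (T (FO p Z))"
      using FA_hom[OF p f] FA_hom[OF p g] by (simp_all add: P(3) Y Z)
    then show "FA p (?ext X Z (Cmp E (?ext Y Z g) f)) = FA p (Cmp E (?ext Y Z g) (?ext X Y f))"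
      using bind_ext_bind_ext[OF monad _ FO_Ob[OF p Y] _ FO_Ob[OF p Z]]
      by (simp add: x(2) FA_Cmp[OF p xg(1) f] FA_Cmp[OF p xg(1) xf(1)] xg(2) xf(2))
    show "Cmp E (proj Z i) (?ext X Z (Cmp E (?ext Y Z g) f)) = Cmp E (proj Z i) (Cmp E (?ext Y Z g) (?ext X Y f))"
      if i: "i \<in> Ob (comma S Z)" for i
    proof -
      let ?j = "(fst i, Cmp E (proj Z i) g)"
      \<comment> \<open>Shifting along the Kleisli composite is shifting along \<open>g\<close> and
        then along \<open>f\<close>, so both sides of the goal become
        \<open>proj X (fst i, proj Y ?j \<circ> f)\<close>.\<close>
      have "Cmp E (proj Z i) (Cmp E (?ext Y Z g) f) = Cmp E (proj Y ?j) f"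
        using Cmp_assoc[OF E proj_hom[OF Z i] xg(1) f] by (simp add: xg(3)[OF i])
      then show ?thesis
        using Cmp_assoc[OF E proj_hom[OF Z i] xg(1) xf(1)] xf(3)[OF xg(4)[OF i]]
        by (simp add: x(3)[OF i] xg(3)[OF i])
    qed
  qed
qed

text \<open>The unit and the extension lie over \<open>\<eta>\<close> and \<open>(-)^#\<close>, and
  the new monad is given by formulas in them. By \<open>bind_ext_eta_Cmp\<close> and
  \<open>bind_ext_Idn\<close> the same formulas in the base return \<open>T\<close> and
  \<open>\<mu>\<close>.\<close>

lemma codensity_monad_lifting:
  "monad_lifting E p M (monad_of_kleisli_triple E Td (codensity_eta p M S db Td P) (codensity_ext p M S db Td P))"
  (is "monad_lifting E p M ?M'")
proof -
  let ?\<eta> = "codensity_eta p M S db Td P" and ?ext = "codensity_ext p M S db Td P"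
  note M' = monad_of_kleisli_triple_monad[OF codensity_kleisli_triple]
  note F' = is_monadD(1)[OF M'] and e' = is_monadD(3)[OF M'] and m' = is_monadD(4)[OF M']
  have FO: "FO (MF ?M') X = Td X" and eC: "Comp (Eta ?M') X = ?\<eta> X"
    and mC: "Comp (Mu ?M') X = ?ext (Td X) X (Idn E (Td X))" if "X \<in> Ob E" for X
    using that by (simp_all add: monad_of_kleisli_triple_def Let_def)
  have FA: "FA (MF ?M') f = ?ext X Y (Cmp E (?\<eta> Y) f)" if "f \<in> hom E X Y" for X Y f
    using that hom_Ar[OF that] by (simp add: monad_of_kleisli_triple_def Let_def hom_Dom hom_Cod)
  have pF: "p \<odot> MF ?M' = MF M \<odot> p"
  proof (rule functor_eqI[OF fcomp_functor[OF F' p] fcomp_functor[OF p TF]])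
    show "FO (p \<odot> MF ?M') X = FO (MF M \<odot> p) X" if "X \<in> Ob E" for X
      using that by (simp add: fcomp_FO[OF F'] fcomp_FO[OF p] FO P(3))
    show "FA (p \<odot> MF ?M') f = FA (MF M \<odot> p) f" if f: "f \<in> hom E X Y" for X Y f
    proof -
      note XY = hom_obj[OF E f]
      note e = eta[OF XY(2)]
      note c = Cmp_hom[OF E e(1) f]
      show ?thesis
        using bind_ext_eta_Cmp[OF monad FA_hom[OF p f]]
        by (simp add: fcomp_FA[OF F' hom_Ar[OF f]] fcomp_FA[OF p hom_Ar[OF f]] FA[OF f] ext(2)[OF XY c]
            FA_Cmp[OF p e(1) f] e(2))
    qed
  qed
  have "p \<lhd> Eta ?M' = Eta M \<rhd> p"
  proof (rule nats_eqI)
    show "p \<lhd> Eta ?M' \<in> nats E B p (MF M \<odot> p)"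
      using whiskL_nats[OF p e'] by (simp add: fcomp_id_functor[OF p] pF)
    show "Eta M \<rhd> p \<in> nats E B p (MF M \<odot> p)"
      using whiskR_nats[OF p is_monadD(3)[OF monad]] by (simp add: fcomp_id_functor[OF p])
    show "Comp (p \<lhd> Eta ?M') X = Comp (Eta M \<rhd> p) X" if "X \<in> Ob E" for X
      using that by (simp add: whiskL_Comp[OF e'] whiskR_Comp[OF p] eC eta(2))
  qed
  moreover have "p \<lhd> Mu ?M' = Mu M \<rhd> p"
  proof (rule nats_eqI)
    have "p \<odot> (MF ?M' \<odot> MF ?M') = (MF M \<odot> MF M) \<odot> p"
      by (simp add: fcomp_assoc[OF F' F' p, symmetric] pF fcomp_assoc[OF F' p TF] fcomp_assoc[OF p TF TF])
    then show "p \<lhd> Mu ?M' \<in> nats E B ((MF M \<odot> MF M) \<odot> p) (MF M \<odot> p)"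
      using whiskL_nats[OF p m'] by (simp add: pF)
    show "Mu M \<rhd> p \<in> nats E B ((MF M \<odot> MF M) \<odot> p) (MF M \<odot> p)"
      by (rule whiskR_nats[OF p is_monadD(4)[OF monad]])
    show "Comp (p \<lhd> Mu ?M') X = Comp (Mu M \<rhd> p) X" if X: "X \<in> Ob E" for X
      using ext(2)[OF P(2)[OF X] X Idn_hom[OF E P(2)[OF X]]] bind_ext_Idn[OF monad FO_Ob[OF p X]]
      by (simp add: whiskL_Comp[OF m' X] whiskR_Comp[OF p X] mC[OF X] FA_Idn[OF p P(2)[OF X]] P(3)[OF X])
  qed
  ultimately show ?thesis using M' pF by (simp add: monad_lifting_def)
qed

end

theorem theorem7p1:
  fixes U :: "'u itself"
    and A :: "('ao, 'am) cat" and E :: "('eo, 'em) cat" and B :: "('bo, 'bm) cat"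
    and p :: "('eo, 'em, 'bo, 'bm) funct" and M :: "('bo, 'bm) monad"
    and R :: "('ao, 'am, 'bo, 'bm \<times> 'bo) funct" and S :: "('ao, 'am, 'eo, 'em) funct"
  assumes "size_universe U"
    and "fibration E B p"
    and "is_monad B M"
    and "lifting_parameter A E p M R S"
    and "small_homs U E \<and> small_cat U A \<and> has_fibred_small_limits U p \<or>
         large_homs U E \<and> large_cat U A \<and> has_fibred_large_limits U p"
  shows "(\<exists>db Td P. codensity_data E p M R S db Td P) \<and>
    (\<forall>db Td P. codensity_data E p M R S db Td P \<longrightarrow>
       kleisli_triple E Td (codensity_eta p M S db Td P) (codensity_ext p M S db Td P) \<and>
       monad_lifting E p M
         (monad_of_kleisli_triple E Td (codensity_eta p M S db Td P)
            (codensity_ext p M S db Td P)))"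
proof -
  interpret lifting_param A E B p M R S
    using assms(2-4) by unfold_locales
  \<comment> \<open>The two size regimes serve only to obtain this fact; afterwards the argument is
    the same for both.\<close>
  have lim: "has_fibred_limits p (comma S X)" if "X \<in> Ob E" for X
    by (rule comma_has_fibred_limits[OF assms(1) S p that assms(5)])
  have "\<exists>db Td P. codensity_data E p M R S db Td P"
    by (rule codensity_data_exists) (rule lim)
  moreover have "codensity A E B p M R S db Td P" if "codensity_data E p M R S db Td P" for db Td P
    using lim that by unfold_locales
  ultimately show ?thesis
    by (blast intro: codensity.codensity_kleisli_triple codensity.codensity_monad_lifting)
qed

end
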